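(* For every hereditary graph property $\mathcal{P}$ there are functions $M_{\mathcal{P}},s_{\mathcal{P}}:(0,1)\to\mathbb{N}$ such that for every $\varepsilon\in(0,1)$, the property $\mathcal{P}$ is $\varepsilon$-testable in the VDF model with one-sided error and sample complexity $s_{\mathcal{P}}(\varepsilon)$, under the promise that inputs $(G,\mathcal{D})$ always satisfy $|V(G)|\ge M_{\mathcal{P}}(\varepsilon)$.
   Context: All graphs are finite, simple, undirected, with nonempty vertex set. A graph property is a family of graphs closed under isomorphism; it is hereditary if it is closed under removal of vertices. A vertex-weighted graph is a pair $(G,\mathcal{D})$ with $G$ a graph and $\mathcal{D}$ a probability distribution on $V(G)$ (weight $0$ is allowed). For graphs $G_1,G_2$ on the same vertex set $V$ and a distribution $\mathcal{D}$ on $V$, their distance with respect to $\mathcal{D}$ is $\sum_{\{x,y\}\in E(G_1)\triangle E(G_2)}\mathcal{D}(x)\mathcal{D}(y)$. $(G,\mathcal{D})$ is $\varepsilon$-far from $\mathcal{P}$ if for every $G'\in\mathcal{P}$ with $V(G')=V(G)$ the distance between $G$ and $G'$ with respect to $\mathcal{D}$ is at least $\varepsilon$ (vacuously true if no such $G'$ exists). VDF model. The input is $(G,\mathcal{D})$, with $\mathcal{D}$ unknown to the algorithm. A (randomized) algorithm accesses the input only by drawing independent random vertices distributed according to $\mathcal{D}$ (it can tell whether two samples are the same vertex, but vertex names carry no other information) and by edge queries "is $\{u,v\}$ an edge of $G$?" for sampled vertices $u,v$; it is not given $|V(G)|$. There is no restriction on computation. $\mathcal{P}$ is $\varepsilon$-testable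 with one-sided error and sample complexity $s$ under a promise on inputs if there is such an algorithm, drawing at most $s$ vertices, which for every $(G,\mathcal{D})$ fulfilling the promise accepts with probability $1$ if $G\in\mathcal{P}$ and rejects with probability at least $2/3$ if $(G,\mathcal{D})$ is $\varepsilon$-far from $\mathcal{P}$. *)

theory Defs
  imports "HOL-Probability.Probability_Mass_Function"
begin

section \<open>Graphs and hereditary properties\<close>

record 'a ugraph =
  verts :: "'a set"
  edges :: "'a set set"

definition simple_graph :: "'a ugraph \<Rightarrow> bool" where
  "simple_graph G \<longleftrightarrow>
     finite (verts G) \<and> verts G \<noteq> {} \<and> edges G \<subseteq> {e. e \<subseteq> verts G \<and> card e = 2}"

definition isomorphic_graphs :: "'a ugraph \<Rightarrow> 'b ugraph \<Rightarrow> bool" where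
  "isomorphic_graphs G H \<longleftrightarrow>
     (\<exists>f. bij_betw f (verts G) (verts H) \<and> edges H = (\<lambda>e. f ` e) ` edges G)"

definition graph_property :: "'a ugraph set \<Rightarrow> bool" where
  "graph_property P \<longleftrightarrow>
     (\<forall>G\<in>P. simple_graph G) \<and> (\<forall>G\<in>P. \<forall>H. isomorphic_graphs G H \<longrightarrow> H \<in> P)"

definition remove_vertex :: "'a ugraph \<Rightarrow> 'a \<Rightarrow> 'a ugraph" where
  "remove_vertex G v = \<lparr>verts = verts G - {v}, edges = {e \<in> edges G. v \<notin> e}\<rparr>"

text \<open>The last remaining vertex is never removed, since graphs have a nonempty vertex set.\<close>

definition hereditary_property :: "'a ugraph set \<Rightarrow> bool" where
  "hereditary_property P \<longleftrightarrow>
     graph_property P \<and>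
     (\<forall>G\<in>P. \<forall>v\<in>verts G. verts G \<noteq> {v} \<longrightarrow> remove_vertex G v \<in> P)"


section \<open>Vertex-weighted graphs and distance\<close>

definition weighted_graph :: "'a ugraph \<Rightarrow> 'a pmf \<Rightarrow> bool" where
  "weighted_graph G D \<longleftrightarrow> simple_graph G \<and> set_pmf D \<subseteq> verts G"

text \<open>Edges are two-element sets, so the product contributes \<open>D(x) D(y)\<close> for \<open>e = {x, y}\<close>.\<close>

definition graph_dist :: "'a pmf \<Rightarrow> 'a ugraph \<Rightarrow> 'a ugraph \<Rightarrow> real" where
  "graph_dist D G H =
     (\<Sum>e \<in> (edges G - edges H) \<union> (edges H - edges G). \<Prod>x\<in>e. pmf D x)"

definition far_from :: "real \<Rightarrow> 'a ugraph \<Rightarrow> 'a pmf \<Rightarrow> 'a ugraph set \<Rightarrow> bool" where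
  "far_from \<epsilon> G D P \<longleftrightarrow> (\<forall>H\<in>P. verts H = verts G \<longrightarrow> \<epsilon> \<le> graph_dist D G H)"


section \<open>The VDF model\<close>

text \<open>
  A tester is a well-founded strategy tree. \<open>Random q f\<close> uses internal randomness of
  the algorithm, \<open>Draw t\<close> samples one more vertex from the unknown distribution.
  Sampled vertices are addressed only by their position in the sequence of samples,
  and the only information available about the \<open>i\<close>-th and \<open>j\<close>-th sample is whether
  they are the same vertex and whether they are adjacent. The type of testers does not
  mention the vertex type. Arbitrary functions as continuations reflect that
  computation is unrestricted.
\<close>

datatype vdf_tester =
    Verdict bool
  | Random "nat pmf" "nat \<Rightarrow> vdf_tester"
  | Draw vdf_tester
  | Same_Vertex nat nat "bool \<Rightarrow> vdf_tester"
  | Edge_Query nat nat "bool \<Rightarrow> vdf_tester"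

text \<open>
  The distribution of the verdict (\<open>True\<close> means accept) when the samples
  drawn so far are \<open>xs\<close>. Questions about positions not yet sampled get the answer
  \<open>False\<close>.
\<close>

primrec run_tester :: "'a ugraph \<Rightarrow> 'a pmf \<Rightarrow> vdf_tester \<Rightarrow> 'a list \<Rightarrow> bool pmf" where
  "run_tester G D (Verdict b) xs = return_pmf b"
| "run_tester G D (Random q f) xs = bind_pmf q (\<lambda>n. run_tester G D (f n) xs)"
| "run_tester G D (Draw t) xs = bind_pmf D (\<lambda>v. run_tester G D t (xs @ [v]))"
| "run_tester G D (Same_Vertex i j f) xs =
     run_tester G D (f (i < length xs \<and> j < length xs \<and> xs ! i = xs ! j)) xs"
| "run_tester G D (Edge_Query i j f) xs =
     run_tester G D (f (i < length xs \<and> j < length xs \<and> {xs ! i, xs ! j} \<in> edges G)) xs"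

inductive draws_at_most :: "nat \<Rightarrow> vdf_tester \<Rightarrow> bool" where
  "draws_at_most n (Verdict b)"
| "(\<And>k. k \<in> set_pmf q \<Longrightarrow> draws_at_most n (f k)) \<Longrightarrow> draws_at_most n (Random q f)"
| "draws_at_most n t \<Longrightarrow> draws_at_most (Suc n) (Draw t)"
| "(\<And>b. draws_at_most n (f b)) \<Longrightarrow> draws_at_most n (Same_Vertex i j f)"
| "(\<And>b. draws_at_most n (f b)) \<Longrightarrow> draws_at_most n (Edge_Query i j f)"

definition vdf_testable_one_sided ::
  "'a ugraph set \<Rightarrow> real \<Rightarrow> nat \<Rightarrow> ('a ugraph \<Rightarrow> 'a pmf \<Rightarrow> bool) \<Rightarrow> bool" where
  "vdf_testable_one_sided P \<epsilon> s promise \<longleftrightarrow>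
     (\<exists>T. draws_at_most s T \<and>
        (\<forall>G D. weighted_graph G D \<and> promise G D \<longrightarrow>
           (G \<in> P \<longrightarrow> pmf (run_tester G D T []) True = 1) \<and>
           (far_from \<epsilon> G D P \<longrightarrow> pmf (run_tester G D T []) False \<ge> 2 / 3)))"

end

theory Submission
  imports Defs "HOL-Library.Ramsey"
begin

text \<open>
  Call a graph extendable if it is contained in arbitrarily large members of \<open>P\<close>. The
  tester accepts iff the sampled graph is extendable. For a fixed number \<open>s\<close> of samples
  there are finitely many possible sampled graphs, so for a suitable \<open>M\<close> those contained in
  some member of \<open>P\<close> with at least \<open>M\<close> vertices are all extendable; hence the
  one-sided error.

  Soundness follows the method of Alon and Shapira, with vertex weights. Take a partition and
  a refinement of it that is regular, with an error that is small in terms of the size of the coarse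
  partition, and whose energy is larger by a small constant only. Represent each coarse class
  by a random fine class. Make the adjacency between two coarse classes empty or complete if
  the density between their representatives is near 0 or 1, and turn each coarse class into a
  clique or an independent set, whichever its representative contains many of by Ramsey's
  theorem. This changes little. If the result is not extendable, then neither is some graph
  of bounded size that is compatible with the reduced graph, and by regularity the input
  contains many copies of it.

  Heavy vertices cannot be cloned. The refinement splits them off as singleton classes, and
  their total weight is added to the energy, so that few of them are new in a step that does
  not increase this potential. Classes that are too light or consist mainly of new heavy
  vertices are discarded: the modified graph on the other vertices, being extendable, extends
  to a member of \<open>P\<close> on the whole vertex set, at the cost of the discarded weight.
\<close>

section \<open>Weighted graphs and the energy of a partition\<close>

text \<open>The constants must not depend on each other in a circle. The number \<open>k\<close> of
  coarse classes determines the size \<open>m\<close> of the forbidden graphs to look for, through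
  finitely many reduced graphs and without explicit bound. The Ramsey density \<open>c0\<close> and
  the threshold \<open>\<tau>\<close> depend on \<open>m\<close>, the regularity
  \<open>\<eta>\<close> on these, and on \<open>\<eta>\<close> the number \<open>K\<close> of fine
  classes and the weight \<open>\<theta>\<close> from which a vertex counts as heavy. Whether a
  coarse partition is good enough shows only at the end of this chain. If the refinement, with the
  heavy vertices split off, raises the potential by more than \<epsilon>^3/8000, it becomes the next
  coarse partition and all constants are chosen afresh. The potential lies between 0 and 2, so the
  number of rounds is bounded in terms of \<epsilon>. All tolerances within a round equal \<zeta> =
  \<epsilon>/10, and \<epsilon>^3/8000 = \<zeta>^3/8 is what makes the expected cost of random
  representatives at most \<zeta>. Heavy vertices matter since Ramsey's theorem is applied to
  samples: these must be distinct, which fails where a single vertex carries much of the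
  weight.\<close>

locale wgraph =
  fixes V :: "'a set" and \<mu> :: "'a \<Rightarrow> real" and a :: "'a \<Rightarrow> 'a \<Rightarrow> bool"
  assumes finite_V [simp, intro]: "finite V"
    and weight_nonneg [simp]: "0 \<le> \<mu> x"
    and weight_total: "sum \<mu> V = 1"
    and adj_sym: "a x y \<longleftrightarrow> a y x"
begin

abbreviation mass :: "'a set \<Rightarrow> real" where "mass X \<equiv> sum \<mu> X"

text \<open>A partition of \<open>V\<close> is coded as a labelling by naturals. That it has at most
  \<open>k\<close> classes is expressed by labels in \<open>{..<k}\<close>; cells may be
  empty.\<close>

definition cell :: "('a \<Rightarrow> nat) \<Rightarrow> nat \<Rightarrow> 'a set" where
  "cell q i = {x \<in> V. q x = i}"

text \<open>The weight of adjacent ordered pairs for \<open>d = 0\<close>, and the discrepancy from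
  the expected weight when \<open>d\<close> is the density of the pair.\<close>

definition cut :: "real \<Rightarrow> 'a set \<Rightarrow> 'a set \<Rightarrow> real" where
  "cut d S T = (\<Sum>x\<in>S. \<Sum>y\<in>T. \<mu> x * \<mu> y * (of_bool (a x y) - d))"

text \<open>A cell of weight zero gets density 0 from division by zero. This is harmless, since all
  cuts involving it vanish.\<close>

definition dens :: "('a \<Rightarrow> nat) \<Rightarrow> nat \<Rightarrow> nat \<Rightarrow> real" where
  "dens q i j = cut 0 (cell q i) (cell q j) / (mass (cell q i) * mass (cell q j))"

definition avg :: "('a \<Rightarrow> 'a \<Rightarrow> real) \<Rightarrow> real" where
  "avg f = (\<Sum>x\<in>V. \<Sum>y\<in>V. \<mu> x * \<mu> y * f x y)"

text \<open>The squared L2 norm of the conditional expectation of adjacency given the pair of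
  cells.\<close>

definition energy :: "('a \<Rightarrow> nat) \<Rightarrow> real" where
  "energy q = avg (\<lambda>x y. (dens q (q x) (q y))\<^sup>2)"

definition refines :: "('a \<Rightarrow> nat) \<Rightarrow> ('a \<Rightarrow> nat) \<Rightarrow> bool" where
  "refines r q \<longleftrightarrow> (\<forall>x\<in>V. \<forall>y\<in>V. r x = r y \<longrightarrow> q x = q y)"

lemma finite_cell [simp, intro]: "finite (cell q i)"
  by (simp add: cell_def)

lemma cell_subset: "cell q i \<subseteq> V"
  by (auto simp: cell_def)

lemma mass_nonneg [simp]: "0 \<le> mass X"
  by (simp add: sum_nonneg)

lemma mass_mono: "X \<subseteq> Y \<Longrightarrow> Y \<subseteq> V \<Longrightarrow> mass X \<le> mass Y"
  by (meson finite_V finite_subset sum_mono2 weight_nonneg)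

lemma mass_le_1: "X \<subseteq> V \<Longrightarrow> mass X \<le> 1"
  using mass_mono[of X V] weight_total by simp

lemma cut_shift: "cut d S T = cut 0 S T - mass S * mass T * d"
proof -
  have "cut d S T = cut 0 S T - (\<Sum>x\<in>S. \<Sum>y\<in>T. \<mu> x * \<mu> y * d)"
    unfolding cut_def by (simp add: sum_subtractf[symmetric] algebra_simps)
  also have "(\<Sum>x\<in>S. \<Sum>y\<in>T. \<mu> x * \<mu> y * d) = mass S * mass T * d"
    unfolding sum_product by (simp only: sum_distrib_right)
  finally show ?thesis .
qed

lemma cut_dens: "cut (dens q i j) (cell q i) (cell q j) = 0"
proof (cases "mass (cell q i) * mass (cell q j) = 0")
  case True
  then have "(\<forall>x\<in>cell q i. \<mu> x = 0) \<or> (\<forall>x\<in>cell q j. \<mu> x = 0)"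
    by (auto simp: sum_nonneg_eq_0_iff)
  then show ?thesis
    unfolding cut_def by (auto intro!: sum.neutral)
next
  case False
  then show ?thesis
    unfolding cut_shift[of "dens q i j"] by (simp add: dens_def)
qed

lemma sum_cells:
  fixes f :: "'a \<Rightarrow> real"
  assumes "q ` V \<subseteq> I" "finite I"
  shows "sum f V = (\<Sum>i\<in>I. sum f (cell q i))"
  unfolding cell_def using sum.group[OF finite_V assms(2,1), of f] by simp

lemma sum2_cells:
  fixes f :: "'a \<Rightarrow> 'a \<Rightarrow> real"
  assumes "q ` V \<subseteq> I" "finite I"
  shows "(\<Sum>x\<in>V. \<Sum>y\<in>V. f x y) = (\<Sum>i\<in>I. \<Sum>j\<in>I. \<Sum>x\<in>cell q i. \<Sum>y\<in>cell q j. f x y)"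
proof -
  have "(\<Sum>x\<in>V. \<Sum>y\<in>V. f x y) = (\<Sum>i\<in>I. \<Sum>x\<in>cell q i. \<Sum>j\<in>I. \<Sum>y\<in>cell q j. f x y)"
    by (simp add: sum_cells[OF assms])
  also have "\<dots> = (\<Sum>i\<in>I. \<Sum>j\<in>I. \<Sum>x\<in>cell q i. \<Sum>y\<in>cell q j. f x y)"
    by (intro sum.cong refl sum.swap)
  finally show ?thesis .
qed

lemma avg_add: "avg (\<lambda>x y. f x y + g x y) = avg f + avg g"
  by (simp add: avg_def sum.distrib algebra_simps)

lemma avg_diff: "avg (\<lambda>x y. f x y - g x y) = avg f - avg g"
  by (simp add: avg_def sum_subtractf algebra_simps)

lemma avg_cmult: "avg (\<lambda>x y. c * f x y) = c * avg f"
  by (simp add: avg_def sum_distrib_left mult_ac)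

lemma avg_const: "avg (\<lambda>x y. c) = c"
proof -
  have "avg (\<lambda>x y. c) = c * (sum \<mu> V * sum \<mu> V)"
    unfolding avg_def by (simp add: sum_product sum_distrib_left mult_ac)
  then show ?thesis by (simp add: weight_total)
qed

lemma avg_mono:
  assumes "\<And>x y. x \<in> V \<Longrightarrow> y \<in> V \<Longrightarrow> f x y \<le> g x y"
  shows "avg f \<le> avg g"
  unfolding avg_def using assms by (intro sum_mono mult_left_mono) auto

lemma avg_cong:
  assumes "\<And>x y. x \<in> V \<Longrightarrow> y \<in> V \<Longrightarrow> f x y = g x y"
  shows "avg f = avg g"
  unfolding avg_def using assms by (intro sum.cong) auto

lemma avg_nonneg: "(\<And>x y. x \<in> V \<Longrightarrow> y \<in> V \<Longrightarrow> 0 \<le> f x y) \<Longrightarrow> 0 \<le> avg f"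
  unfolding avg_def by (intro sum_nonneg) auto

text \<open>The densities are the orthogonal projection of adjacency to functions constant on pairs
  of cells, so both have the same inner product with each such \<open>h\<close>. On a single pair of
  cells this is \<open>cut_dens\<close>.\<close>

lemma dens_projection:
  assumes h: "\<And>x x' y y'. \<lbrakk>x \<in> V; x' \<in> V; y \<in> V; y' \<in> V; q x = q x'; q y = q y'\<rbrakk> \<Longrightarrow> h x y = h x' y'"
  shows "avg (\<lambda>x y. of_bool (a x y) * h x y) = avg (\<lambda>x y. dens q (q x) (q y) * h x y)"
proof -
  have "avg (\<lambda>x y. (of_bool (a x y) - dens q (q x) (q y)) * h x y) = 0"
    unfolding avg_def
    unfolding sum2_cells[of q "q ` V", OF order_refl finite_imageI[OF finite_V]]
  proof (rule sum.neutral, rule ballI, rule sum.neutral, rule ballI)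
    fix i j assume ij: "i \<in> q ` V" "j \<in> q ` V"
    then obtain x0 y0 where xy: "x0 \<in> cell q i" "y0 \<in> cell q j"
      by (auto simp: cell_def)
    have "(\<Sum>x\<in>cell q i. \<Sum>y\<in>cell q j. \<mu> x * \<mu> y * ((of_bool (a x y) - dens q (q x) (q y)) * h x y))
       = (\<Sum>x\<in>cell q i. \<Sum>y\<in>cell q j. h x0 y0 * (\<mu> x * \<mu> y * (of_bool (a x y) - dens q i j)))"
    proof (intro sum.cong refl)
      fix x y assume "x \<in> cell q i" "y \<in> cell q j"
      moreover from this have "h x y = h x0 y0"
        using xy by (intro h) (auto simp: cell_def)
      ultimately show "\<mu> x * \<mu> y * ((of_bool (a x y) - dens q (q x) (q y)) * h x y) =
          h x0 y0 * (\<mu> x * \<mu> y * (of_bool (a x y) - dens q i j))"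
        by (auto simp: cell_def)
    qed
    also have "\<dots> = h x0 y0 * cut (dens q i j) (cell q i) (cell q j)"
      unfolding cut_def by (simp add: sum_distrib_left)
    finally show "(\<Sum>x\<in>cell q i. \<Sum>y\<in>cell q j. \<mu> x * \<mu> y * ((of_bool (a x y) - dens q (q x) (q y)) * h x y)) = 0"
      by (simp add: cut_dens)
  qed
  then show ?thesis by (simp add: left_diff_distrib avg_diff)
qed

lemma cut0_bounds: "0 \<le> cut 0 S T" "finite S \<Longrightarrow> finite T \<Longrightarrow> cut 0 S T \<le> mass S * mass T"
proof -
  show "0 \<le> cut 0 S T" unfolding cut_def by (auto intro!: sum_nonneg)
  show "cut 0 S T \<le> mass S * mass T"
    unfolding cut_def sum_product by (intro sum_mono) (auto simp: mult_left_le)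
qed

lemma dens_nonneg: "0 \<le> dens q i j"
  unfolding dens_def by (simp add: cut0_bounds)

lemma dens_le_1: "dens q i j \<le> 1"
  unfolding dens_def using cut0_bounds(2)[of "cell q i" "cell q j"]
  by (intro divide_le_eq_1[THEN iffD2]) (auto simp: less_le)

lemma cut_sym: "cut d S T = cut d T S"
  unfolding cut_def by (subst sum.swap) (simp add: mult_ac adj_sym)

lemma dens_sym: "dens q i j = dens q j i"
  unfolding dens_def by (simp add: cut_sym mult_ac)

lemma energy_nonneg: "0 \<le> energy q"
  unfolding energy_def by (rule avg_nonneg) simp

lemma energy_le_1: "energy q \<le> 1"
proof -
  have "energy q \<le> avg (\<lambda>x y. 1)"
    unfolding energy_def by (rule avg_mono) (simp add: power_le_one dens_nonneg dens_le_1)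
  then show ?thesis by (simp add: avg_const)
qed

text \<open>Pythagoras: the densities of \<open>q\<close> are the projection of the densities of the
  refinement \<open>r\<close>.\<close>

lemma energy_diff:
  assumes "refines r q"
  shows "avg (\<lambda>x y. (dens r (r x) (r y) - dens q (q x) (q y))\<^sup>2) = energy r - energy q"
proof -
  have 1: "avg (\<lambda>x y. dens r (r x) (r y) * dens q (q x) (q y)) =
        avg (\<lambda>x y. of_bool (a x y) * dens q (q x) (q y))"
    using assms by (intro dens_projection[symmetric]) (metis refines_def)
  also have "\<dots> = energy q"
    unfolding energy_def power2_eq_square by (intro dens_projection) simp
  finally have 2: "avg (\<lambda>x y. 2 * (dens r (r x) (r y) * dens q (q x) (q y))) = 2 * energy q"
    by (simp add: avg_cmult)
  have "avg (\<lambda>x y. (dens r (r x) (r y) - dens q (q x) (q y))\<^sup>2) =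
     avg (\<lambda>x y. (dens r (r x) (r y))\<^sup>2 + (dens q (q x) (q y))\<^sup>2 - 2 * (dens r (r x) (r y) * dens q (q x) (q y)))"
    by (intro avg_cong) (simp add: power2_diff)
  then show ?thesis
    using 2 by (simp add: avg_diff avg_add energy_def)
qed

lemma energy_mono: "refines r q \<Longrightarrow> energy q \<le> energy r"
  using energy_diff[of r q] avg_nonneg[of "\<lambda>x y. (dens r (r x) (r y) - dens q (q x) (q y))\<^sup>2"] by simp

end

section \<open>The regularity lemma\<close>

text \<open>Classes that are naturally named by tuples of sets or elements of a sum type are
  renumbered, so that the number of names bounds the labels.\<close>

lemma encode_partition:
  assumes "f ` V \<subseteq> A" "finite A" "card A \<le> K"
  obtains r :: "'a \<Rightarrow> nat" where "r ` V \<subseteq> {..<K}"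
    "\<And>x y. x \<in> V \<Longrightarrow> y \<in> V \<Longrightarrow> r x = r y \<longleftrightarrow> f x = f y"
proof -
  obtain h where h: "bij_betw h A {0..<card A}"
    using ex_bij_betw_finite_nat[OF assms(2)] by blast
  show thesis
  proof
    show "(h \<circ> f) ` V \<subseteq> {..<K}"
    proof (rule image_subsetI)
      fix x assume "x \<in> V"
      then have "h (f x) \<in> h ` A" using assms(1) by blast
      then show "(h \<circ> f) x \<in> {..<K}"
        using h assms(3) by (simp add: bij_betw_def)
    qed
    show "(h \<circ> f) x = (h \<circ> f) y \<longleftrightarrow> f x = f y" if "x \<in> V" "y \<in> V" for x y
      using that assms(1) inj_on_eq_iff[OF bij_betw_imp_inj_on[OF h], of "f x" "f y"] by auto
  qed
qed

context wgraph
begin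

text \<open>The error is relative to the whole cells, in the manner of a cut norm, so that one
  inequality tests subsets of every size.\<close>

definition irregular :: "('a \<Rightarrow> nat) \<Rightarrow> real \<Rightarrow> nat \<Rightarrow> nat \<Rightarrow> bool" where
  "irregular q \<eta> i j \<longleftrightarrow> (\<exists>S\<subseteq>cell q i. \<exists>T\<subseteq>cell q j.
     \<eta> * (mass (cell q i) * mass (cell q j)) < \<bar>cut (dens q i j) S T\<bar>)"

definition irr_mass :: "('a \<Rightarrow> nat) \<Rightarrow> real \<Rightarrow> real" where
  "irr_mass q \<eta> = avg (\<lambda>x y. of_bool (irregular q \<eta> (q x) (q y)))"

lemma refines_refl: "refines q q"
  by (simp add: refines_def)

lemma refines_trans: "refines r q \<Longrightarrow> refines q p \<Longrightarrow> refines r p"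
  unfolding refines_def by blast

lemma cut_restrict:
  assumes "S \<subseteq> X" "T \<subseteq> Y" "finite X" "finite Y"
  shows "(\<Sum>x\<in>X. \<Sum>y\<in>Y. \<mu> x * \<mu> y * ((of_bool (a x y) - d) * of_bool (x \<in> S \<and> y \<in> T))) = cut d S T"
proof -
  have "(\<Sum>x\<in>X. \<Sum>y\<in>Y. \<mu> x * \<mu> y * ((of_bool (a x y) - d) * of_bool (x \<in> S \<and> y \<in> T))) =
    (\<Sum>x\<in>S. \<Sum>y\<in>Y. \<mu> x * \<mu> y * ((of_bool (a x y) - d) * of_bool (x \<in> S \<and> y \<in> T)))"
    using assms by (intro sum.mono_neutral_right ballI) (simp_all add: sum.neutral)
  also have "\<dots> = (\<Sum>x\<in>S. \<Sum>y\<in>T. \<mu> x * \<mu> y * ((of_bool (a x y) - d) * of_bool (x \<in> S \<and> y \<in> T)))"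
    using assms by (intro sum.cong[OF refl] sum.mono_neutral_right ballI) simp_all
  also have "\<dots> = cut d S T"
    unfolding cut_def by (intro sum.cong refl) auto
  finally show ?thesis .
qed

lemma avg_cells:
  assumes "q ` V \<subseteq> I" "finite I"
  shows "avg f = (\<Sum>i\<in>I. \<Sum>j\<in>I. \<Sum>x\<in>cell q i. \<Sum>y\<in>cell q j. \<mu> x * \<mu> y * f x y)"
  unfolding avg_def by (rule sum2_cells[OF assms])

lemma irr_mass_cells:
  assumes "q ` V \<subseteq> I" "finite I"
  shows "irr_mass q \<eta> = (\<Sum>i\<in>I. \<Sum>j\<in>I. of_bool (irregular q \<eta> i j) * (mass (cell q i) * mass (cell q j)))"
  unfolding irr_mass_def avg_cells[OF assms]
proof (intro sum.cong refl)
  fix i j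
  have "(\<Sum>x\<in>cell q i. \<Sum>y\<in>cell q j. \<mu> x * \<mu> y * of_bool (irregular q \<eta> (q x) (q y))) =
     (\<Sum>x\<in>cell q i. \<Sum>y\<in>cell q j. \<mu> x * \<mu> y * of_bool (irregular q \<eta> i j))"
    by (intro sum.cong refl) (auto simp: cell_def)
  also have "\<dots> = (mass (cell q i) * mass (cell q j)) * of_bool (irregular q \<eta> i j)"
    unfolding sum_product by (simp only: sum_distrib_right)
  finally show "(\<Sum>x\<in>cell q i. \<Sum>y\<in>cell q j. \<mu> x * \<mu> y * of_bool (irregular q \<eta> (q x) (q y))) =
      of_bool (irregular q \<eta> i j) * (mass (cell q i) * mass (cell q j))" by simp
qed

text \<open>Cut every cell by all witnesses of irregularity. The signed indicator \<open>g\<close>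
  of the witnesses correlates with the deviation of adjacency from its density by at least \<eta>^2,
  and being constant on pairs of new cells it correlates equally with the change of density. The L2
  norm of that change is the energy gain.\<close>

lemma energy_increment:
  assumes \<eta>: "\<eta> > 0" and irr: "\<eta> < irr_mass q \<eta>" and q: "q ` V \<subseteq> {..<k}"
  obtains r :: "'a \<Rightarrow> nat" where "refines r q" "r ` V \<subseteq> {..<k * (2 ^ (k * k) * 2 ^ (k * k))}"
    "energy q + \<eta> ^ 4 \<le> energy r"
proof -
  let ?irr = "irregular q \<eta>"
  have "\<exists>S T. ?irr i j \<longrightarrow> S \<subseteq> cell q i \<and> T \<subseteq> cell q j \<and>
     \<eta> * (mass (cell q i) * mass (cell q j)) < \<bar>cut (dens q i j) S T\<bar>" for i j
    unfolding irregular_def by blast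
  then obtain S T where ST: "\<And>i j. ?irr i j \<Longrightarrow> S i j \<subseteq> cell q i \<and> T i j \<subseteq> cell q j \<and>
     \<eta> * (mass (cell q i) * mass (cell q j)) < \<bar>cut (dens q i j) (S i j) (T i j)\<bar>"
    by metis
  define s where "s i j = sgn (cut (dens q i j) (S i j) (T i j))" for i j
  define g :: "'a \<Rightarrow> 'a \<Rightarrow> real" where
    "g x y = of_bool (?irr (q x) (q y)) * s (q x) (q y) * of_bool (x \<in> S (q x) (q y) \<and> y \<in> T (q x) (q y))" for x y
  define K2 where "K2 = {..<k} \<times> {..<k}"
  \<comment> \<open>A new class records the old label and, for each pair of labels, on which side of
    the two witness sets a vertex lies; this gives the bound on the number of classes.\<close>
  define f where "f x = (q x, {(i, j) \<in> K2. x \<in> S i j}, {(i, j) \<in> K2. x \<in> T i j})" for x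
  have fA: "f ` V \<subseteq> {..<k} \<times> Pow K2 \<times> Pow K2"
    using q by (auto simp: f_def)
  have finA: "finite ({..<k} \<times> Pow K2 \<times> Pow K2)"
    and cardA: "card ({..<k} \<times> Pow K2 \<times> Pow K2) \<le> k * (2 ^ (k * k) * 2 ^ (k * k))"
    by (simp_all add: K2_def card_cartesian_product card_Pow)
  obtain r :: "'a \<Rightarrow> nat" where r: "r ` V \<subseteq> {..<k * (2 ^ (k * k) * 2 ^ (k * k))}"
    and rf: "\<And>x y. x \<in> V \<Longrightarrow> y \<in> V \<Longrightarrow> r x = r y \<longleftrightarrow> f x = f y"
    by (rule encode_partition[OF fA finA cardA]) blast
  have ref: "refines r q"
    unfolding refines_def using rf by (auto simp: f_def)
  have g_meas: "g x y = g x' y'"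
    if "x \<in> V" "x' \<in> V" "y \<in> V" "y' \<in> V" "r x = r x'" "r y = r y'" for x x' y y'
  proof -
    have e: "f x = f x'" "f y = f y'" using that rf by auto
    then have qq: "q x' = q x" "q y' = q y" by (auto simp: f_def)
    have K2: "(q x, q y) \<in> K2" using q that by (auto simp: K2_def)
    have "x \<in> S (q x) (q y) \<longleftrightarrow> x' \<in> S (q x) (q y)"
      using e(1) K2 unfolding f_def by (auto simp: set_eq_iff)
    moreover have "y \<in> T (q x) (q y) \<longleftrightarrow> y' \<in> T (q x) (q y)"
      using e(2) K2 unfolding f_def by (auto simp: set_eq_iff)
    ultimately show ?thesis unfolding g_def qq by simp
  qed
  have "\<eta> * irr_mass q \<eta> \<le> avg (\<lambda>x y. (of_bool (a x y) - dens q (q x) (q y)) * g x y)"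
    unfolding irr_mass_cells[OF q finite_lessThan] avg_cells[OF q finite_lessThan] sum_distrib_left[of \<eta>]
  proof (intro sum_mono)
    fix i j
    have "(\<Sum>x\<in>cell q i. \<Sum>y\<in>cell q j. \<mu> x * \<mu> y * ((of_bool (a x y) - dens q (q x) (q y)) * g x y)) =
      (\<Sum>x\<in>cell q i. \<Sum>y\<in>cell q j. of_bool (?irr i j) * s i j * (\<mu> x * \<mu> y * ((of_bool (a x y) - dens q i j) *
         of_bool (x \<in> S i j \<and> y \<in> T i j))))"
      by (intro sum.cong refl) (auto simp: cell_def g_def)
    also have "\<dots> = of_bool (?irr i j) * s i j * (\<Sum>x\<in>cell q i. \<Sum>y\<in>cell q j. \<mu> x * \<mu> y * ((of_bool (a x y) - dens q i j) *
         of_bool (x \<in> S i j \<and> y \<in> T i j)))"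
      by (simp only: sum_distrib_left)
    also have "\<dots> \<ge> \<eta> * (of_bool (?irr i j) * (mass (cell q i) * mass (cell q j)))"
    proof (cases "?irr i j")
      case True
      note w = ST[OF True]
      have "s i j * cut (dens q i j) (S i j) (T i j) = \<bar>cut (dens q i j) (S i j) (T i j)\<bar>"
        unfolding s_def by (simp add: sgn_mult_abs abs_sgn)
      then show ?thesis using w True
        by (subst cut_restrict) auto
    qed simp
    finally show "\<eta> * (of_bool (?irr i j) * (mass (cell q i) * mass (cell q j)))
      \<le> (\<Sum>x\<in>cell q i. \<Sum>y\<in>cell q j. \<mu> x * \<mu> y * ((of_bool (a x y) - dens q (q x) (q y)) * g x y))" .
  qed
  \<comment> \<open>\<open>g\<close> is constant on pairs of cells of \<open>r\<close>, so adjacency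
    may be replaced by the densities of \<open>r\<close>.\<close>
  also have "\<dots> = avg (\<lambda>x y. (dens r (r x) (r y) - dens q (q x) (q y)) * g x y)"
    unfolding left_diff_distrib avg_diff by (subst dens_projection[of r g, OF g_meas]) auto
  also have "\<dots> \<le> avg (\<lambda>x y. 1 / (2 * \<eta>\<^sup>2) * (dens r (r x) (r y) - dens q (q x) (q y))\<^sup>2 + \<eta>\<^sup>2 / 2)"
  proof (rule avg_mono)
    fix x y
    let ?t = "dens r (r x) (r y) - dens q (q x) (q y)"
    have "\<bar>g x y\<bar> \<le> 1" unfolding g_def s_def by (simp add: abs_mult abs_sgn_eq)
    then have "\<bar>?t * g x y\<bar> \<le> \<bar>?t\<bar>"
      unfolding abs_mult by (simp add: mult_left_le)
    then have "?t * g x y \<le> \<bar>?t\<bar>" by linarith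
    \<comment> \<open>Young's inequality, weighted so that the error \<eta>^2/2 uses up only half of
      the correlation \<eta>^2.\<close>
    moreover have "0 \<le> (\<bar>?t\<bar> / \<eta> - \<eta>)\<^sup>2" by simp
    then have "2 * \<bar>?t\<bar> \<le> ?t\<^sup>2 / \<eta>\<^sup>2 + \<eta>\<^sup>2"
      using \<eta> by (simp add: power2_diff power_divide)
    ultimately show "?t * g x y \<le> 1 / (2 * \<eta>\<^sup>2) * ?t\<^sup>2 + \<eta>\<^sup>2 / 2"
      by simp
  qed
  also have "\<dots> = 1 / (2 * \<eta>\<^sup>2) * (energy r - energy q) + \<eta>\<^sup>2 / 2"
    by (simp only: avg_add avg_cmult avg_const energy_diff[OF ref])
  finally have "\<eta> * irr_mass q \<eta> \<le> (energy r - energy q) / (2 * \<eta>\<^sup>2) + \<eta>\<^sup>2 / 2" by simp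
  moreover have "\<eta>\<^sup>2 \<le> \<eta> * irr_mass q \<eta>"
    using \<eta> irr by (simp add: power2_eq_square)
  ultimately have "\<eta>\<^sup>2 / 2 \<le> (energy r - energy q) / (2 * \<eta>\<^sup>2)" by linarith
  then have "\<eta>\<^sup>2 * \<eta>\<^sup>2 \<le> energy r - energy q"
    using \<eta> by (simp add: field_simps)
  then have "energy q + \<eta> ^ 4 \<le> energy r" by (simp add: power4_eq_xxxx power2_eq_square)
  then show thesis using that ref r by blast
qed

end

text \<open>\<open>t\<close> bounds the number of increments still possible, because the energy
  never exceeds 1. The graph is quantified inside, since \<open>K\<close> has to be the same for all
  graphs.\<close>

lemma regularity_induct:
  assumes "\<eta> > 0"
  shows "\<exists>K. \<forall>(V :: 'a set) \<mu> a q. wgraph V \<mu> a \<longrightarrow> q ` V \<subseteq> {..<k} \<longrightarrow>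
    1 - real t * \<eta> ^ 4 \<le> wgraph.energy V \<mu> a q \<longrightarrow>
    (\<exists>r. wgraph.refines V r q \<and> r ` V \<subseteq> {..<K} \<and> wgraph.irr_mass V \<mu> a r \<eta> \<le> \<eta>)"
proof (induction t arbitrary: k)
  case 0
  show ?case
  proof (intro exI[of _ k] allI impI)
    fix V :: "'a set" and \<mu> a and q :: "'a \<Rightarrow> nat"
    assume w: "wgraph V \<mu> a" and q: "q ` V \<subseteq> {..<k}" and e: "1 - real 0 * \<eta> ^ 4 \<le> wgraph.energy V \<mu> a q"
    interpret wgraph V \<mu> a by (rule w)
    have "\<not> \<eta> < irr_mass q \<eta>"
    proof
      assume *: "\<eta> < irr_mass q \<eta>"
      obtain r :: "'a \<Rightarrow> nat" where "energy q + \<eta> ^ 4 \<le> energy r"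
        by (rule energy_increment[OF assms * q])
      then show False
        using e energy_le_1[of r] zero_less_power[OF assms, of 4] by simp
    qed
    then show "\<exists>r. refines r q \<and> r ` V \<subseteq> {..<k} \<and> irr_mass r \<eta> \<le> \<eta>"
      using q refines_refl by (intro exI[of _ q]) auto
  qed
next
  case (Suc t)
  define k' where "k' = k * (2 ^ (k * k) * 2 ^ (k * k))"
  obtain K where K: "\<And>(V :: 'a set) \<mu> a q. wgraph V \<mu> a \<Longrightarrow> q ` V \<subseteq> {..<k'} \<Longrightarrow>
    1 - real t * \<eta> ^ 4 \<le> wgraph.energy V \<mu> a q \<Longrightarrow>
    (\<exists>r. wgraph.refines V r q \<and> r ` V \<subseteq> {..<K} \<and> wgraph.irr_mass V \<mu> a r \<eta> \<le> \<eta>)"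
    using Suc.IH[of k'] by metis
  show ?case
  proof (intro exI[of _ "max k K"] allI impI)
    fix V :: "'a set" and \<mu> a and q :: "'a \<Rightarrow> nat"
    assume w: "wgraph V \<mu> a" and q: "q ` V \<subseteq> {..<k}" and e: "1 - real (Suc t) * \<eta> ^ 4 \<le> wgraph.energy V \<mu> a q"
    interpret wgraph V \<mu> a by (rule w)
    show "\<exists>r. refines r q \<and> r ` V \<subseteq> {..<max k K} \<and> irr_mass r \<eta> \<le> \<eta>"
    proof (cases "irr_mass q \<eta> \<le> \<eta>")
      case True
      then show ?thesis
        using q refines_refl by (intro exI[of _ q]) auto
    next
      case False
      then have *: "\<eta> < irr_mass q \<eta>" by simp
      obtain p :: "'a \<Rightarrow> nat" where p: "refines p q" "p ` V \<subseteq> {..<k'}" "energy q + \<eta> ^ 4 \<le> energy p"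
        unfolding k'_def by (rule energy_increment[OF assms * q])
      then have "1 - real t * \<eta> ^ 4 \<le> energy p"
        using e by (simp add: algebra_simps)
      then obtain r where "refines r p" "r ` V \<subseteq> {..<K}" "irr_mass r \<eta> \<le> \<eta>"
        using K[OF w p(2)] by blast
      then show ?thesis
        using refines_trans[OF _ p(1)] by (intro exI[of _ r]) auto
    qed
  qed
qed

theorem regularity:
  assumes "\<eta> > 0"
  obtains K where "\<And>(V :: 'a set) \<mu> a q. wgraph V \<mu> a \<Longrightarrow> q ` V \<subseteq> {..<k} \<Longrightarrow>
    \<exists>r. wgraph.refines V r q \<and> r ` V \<subseteq> {..<K} \<and> wgraph.irr_mass V \<mu> a r \<eta> \<le> \<eta>"
proof -
  obtain t :: nat where "1 / \<eta> ^ 4 \<le> real t" using real_arch_simple by blast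
  then have t: "1 - real t * \<eta> ^ 4 \<le> 0"
    using assms by (simp add: field_simps)
  obtain K where K: "\<And>(V :: 'a set) \<mu> a q. wgraph V \<mu> a \<Longrightarrow> q ` V \<subseteq> {..<k} \<Longrightarrow>
    1 - real t * \<eta> ^ 4 \<le> wgraph.energy V \<mu> a q \<Longrightarrow>
    (\<exists>r. wgraph.refines V r q \<and> r ` V \<subseteq> {..<K} \<and> wgraph.irr_mass V \<mu> a r \<eta> \<le> \<eta>)"
    using regularity_induct[OF assms, of k t] by metis
  show thesis
  proof (rule that)
    fix V :: "'a set" and \<mu> a and q :: "'a \<Rightarrow> nat"
    assume w: "wgraph V \<mu> a" and q: "q ` V \<subseteq> {..<k}"
    show "\<exists>r. wgraph.refines V r q \<and> r ` V \<subseteq> {..<K} \<and> wgraph.irr_mass V \<mu> a r \<eta> \<le> \<eta>"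
      using t wgraph.energy_nonneg[OF w, of q] by (intro K[OF w q]) simp
  qed
qed

section \<open>Independent choices\<close>

text \<open>Positivity of \<open>q u\<close> is part of the conclusion: it will force a chosen
  representative to lie in the support of its distribution.\<close>

lemma exists_le_average:
  fixes q f :: "'b \<Rightarrow> real"
  assumes "finite X" "\<And>u. u \<in> X \<Longrightarrow> 0 \<le> q u" "sum q X = 1"
  shows "\<exists>u\<in>X. 0 < q u \<and> f u \<le> (\<Sum>v\<in>X. q v * f v)"
proof (rule ccontr)
  let ?m = "\<Sum>v\<in>X. q v * f v"
  assume "\<not> (\<exists>u\<in>X. 0 < q u \<and> f u \<le> ?m)"
  then have gt: "?m < f u" if "u \<in> X" "0 < q u" for u using that by force
  obtain w where w: "w \<in> X" "0 < q w"
    using assms by (metis less_eq_real_def sum.neutral zero_neq_one)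
  have "(\<Sum>v\<in>X. q v * ?m) < (\<Sum>v\<in>X. q v * f v)"
  proof (rule sum_strict_mono_ex1[OF assms(1)])
    show "\<forall>v\<in>X. q v * ?m \<le> q v * f v"
    proof
      fix v assume "v \<in> X"
      then show "q v * ?m \<le> q v * f v"
        using gt[of v] assms(2)[of v] by (cases "q v = 0") (auto intro!: mult_left_mono simp: less_le)
    qed
    show "\<exists>v\<in>X. q v * ?m < q v * f v"
      using w gt[of w] by (intro bexI[of _ w] mult_strict_left_mono)
  qed
  then show False using assms(3) by (simp add: sum_distrib_right[symmetric])
qed

lemma sum_offdiag_insert:
  fixes F :: "'i \<Rightarrow> 'i \<Rightarrow> real"
  assumes "finite I" "k \<notin> I"
  shows "(\<Sum>i\<in>insert k I. \<Sum>j\<in>insert k I - {i}. F i j) =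
    (\<Sum>j\<in>I. F k j + F j k) + (\<Sum>i\<in>I. \<Sum>j\<in>I - {i}. F i j)"
proof -
  have 1: "insert k I - {k} = I" using assms by auto
  have 2: "(\<Sum>j\<in>insert k I - {i}. F i j) = F i k + (\<Sum>j\<in>I - {i}. F i j)" if "i \<in> I" for i
  proof -
    have "insert k I - {i} = insert k (I - {i})" using that assms by auto
    then show ?thesis using assms by simp
  qed
  show ?thesis using assms by (simp add: 1 2 sum.distrib)
qed

text \<open>The method of conditional expectations. Once the choice for \<open>k\<close> is fixed,
  the pair costs that involve \<open>k\<close> become costs of single choices; the terms
  \<open>b\<close> are there to absorb them in the induction.\<close>

lemma choose_pairwise:
  fixes q :: "'i \<Rightarrow> 'b \<Rightarrow> real" and b :: "'i \<Rightarrow> 'b \<Rightarrow> real" and c :: "'i \<Rightarrow> 'i \<Rightarrow> 'b \<Rightarrow> 'b \<Rightarrow> real"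
  assumes "finite I" "finite X" "\<And>i u. i \<in> I \<Longrightarrow> u \<in> X \<Longrightarrow> 0 \<le> q i u" "\<And>i. i \<in> I \<Longrightarrow> sum (q i) X = 1"
  shows "\<exists>y. (\<forall>i\<in>I. y i \<in> X \<and> 0 < q i (y i)) \<and>
    (\<Sum>i\<in>I. b i (y i)) + (\<Sum>i\<in>I. \<Sum>j\<in>I - {i}. c i j (y i) (y j)) \<le>
    (\<Sum>i\<in>I. \<Sum>u\<in>X. q i u * b i u) +
    (\<Sum>i\<in>I. \<Sum>j\<in>I - {i}. \<Sum>u\<in>X. \<Sum>v\<in>X. q i u * (q j v * c i j u v))"
  using assms(1,3,4)
proof (induction I arbitrary: b rule: finite_induct)
  case empty
  then show ?case by simp
next
  case (insert k I)
  define f where "f u = b k u + (\<Sum>j\<in>I. \<Sum>v\<in>X. q j v * (c k j u v + c j k v u))" for u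
  obtain u where u: "u \<in> X" "0 < q k u" "f u \<le> (\<Sum>v\<in>X. q k v * f v)"
    using exists_le_average[OF assms(2), of "q k" f] insert.prems by auto
  define b' where "b' j v = b j v + (c k j u v + c j k v u)" for j v
  obtain y where y: "\<forall>i\<in>I. y i \<in> X \<and> 0 < q i (y i)"
    and le: "(\<Sum>i\<in>I. b' i (y i)) + (\<Sum>i\<in>I. \<Sum>j\<in>I - {i}. c i j (y i) (y j)) \<le>
    (\<Sum>i\<in>I. \<Sum>u\<in>X. q i u * b' i u) +
    (\<Sum>i\<in>I. \<Sum>j\<in>I - {i}. \<Sum>u\<in>X. \<Sum>v\<in>X. q i u * (q j v * c i j u v))"
    using insert.IH[of b'] insert.prems by blast
  define z where "z = y(k := u)"
  have zk: "z k = u" and zI: "\<And>i. i \<in> I \<Longrightarrow> z i = y i"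
    using insert.hyps by (auto simp: z_def)
  let ?C = "\<lambda>i j. \<Sum>u\<in>X. \<Sum>v\<in>X. q i u * (q j v * c i j u v)"
  let ?R = "\<Sum>i\<in>I. \<Sum>j\<in>I - {i}. ?C i j"
  have "(\<Sum>i\<in>insert k I. b i (z i)) + (\<Sum>i\<in>insert k I. \<Sum>j\<in>insert k I - {i}. c i j (z i) (z j))
     = b k u + (\<Sum>i\<in>I. b i (y i)) + ((\<Sum>j\<in>I. c k j u (y j) + c j k (y j) u) +
         (\<Sum>i\<in>I. \<Sum>j\<in>I - {i}. c i j (y i) (y j)))"
    unfolding sum_offdiag_insert[OF insert.hyps(1,2)] using insert.hyps zI by (simp add: zk)
  also have "\<dots> = b k u + ((\<Sum>i\<in>I. b' i (y i)) + (\<Sum>i\<in>I. \<Sum>j\<in>I - {i}. c i j (y i) (y j)))"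
    by (simp add: b'_def sum.distrib)
  also have "\<dots> \<le> b k u + ((\<Sum>i\<in>I. \<Sum>u\<in>X. q i u * b' i u) + ?R)"
    using le by simp
  also have "\<dots> = f u + (\<Sum>i\<in>I. \<Sum>u\<in>X. q i u * b i u) + ?R"
    by (simp add: b'_def f_def sum.distrib distrib_left)
  also have "\<dots> \<le> (\<Sum>v\<in>X. q k v * f v) + (\<Sum>i\<in>I. \<Sum>u\<in>X. q i u * b i u) + ?R"
    using u by simp
  also have "(\<Sum>v\<in>X. q k v * f v) = (\<Sum>v\<in>X. q k v * b k v) + (\<Sum>j\<in>I. ?C k j + ?C j k)"
  proof -
    have "(\<Sum>v\<in>X. q k v * (\<Sum>j\<in>I. \<Sum>w\<in>X. q j w * (c k j v w + c j k w v))) =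
      (\<Sum>v\<in>X. \<Sum>j\<in>I. \<Sum>w\<in>X. q k v * (q j w * (c k j v w + c j k w v)))"
      by (simp only: sum_distrib_left)
    also have "\<dots> = (\<Sum>j\<in>I. \<Sum>v\<in>X. \<Sum>w\<in>X. q k v * (q j w * (c k j v w + c j k w v)))"
      by (rule sum.swap)
    also have "\<dots> = (\<Sum>j\<in>I. ?C k j + ?C j k)"
    proof (intro sum.cong refl)
      fix j
      have "?C j k = (\<Sum>v\<in>X. \<Sum>w\<in>X. q k v * (q j w * c j k w v))"
        by (subst sum.swap) (simp add: mult_ac)
      then show "(\<Sum>v\<in>X. \<Sum>w\<in>X. q k v * (q j w * (c k j v w + c j k w v))) = ?C k j + ?C j k"
        by (simp only: distrib_left sum.distrib)
    qed
    finally show ?thesis by (simp add: f_def distrib_left sum.distrib)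
  qed
  also have "(\<Sum>v\<in>X. q k v * b k v) + (\<Sum>j\<in>I. ?C k j + ?C j k) + (\<Sum>i\<in>I. \<Sum>u\<in>X. q i u * b i u) + ?R =
     (\<Sum>i\<in>insert k I. \<Sum>u\<in>X. q i u * b i u) + (\<Sum>i\<in>insert k I. \<Sum>j\<in>insert k I - {i}. ?C i j)"
    unfolding sum_offdiag_insert[OF insert.hyps(1,2)] using insert.hyps by simp
  finally show ?case
    using y u zk zI by (intro exI[of _ z]) simp
qed

section \<open>Expectations over finite products\<close>

definition expect :: "'v set \<Rightarrow> 's set \<Rightarrow> ('s \<Rightarrow> 'v \<Rightarrow> real) \<Rightarrow> (('s \<Rightarrow> 'v) \<Rightarrow> real) \<Rightarrow> real" where
  "expect V S \<nu> F = (\<Sum>x\<in>S \<rightarrow>\<^sub>E V. (\<Prod>s\<in>S. \<nu> s (x s)) * F x)"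

text \<open>This plays the part of measurability with respect to the coordinates in
  \<open>T\<close>.\<close>

definition depends_on :: "'s set \<Rightarrow> (('s \<Rightarrow> 'v) \<Rightarrow> 'b) \<Rightarrow> bool" where
  "depends_on T F \<longleftrightarrow> (\<forall>x y. (\<forall>s\<in>T. x s = y s) \<longrightarrow> F x = F y)"

lemma expect_empty [simp]: "expect V {} \<nu> F = F (\<lambda>_. undefined)"
  by (simp add: expect_def)

lemma expect_insert:
  assumes "finite S" "s \<notin> S"
  shows "expect V (insert s S) \<nu> F = (\<Sum>v\<in>V. \<nu> s v * expect V S \<nu> (\<lambda>x. F (x(s := v))))"
proof -
  have inj: "inj_on (\<lambda>(y, g). g(s := y)) (V \<times> (S \<rightarrow>\<^sub>E V))"
    using inj_combinator[OF assms(2), of "\<lambda>_. V"] by simp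
  have *: "(\<Prod>t\<in>S. \<nu> t ((g(s := y)) t)) = (\<Prod>t\<in>S. \<nu> t (g t))" for g y
    using assms by (intro prod.cong) auto
  have "expect V (insert s S) \<nu> F =
     (\<Sum>(y, g)\<in>V \<times> (S \<rightarrow>\<^sub>E V). (\<Prod>t\<in>insert s S. \<nu> t ((g(s := y)) t)) * F (g(s := y)))"
    unfolding expect_def PiE_insert_eq by (subst sum.reindex[OF inj]) (simp add: o_def case_prod_unfold)
  also have "\<dots> = (\<Sum>y\<in>V. \<Sum>g\<in>S \<rightarrow>\<^sub>E V. \<nu> s y * ((\<Prod>t\<in>S. \<nu> t (g t)) * F (g(s := y))))"
    unfolding sum.cartesian_product[symmetric] prod.insert[OF assms] * by (simp add: mult.assoc)
  finally show ?thesis by (simp only: expect_def sum_distrib_left)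
qed

lemma expect_cong:
  "(\<And>x. x \<in> S \<rightarrow>\<^sub>E V \<Longrightarrow> F x = G x) \<Longrightarrow> expect V S \<nu> F = expect V S \<nu> G"
  by (simp add: expect_def)

lemma expect_add: "expect V S \<nu> (\<lambda>x. F x + G x) = expect V S \<nu> F + expect V S \<nu> G"
  by (simp add: expect_def sum.distrib distrib_left)

lemma expect_cmult: "expect V S \<nu> (\<lambda>x. c * F x) = c * expect V S \<nu> F"
  by (simp add: expect_def sum_distrib_left mult_ac)

lemma expect_sum: "expect V S \<nu> (\<lambda>x. \<Sum>i\<in>I. F i x) = (\<Sum>i\<in>I. expect V S \<nu> (F i))"
  unfolding expect_def sum_distrib_left by (rule sum.swap)

lemma expect_mono:
  assumes "\<And>s v. s \<in> S \<Longrightarrow> v \<in> V \<Longrightarrow> 0 \<le> \<nu> s v" "\<And>x. x \<in> S \<rightarrow>\<^sub>E V \<Longrightarrow> F x \<le> G x"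
  shows "expect V S \<nu> F \<le> expect V S \<nu> G"
  unfolding expect_def using assms by (intro sum_mono mult_left_mono prod_nonneg) (auto simp: PiE_mem)

lemma depends_on_upd: "depends_on (insert s T) F \<Longrightarrow> depends_on T (\<lambda>x. F (x(s := v)))"
  by (simp add: depends_on_def)

lemma depends_on_fun_upd_ignore: "depends_on T F \<Longrightarrow> s \<notin> T \<Longrightarrow> F (x(s := v)) = F x"
  unfolding depends_on_def by (metis fun_upd_other)

lemma expect_mult:
  assumes "finite S" "finite T" "S \<inter> T = {}" "depends_on S F" "depends_on T G"
  shows "expect V (S \<union> T) \<nu> (\<lambda>x. F x * G x) = expect V S \<nu> F * expect V T \<nu> G"
  using assms(1,3,4)
proof (induction S arbitrary: F rule: finite_induct)
  case empty
  define c where "c = F undefined"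
  have "F x = c" for x
    unfolding c_def using empty.prems(2)[unfolded depends_on_def, rule_format, of x undefined] by simp
  then show ?case by (simp add: expect_cmult)
next
  case (insert s S)
  have G: "G (x(s := v)) = G x" for x v
    using insert.prems(1) by (intro depends_on_fun_upd_ignore[OF assms(5)]) auto
  have "expect V (insert s S \<union> T) \<nu> (\<lambda>x. F x * G x) =
     (\<Sum>v\<in>V. \<nu> s v * expect V (S \<union> T) \<nu> (\<lambda>x. F (x(s := v)) * G x))"
    using insert assms(2) by (simp add: expect_insert G)
  also have "\<dots> = (\<Sum>v\<in>V. \<nu> s v * (expect V S \<nu> (\<lambda>x. F (x(s := v))) * expect V T \<nu> G))"
    using insert by (subst insert.IH) (auto intro: depends_on_upd)
  also have "\<dots> = expect V (insert s S) \<nu> F * expect V T \<nu> G"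
    using insert by (simp add: expect_insert sum_distrib_right mult.assoc)
  finally show ?case .
qed

lemma expect_one:
  assumes "finite S" "\<And>s. s \<in> S \<Longrightarrow> sum (\<nu> s) V = 1"
  shows "expect V S \<nu> (\<lambda>x. 1) = 1"
  using assms by (induction S rule: finite_induct) (simp_all add: expect_insert)

lemma expect_const:
  assumes "finite S" "\<And>s. s \<in> S \<Longrightarrow> sum (\<nu> s) V = 1"
  shows "expect V S \<nu> (\<lambda>x. c) = c"
  using expect_cmult[of V S \<nu> c "\<lambda>x. 1"] expect_one[of S \<nu> V, OF assms] by simp

lemma expect_marginal:
  assumes "finite S" "T \<subseteq> S" "\<And>s. s \<in> S \<Longrightarrow> sum (\<nu> s) V = 1" "depends_on T F"
  shows "expect V S \<nu> F = expect V T \<nu> F"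
proof -
  have "expect V ((S - T) \<union> T) \<nu> (\<lambda>x. 1 * F x) = expect V (S - T) \<nu> (\<lambda>x. 1) * expect V T \<nu> F"
    using assms by (intro expect_mult) (auto simp: depends_on_def intro: finite_subset)
  moreover have "(S - T) \<union> T = S" using assms by auto
  moreover have "expect V (S - T) \<nu> (\<lambda>x. 1) = 1" using assms by (intro expect_one) auto
  ultimately show ?thesis by simp
qed

lemma expect_prod_depends:
  assumes "finite I" "finite S" "\<And>s. s \<in> S \<Longrightarrow> sum (\<nu> s) V = 1"
    and "\<And>i. i \<in> I \<Longrightarrow> T i \<subseteq> S" "\<And>i. i \<in> I \<Longrightarrow> depends_on (T i) (h i)"
    and "\<And>i j. i \<in> I \<Longrightarrow> j \<in> I \<Longrightarrow> i \<noteq> j \<Longrightarrow> T i \<inter> T j = {}"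
  shows "expect V S \<nu> (\<lambda>x. \<Prod>i\<in>I. h i x) = (\<Prod>i\<in>I. expect V (T i) \<nu> (h i))"
  using assms(1,4,5,6)
proof (induction I rule: finite_induct)
  case empty
  then show ?case using assms by (simp add: expect_one)
next
  case (insert k I)
  have d: "depends_on (\<Union>i\<in>I. T i) (\<lambda>x. \<Prod>i\<in>I. h i x)"
    using insert.prems(2) unfolding depends_on_def by (auto intro!: prod.cong)
  have sub: "T k \<subseteq> S" "(\<Union>i\<in>I. T i) \<subseteq> S" using insert.prems(1) by auto
  then have fin: "finite (T k)" "finite (\<Union>i\<in>I. T i)" using assms(2) finite_subset by blast+
  have disj: "T k \<inter> (\<Union>i\<in>I. T i) = {}"
    using insert.prems(3) insert.hyps(2) by (auto simp: disjoint_iff)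
  have dk: "depends_on (T k) (h k)" using insert.prems(2) by simp
  have "expect V S \<nu> (\<lambda>x. \<Prod>i\<in>insert k I. h i x) = expect V S \<nu> (\<lambda>x. h k x * (\<Prod>i\<in>I. h i x))"
    using insert.hyps by simp
  also have "\<dots> = expect V (T k \<union> (\<Union>i\<in>I. T i)) \<nu> (\<lambda>x. h k x * (\<Prod>i\<in>I. h i x))"
  proof (rule expect_marginal[OF assms(2) _ assms(3)])
    show "depends_on (T k \<union> (\<Union>i\<in>I. T i)) (\<lambda>x. h k x * (\<Prod>i\<in>I. h i x))"
      using dk d unfolding depends_on_def by (metis UnCI)
  qed (use sub in auto)
  also have "\<dots> = expect V (T k) \<nu> (h k) * expect V (\<Union>i\<in>I. T i) \<nu> (\<lambda>x. \<Prod>i\<in>I. h i x)"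
    by (rule expect_mult[OF fin disj dk d])
  also have "expect V (\<Union>i\<in>I. T i) \<nu> (\<lambda>x. \<Prod>i\<in>I. h i x) = expect V S \<nu> (\<lambda>x. \<Prod>i\<in>I. h i x)"
    by (rule expect_marginal[OF assms(2) sub(2) assms(3) d, symmetric]) auto
  also have "\<dots> = (\<Prod>i\<in>I. expect V (T i) \<nu> (h i))"
    using insert.prems by (intro insert.IH) auto
  finally show ?case using insert.hyps by simp
qed

text \<open>The chance that \<open>n\<close> further draws are distinct, avoid \<open>C\<close>, and
  together with \<open>C\<close> form a set satisfying \<open>B\<close>. It knows the index set of a
  tuple only through its size, which allows index sets to be exchanged.\<close>

primrec expect_inj :: "'v set \<Rightarrow> ('v \<Rightarrow> real) \<Rightarrow> ('v set \<Rightarrow> bool) \<Rightarrow> nat \<Rightarrow> 'v set \<Rightarrow> real" where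
  "expect_inj V \<nu> B 0 C = of_bool (B C)"
| "expect_inj V \<nu> B (Suc n) C = (\<Sum>v\<in>V. \<nu> v * (of_bool (v \<notin> C) * expect_inj V \<nu> B n (insert v C)))"

lemma expect_inj_image:
  fixes S :: "'s set" and V :: "'v set"
  assumes "finite S"
  shows "expect V S (\<lambda>_. \<nu>) (\<lambda>x. of_bool (inj_on x S \<and> x ` S \<inter> C = {} \<and> B (x ` S \<union> C))) = expect_inj V \<nu> B (card S) C"
  using assms
proof (induction S arbitrary: C rule: finite_induct)
  case empty
  then show ?case by simp
next
  case (insert s S)
  have "expect V (insert s S) (\<lambda>_. \<nu>) (\<lambda>x. of_bool (inj_on x (insert s S) \<and> x ` insert s S \<inter> C = {} \<and> B (x ` insert s S \<union> C)))
    = (\<Sum>v\<in>V. \<nu> v * expect V S (\<lambda>_. \<nu>) (\<lambda>x. of_bool (v \<notin> C) *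
         of_bool (inj_on x S \<and> x ` S \<inter> insert v C = {} \<and> B (x ` S \<union> insert v C))))"
    unfolding expect_insert[OF insert.hyps]
  proof (intro sum.cong refl arg_cong2[where f = "(*)"] expect_cong)
    fix v and x :: "'s \<Rightarrow> 'v"
    have "(x(s := v)) ` insert s S = insert v (x ` S)"
      using insert.hyps(2) by auto
    moreover have "inj_on (x(s := v)) (insert s S) \<longleftrightarrow> v \<notin> x ` S \<and> inj_on x S"
      using insert.hyps(2) by (auto simp: inj_on_def)
    ultimately
    show "of_bool (inj_on (x(s := v)) (insert s S) \<and> (x(s := v)) ` insert s S \<inter> C = {} \<and> B ((x(s := v)) ` insert s S \<union> C)) =
      (of_bool (v \<notin> C) * of_bool (inj_on x S \<and> x ` S \<inter> insert v C = {} \<and> B (x ` S \<union> insert v C)) :: real)"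
      by (simp add: Un_commute) (auto simp: Un_commute insert_commute)
  qed
  also have "\<dots> = (\<Sum>v\<in>V. \<nu> v * (of_bool (v \<notin> C) * expect_inj V \<nu> B (card S) (insert v C)))"
    by (simp only: expect_cmult insert.IH)
  finally show ?case using insert.hyps by simp
qed

text \<open>The index sets may have different types.\<close>

lemma expect_inj_card_eq:
  assumes "finite S" "finite T" "card S = card T"
  shows "expect V S (\<lambda>_. \<nu>) (\<lambda>x. of_bool (inj_on x S \<and> B (x ` S))) = expect V T (\<lambda>_. \<nu>) (\<lambda>x. of_bool (inj_on x T \<and> B (x ` T)))"
  using expect_inj_image[OF assms(1), of V \<nu> "{}" B] expect_inj_image[OF assms(2), of V \<nu> "{}" B] assms(3) by simp

section \<open>Homogeneous tuples and cut norms\<close>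

text \<open>\<open>t\<close> selects between cliques and independent sets. Injectivity is demanded
  because tuples are sampled with replacement.\<close>

definition homog :: "('v \<Rightarrow> 'v \<Rightarrow> bool) \<Rightarrow> bool \<Rightarrow> 's set \<Rightarrow> ('s \<Rightarrow> 'v) \<Rightarrow> bool" where
  "homog a t S x \<longleftrightarrow> inj_on x S \<and> (\<forall>u\<in>x ` S. \<forall>v\<in>x ` S. u \<noteq> v \<longrightarrow> a u v = t)"

lemma homog_depends: "depends_on S (\<lambda>x. of_bool (homog a t S x) :: real)"
proof -
  have *: "homog a t S x = homog a t S y" if "\<forall>s\<in>S. x s = y s" for x y
  proof -
    have "x ` S = y ` S" using that by force
    moreover have "inj_on x S = inj_on y S" using that by (intro inj_on_cong) auto
    ultimately show ?thesis by (simp add: homog_def)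
  qed
  show ?thesis unfolding depends_on_def by (intro allI impI arg_cong[where f = of_bool] *) blast
qed

lemma homog_subset: "homog a t S x \<Longrightarrow> T \<subseteq> S \<Longrightarrow> homog a t T x"
  unfolding homog_def by (meson image_mono inj_on_subset subsetD)

text \<open>The collision probability is the sum of the squares of the weights, which is at most the
  largest weight.\<close>

lemma expect_collision:
  fixes \<nu> :: "'v \<Rightarrow> real" and S :: "'s set"
  assumes "finite S" "i \<in> S" "j \<in> S" "i \<noteq> j" "finite V"
    and "\<And>v. 0 \<le> \<nu> v" "sum \<nu> V = 1" "\<And>v. v \<in> V \<Longrightarrow> \<nu> v \<le> \<tau>"
  shows "expect V S (\<lambda>_. \<nu>) (\<lambda>x. of_bool (x i = x j)) \<le> \<tau>"
proof -
  have "expect V S (\<lambda>_. \<nu>) (\<lambda>x. of_bool (x i = x j)) = expect V {i, j} (\<lambda>_. \<nu>) (\<lambda>x. of_bool (x i = x j))"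
    using assms by (intro expect_marginal) (auto simp: depends_on_def)
  also have "\<dots> = (\<Sum>u\<in>V. \<nu> u * (\<Sum>v\<in>V. \<nu> v * of_bool (u = v)))"
    using assms(4) by (simp add: expect_insert)
  also have "\<dots> = (\<Sum>u\<in>V. \<nu> u * \<nu> u)"
    using assms(5) by (intro sum.cong refl) (simp add: of_bool_def if_distrib sum.delta cong: if_cong)
  also have "\<dots> \<le> (\<Sum>u\<in>V. \<nu> u * \<tau>)"
    using assms by (intro sum_mono mult_left_mono) auto
  also have "\<dots> = \<tau>" using assms(7) by (simp add: sum_distrib_right[symmetric])
  finally show ?thesis .
qed

text \<open>A sample of Ramsey size contains a homogeneous set, so homogeneous tuples have positive density.\<close>

lemma homogeneous_density:
  fixes m :: nat
  obtains c0 \<tau> :: real where "0 < c0" "c0 \<le> 1" "0 < \<tau>"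
    "\<And>(V :: 'v set) a \<nu>. finite V \<Longrightarrow> (\<And>u v. a u v \<longleftrightarrow> a v u) \<Longrightarrow> (\<And>v. 0 \<le> \<nu> v) \<Longrightarrow> sum \<nu> V = 1 \<Longrightarrow>
       (\<And>v. v \<in> V \<Longrightarrow> \<nu> v \<le> \<tau>) \<Longrightarrow>
       \<exists>t. \<forall>S :: 's set. finite S \<longrightarrow> card S \<le> m \<longrightarrow> c0 \<le> expect V S (\<lambda>_. \<nu>) (\<lambda>x. of_bool (homog a t S x))"
proof -
  obtain L where L: "\<And>(W :: nat set) E. finite W \<Longrightarrow> L \<le> card W \<Longrightarrow>
      \<exists>R\<subseteq>W. card R = m \<and> clique R E \<or> card R = m \<and> indep R E"
    using ramsey2[of m m] by metis
  define I where "I = {..<L}"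
  \<comment> \<open>A probability of at least 1/2 is shared by at most 2^L sets of positions and two
    kinds of homogeneity.\<close>
  define c0 where "c0 = 1 / (4 * 2 ^ L :: real)"
  \<comment> \<open>The union bound over the L^2 pairs of positions then leaves a collision
    probability of at most 1/2; the summand 1 avoids division by zero.\<close>
  define \<tau> where "\<tau> = 1 / (2 * (real (L * L) + 1))"
  show thesis
  proof (rule that)
    show "0 < c0" by (simp add: c0_def)
    show "0 < \<tau>" unfolding \<tau>_def by (intro divide_pos_pos mult_pos_pos add_nonneg_pos) auto
    show "c0 \<le> 1" unfolding c0_def by (simp add: field_simps) (metis mult_1 mult_mono one_le_numeral one_le_power zero_le_numeral zero_le_one)
    fix V :: "'v set" and a :: "'v \<Rightarrow> 'v \<Rightarrow> bool" and \<nu>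
    assume fin: "finite V" and sym: "\<And>u v. a u v \<longleftrightarrow> a v u" and nn: "\<And>v. 0 \<le> \<nu> v" and tot: "sum \<nu> V = 1"
      and small: "\<And>v. v \<in> V \<Longrightarrow> \<nu> v \<le> \<tau>"
    let ?E = "\<lambda>F. expect V I (\<lambda>_. \<nu>) F"
    let ?N = "{R. R \<subseteq> I \<and> card R = m} \<times> (UNIV :: bool set)"
    have finI: "finite I" by (simp add: I_def)
    have finN: "finite ?N" using finI by auto
    have ex: "\<exists>R t. R \<subseteq> I \<and> card R = m \<and> homog a t R x" if "inj_on x I" for x
    proof -
      obtain R where R: "R \<subseteq> I" "card R = m"
        "clique R {{i, j} | i j. a (x i) (x j)} \<or> indep R {{i, j} | i j. a (x i) (x j)}"
        using L[of I "{{i, j} | i j. a (x i) (x j)}"] by (auto simp: I_def)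
      have iff: "{i, j} \<in> {{i, j} | i j. a (x i) (x j)} \<longleftrightarrow> a (x i) (x j)" for i j
        using sym by (auto simp: doubleton_eq_iff)
      have "inj_on x R" using that R(1) inj_on_subset by blast
      then have "homog a True R x \<or> homog a False R x"
        using R(3) unfolding homog_def clique_def indep_def iff ball_simps(9) by (auto; blast)
      then show ?thesis using R by blast
    qed
    \<comment> \<open>Every outcome either repeats a vertex or is homogeneous on some
      \<open>m\<close> positions. Taking expectations turns Ramsey's theorem into a statement on
      densities.\<close>
    have pt: "1 \<le> (\<Sum>p\<in>?N. of_bool (homog a (snd p) (fst p) x)) +
        (\<Sum>p\<in>I \<times> I. of_bool (fst p \<noteq> snd p) * of_bool (x (fst p) = x (snd p)) :: real)" for x
    proof (cases "inj_on x I")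
      case True
      then obtain R t where R: "R \<subseteq> I" "card R = m" "homog a t R x" using ex by blast
      have "(1 :: real) \<le> (\<Sum>p\<in>?N. of_bool (homog a (snd p) (fst p) x))"
        using R by (intro order_trans[OF _ member_le_sum[OF _ _ finN, of "(R, t)"]]) auto
      moreover have "0 \<le> (\<Sum>p\<in>I \<times> I. of_bool (fst p \<noteq> snd p) * of_bool (x (fst p) = x (snd p)) :: real)"
        by (intro sum_nonneg) auto
      ultimately show ?thesis by linarith
    next
      case False
      then obtain i j where ij: "i \<in> I" "j \<in> I" "i \<noteq> j" "x i = x j" by (auto simp: inj_on_def)
      have "(1 :: real) \<le> (\<Sum>p\<in>I \<times> I. of_bool (fst p \<noteq> snd p) * of_bool (x (fst p) = x (snd p)))"
        using ij finI by (intro order_trans[OF _ member_le_sum[of "(i, j)"]]) auto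
      moreover have "0 \<le> (\<Sum>p\<in>?N. of_bool (homog a (snd p) (fst p) x) :: real)"
        by (intro sum_nonneg) auto
      ultimately show ?thesis by linarith
    qed
    have "1 = ?E (\<lambda>x. 1)" using expect_one[OF finI] tot by metis
    also have "\<dots> \<le> ?E (\<lambda>x. (\<Sum>p\<in>?N. of_bool (homog a (snd p) (fst p) x)) +
        (\<Sum>p\<in>I \<times> I. of_bool (fst p \<noteq> snd p) * of_bool (x (fst p) = x (snd p))))"
      using nn pt by (intro expect_mono) auto
    also have "\<dots> = (\<Sum>p\<in>?N. ?E (\<lambda>x. of_bool (homog a (snd p) (fst p) x))) +
        (\<Sum>p\<in>I \<times> I. of_bool (fst p \<noteq> snd p) * ?E (\<lambda>x. of_bool (x (fst p) = x (snd p))))"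
      by (simp only: expect_add expect_sum expect_cmult)
    also have "(\<Sum>p\<in>I \<times> I. of_bool (fst p \<noteq> snd p) * ?E (\<lambda>x. of_bool (x (fst p) = x (snd p)))) \<le> (\<Sum>p\<in>I \<times> I. \<tau>)"
    proof (rule sum_mono)
      fix p assume p: "p \<in> I \<times> I"
      have "0 \<le> \<tau>" by (simp add: \<tau>_def)
      moreover have "?E (\<lambda>x. of_bool (x (fst p) = x (snd p))) \<le> \<tau>" if "fst p \<noteq> snd p"
        using p by (intro expect_collision[OF finI _ _ that fin nn tot small]) auto
      ultimately show "of_bool (fst p \<noteq> snd p) * ?E (\<lambda>x. of_bool (x (fst p) = x (snd p))) \<le> \<tau>"
        by (cases "fst p = snd p") auto
    qed
    also have "(\<Sum>p\<in>I \<times> I. \<tau>) \<le> 1 / 2"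
    proof -
      have "z / (2 * (z + 1)) \<le> 1 / 2" if "0 \<le> z" for z :: real
        using that by (simp add: divide_simps)
      note half = this[OF of_nat_0_le_iff]
      have "(\<Sum>p\<in>I \<times> I. \<tau>) = real (L * L) / (2 * (real (L * L) + 1))"
        by (simp add: card_cartesian_product I_def \<tau>_def)
      also have "\<dots> \<le> 1 / 2"
        by (rule half)
      finally show ?thesis .
    qed
    finally have half: "1 / 2 \<le> (\<Sum>p\<in>?N. ?E (\<lambda>x. of_bool (homog a (snd p) (fst p) x)))" by simp
    have "\<exists>p\<in>?N. c0 \<le> ?E (\<lambda>x. of_bool (homog a (snd p) (fst p) x))"
    proof (rule ccontr)
      assume "\<not> ?thesis"
      then have lt: "\<And>p. p \<in> ?N \<Longrightarrow> ?E (\<lambda>x. of_bool (homog a (snd p) (fst p) x)) < c0"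
        by (meson not_le)
      have ne: "?N \<noteq> {}" using half by (intro notI) simp
      have "(\<Sum>p\<in>?N. ?E (\<lambda>x. of_bool (homog a (snd p) (fst p) x))) < (\<Sum>p\<in>?N. c0)"
        using lt by (intro sum_strict_mono finN ne) auto
      also have "\<dots> = real (card ?N) * c0" by simp
      also have "\<dots> \<le> real (2 ^ L * 2) * c0"
      proof (intro mult_right_mono)
        have "card {R. R \<subseteq> I \<and> card R = m} \<le> card (Pow I)"
          using finI by (intro card_mono) auto
        then show "real (card ?N) \<le> real (2 ^ L * 2)"
          unfolding card_cartesian_product by (simp add: card_Pow finI I_def)
      qed (simp add: c0_def)
      also have "\<dots> = 1 / 2" by (simp add: c0_def)
      finally show False using half by simp
    qed
    then obtain R t where R: "R \<subseteq> I" "card R = m" and Rc: "c0 \<le> ?E (\<lambda>x. of_bool (homog a t R x))"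
      by auto
    have "c0 \<le> expect V S (\<lambda>_. \<nu>) (\<lambda>x. of_bool (homog a t S x))" if S: "finite S" "card S \<le> m" for S :: "'s set"
    proof -
      \<comment> \<open>Shorter tuples are read off from fewer positions of the same
        \<open>R\<close>, so one \<open>t\<close> serves all index sets of size at most
        \<open>m\<close>.\<close>
      obtain R' where R': "R' \<subseteq> R" "card R' = card S"
        using S R by (metis obtain_subset_with_card_n)
      have finR: "finite R'" using R R' finI by (meson finite_subset)
      have "?E (\<lambda>x. of_bool (homog a t R x)) \<le> ?E (\<lambda>x. of_bool (homog a t R' x))"
        using nn homog_subset[OF _ R'(1), of a t] by (intro expect_mono) auto
      also have "\<dots> = expect V R' (\<lambda>_. \<nu>) (\<lambda>x. of_bool (homog a t R' x))"
        using R R' tot by (intro expect_marginal homog_depends finI) auto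
      also have "\<dots> = expect V S (\<lambda>_. \<nu>) (\<lambda>x. of_bool (homog a t S x))"
        unfolding homog_def
        by (rule expect_inj_card_eq[OF finR S(1) R'(2), where B = "\<lambda>X. \<forall>u\<in>X. \<forall>v\<in>X. u \<noteq> v \<longrightarrow> a u v = t"])
      finally show ?thesis using Rc by simp
    qed
    then show "\<exists>t. \<forall>S :: 's set. finite S \<longrightarrow> card S \<le> m \<longrightarrow> c0 \<le> expect V S (\<lambda>_. \<nu>) (\<lambda>x. of_bool (homog a t S x))"
      by blast
  qed
qed

section \<open>Bilinear forms bounded by cuts\<close>

lemma sum_le_sum_pos:
  fixes c f :: "'v \<Rightarrow> real"
  assumes "finite V" "\<And>u. 0 \<le> f u \<and> f u \<le> 1"
  shows "(\<Sum>u\<in>V. f u * c u) \<le> sum c {u\<in>V. 0 < c u}"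
proof -
  have "(\<Sum>u\<in>V. f u * c u) \<le> (\<Sum>u\<in>V. if 0 < c u then c u else 0)"
    using assms(2) by (intro sum_mono) (auto simp: mult_left_le_one_le mult_nonneg_nonpos not_less)
  then show ?thesis using assms(1) by (simp add: sum.inter_filter)
qed

text \<open>A bilinear form on functions with values in [0,1] is largest at indicator functions:
  round \<open>f\<close> to the set of positive coefficients, and after that \<open>g\<close>
  likewise.\<close>

lemma cut_bilinear_upper:
  fixes M :: "'v \<Rightarrow> 'v \<Rightarrow> real"
  assumes "finite V" "\<And>X Y. X \<subseteq> V \<Longrightarrow> Y \<subseteq> V \<Longrightarrow> (\<Sum>u\<in>X. \<Sum>v\<in>Y. M u v) \<le> \<eta>"
    and "\<And>u. 0 \<le> f u \<and> f u \<le> 1" "\<And>u. 0 \<le> g u \<and> g u \<le> 1"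
  shows "(\<Sum>u\<in>V. \<Sum>v\<in>V. f u * (g v * M u v)) \<le> \<eta>"
proof -
  define c where "c u = (\<Sum>v\<in>V. g v * M u v)" for u
  define X where "X = {u\<in>V. 0 < c u}"
  define d where "d v = (\<Sum>u\<in>X. M u v)" for v
  have "(\<Sum>u\<in>V. \<Sum>v\<in>V. f u * (g v * M u v)) = (\<Sum>u\<in>V. f u * c u)"
    by (simp add: c_def sum_distrib_left)
  also have "\<dots> \<le> sum c X"
    unfolding X_def by (rule sum_le_sum_pos) (use assms in auto)
  also have "\<dots> = (\<Sum>v\<in>V. \<Sum>u\<in>X. g v * M u v)"
    unfolding c_def by (rule sum.swap)
  also have "\<dots> = (\<Sum>v\<in>V. g v * d v)"
    by (simp add: d_def sum_distrib_left)
  also have "\<dots> \<le> sum d {v\<in>V. 0 < d v}"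
    by (rule sum_le_sum_pos) (use assms in auto)
  also have "\<dots> = (\<Sum>u\<in>X. \<Sum>v\<in>{v\<in>V. 0 < d v}. M u v)"
    unfolding d_def by (rule sum.swap)
  also have "\<dots> \<le> \<eta>" by (rule assms(2)) (auto simp: X_def)
  finally show ?thesis .
qed

lemma cut_bilinear:
  fixes M :: "'v \<Rightarrow> 'v \<Rightarrow> real"
  assumes "finite V" "\<And>X Y. X \<subseteq> V \<Longrightarrow> Y \<subseteq> V \<Longrightarrow> \<bar>\<Sum>u\<in>X. \<Sum>v\<in>Y. M u v\<bar> \<le> \<eta>"
    and "\<And>u. 0 \<le> f u \<and> f u \<le> 1" "\<And>u. 0 \<le> g u \<and> g u \<le> 1"
  shows "\<bar>\<Sum>u\<in>V. \<Sum>v\<in>V. f u * (g v * M u v)\<bar> \<le> \<eta>"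
proof (rule abs_leI)
  show "(\<Sum>u\<in>V. \<Sum>v\<in>V. f u * (g v * M u v)) \<le> \<eta>"
    using assms(2) by (intro cut_bilinear_upper assms) (simp add: abs_le_iff)
  have "(\<Sum>u\<in>V. \<Sum>v\<in>V. f u * (g v * - M u v)) \<le> \<eta>"
    using assms(2) by (intro cut_bilinear_upper assms) (simp add: sum_negf abs_le_iff)
  then show "- (\<Sum>u\<in>V. \<Sum>v\<in>V. f u * (g v * M u v)) \<le> \<eta>" by (simp add: sum_negf)
qed

section \<open>Counting\<close>

definition ignores :: "'s \<Rightarrow> (('s \<Rightarrow> 'v) \<Rightarrow> real) \<Rightarrow> bool" where
  "ignores s F \<longleftrightarrow> (\<forall>x v. F (x(s := v)) = F x)"

lemma depends_on_ignores: "depends_on T F \<Longrightarrow> s \<notin> T \<Longrightarrow> ignores s F"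
  by (simp add: ignores_def depends_on_fun_upd_ignore)

text \<open>For fixed other coordinates, such a function is a product of a function of
  the coordinate \<open>s\<close> and a function of the coordinate \<open>t\<close>.\<close>

definition splits :: "'s \<Rightarrow> 's \<Rightarrow> (('s \<Rightarrow> 'v) \<Rightarrow> real) \<Rightarrow> bool" where
  "splits s t g \<longleftrightarrow> (\<exists>g1 g2. (\<forall>x. g x = g1 x * g2 x \<and> 0 \<le> g1 x \<and> g1 x \<le> 1 \<and> 0 \<le> g2 x \<and> g2 x \<le> 1) \<and>
     ignores t g1 \<and> ignores s g2)"

lemma splits_basic:
  assumes "\<And>x. 0 \<le> g x \<and> g x \<le> 1" "ignores s g \<or> ignores t g"
  shows "splits s t g"
  using assms(2)
proof
  assume "ignores s g"
  then show ?thesis unfolding splits_def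
    using assms(1) by (intro exI[of _ "\<lambda>_. 1"] exI[of _ g]) (simp add: ignores_def)
next
  assume "ignores t g"
  then show ?thesis unfolding splits_def
    using assms(1) by (intro exI[of _ g] exI[of _ "\<lambda>_. 1"]) (simp add: ignores_def)
qed

lemma splits_mult:
  assumes "splits s t g" "splits s t h"
  shows "splits s t (\<lambda>x. g x * h x)"
proof -
  obtain g1 g2 where g: "\<And>x. g x = g1 x * g2 x" "\<And>x. 0 \<le> g1 x \<and> g1 x \<le> 1 \<and> 0 \<le> g2 x \<and> g2 x \<le> 1"
    "ignores t g1" "ignores s g2"
    using assms(1) unfolding splits_def by blast
  obtain h1 h2 where h: "\<And>x. h x = h1 x * h2 x" "\<And>x. 0 \<le> h1 x \<and> h1 x \<le> 1 \<and> 0 \<le> h2 x \<and> h2 x \<le> 1"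
    "ignores t h1" "ignores s h2"
    using assms(2) unfolding splits_def by blast
  show ?thesis unfolding splits_def
    using g h by (intro exI[of _ "\<lambda>x. g1 x * h1 x"] exI[of _ "\<lambda>x. g2 x * h2 x"])
      (simp add: ignores_def mult_ac mult_le_one)
qed

lemma splits_prod:
  assumes "\<And>i. i \<in> I \<Longrightarrow> splits s t (g i)"
  shows "splits s t (\<lambda>x. \<Prod>i\<in>I. g i x)"
  using assms
proof (induction I rule: infinite_finite_induct)
  case (insert i I)
  then show ?case using splits_mult[of s t "g i" "\<lambda>x. \<Prod>i\<in>I. g i x"] by simp
qed (auto intro!: splits_basic simp: ignores_def)

text \<open>With all other coordinates fixed, \<open>g\<close> is a function of the value at
  \<open>s\<close> times a function of the value at \<open>t\<close>. The remaining double sum is a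
  bilinear form bounded by the cuts, and averaging over the fixed coordinates preserves the
  bound.\<close>

lemma expect_cut:
  fixes S :: "'s set" and V :: "'v set"
  assumes "finite S" "finite V" "s \<in> S" "t \<in> S" "s \<noteq> t"
    and nn: "\<And>r v. r \<in> S \<Longrightarrow> 0 \<le> \<nu> r v" and tot: "\<And>r. r \<in> S \<Longrightarrow> sum (\<nu> r) V = 1"
    and g: "splits s t g"
    and cut: "\<And>X Y. X \<subseteq> V \<Longrightarrow> Y \<subseteq> V \<Longrightarrow> \<bar>\<Sum>u\<in>X. \<Sum>v\<in>Y. \<nu> s u * \<nu> t v * m u v\<bar> \<le> \<eta>"
  shows "\<bar>expect V S \<nu> (\<lambda>x. g x * m (x s) (x t))\<bar> \<le> \<eta>"
proof -
  obtain g1 g2 where g12: "\<And>x. g x = g1 x * g2 x" "\<And>x. 0 \<le> g1 x \<and> g1 x \<le> 1" "\<And>x. 0 \<le> g2 x \<and> g2 x \<le> 1"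
    "ignores t g1" "ignores s g2"
    using g unfolding splits_def by blast
  define S0 where "S0 = S - {s, t}"
  have S: "S = insert s (insert t S0)" and fin: "finite S0" and notin: "s \<notin> insert t S0" "t \<notin> S0"
    using assms by (auto simp: S0_def)
  have fin': "finite (insert t S0)" using fin by simp
  define B where "B x = (\<Sum>u\<in>V. \<Sum>v\<in>V. g1 (x(s := u)) * (g2 (x(t := v)) * (\<nu> s u * \<nu> t v * m u v)))" for x
  have "expect V S \<nu> (\<lambda>x. g x * m (x s) (x t)) =
     (\<Sum>u\<in>V. \<nu> s u * (\<Sum>v\<in>V. \<nu> t v * expect V S0 \<nu> (\<lambda>x. g (x(t := v, s := u)) * m u v)))"
    unfolding S expect_insert[OF fin' notin(1)] expect_insert[OF fin notin(2)] using assms(5) by simp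
  also have "\<dots> = (\<Sum>u\<in>V. \<Sum>v\<in>V. expect V S0 \<nu> (\<lambda>x. \<nu> s u * (\<nu> t v * (g (x(t := v, s := u)) * m u v))))"
    by (simp only: sum_distrib_left expect_cmult)
  also have "\<dots> = expect V S0 \<nu> B"
  proof -
    have "g (x(t := v, s := u)) = g1 (x(s := u)) * g2 (x(t := v))" for x u v
    proof -
      have "g1 (x(t := v, s := u)) = g1 (x(s := u))"
        using g12(4) assms(5) unfolding ignores_def by (metis fun_upd_twist)
      moreover have "g2 (x(t := v, s := u)) = g2 (x(t := v))"
        using g12(5) unfolding ignores_def by simp
      ultimately show ?thesis using g12(1) by simp
    qed
    then show ?thesis unfolding B_def expect_sum by (simp add: mult_ac)
  qed
  finally have eq: "expect V S \<nu> (\<lambda>x. g x * m (x s) (x t)) = expect V S0 \<nu> B" .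
  have B: "\<bar>B x\<bar> \<le> \<eta>" for x
    unfolding B_def using g12(2,3) by (intro cut_bilinear assms(2) cut) auto
  have sub: "r \<in> S0 \<Longrightarrow> r \<in> S" for r by (simp add: S0_def)
  have "expect V S0 \<nu> B \<le> expect V S0 \<nu> (\<lambda>_. \<eta>)"
    using B nn sub by (intro expect_mono) (auto simp: abs_le_iff)
  moreover have "expect V S0 \<nu> (\<lambda>_. - \<eta>) \<le> expect V S0 \<nu> B"
    using B nn sub by (intro expect_mono) (auto simp: abs_le_iff minus_le_iff)
  ultimately show ?thesis
    unfolding eq using tot sub fin by (simp add: expect_const abs_le_iff)
qed

text \<open>Adjacency conditions are replaced by densities one pair at a time, at a cost of at most
  \<open>\<eta>\<close> each. This works because no other factor sees both \<open>s\<close> and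
  \<open>t\<close>: a factor \<open>h i\<close> sees one part only, whereas \<open>s\<close> and
  \<open>t\<close> lie in different parts.\<close>

lemma telescoping:
  fixes S :: "'s set" and V :: "'v set" and \<phi> :: "'s \<Rightarrow> nat" and a :: "'v \<Rightarrow> 'v \<Rightarrow> bool"
  assumes fin: "finite S" "finite V" and finE: "finite E" "E \<subseteq> {(s, t) \<in> S \<times> S. \<phi> s < \<phi> t}"
    and nn: "\<And>r v. r \<in> S \<Longrightarrow> 0 \<le> \<nu> r v" and tot: "\<And>r. r \<in> S \<Longrightarrow> sum (\<nu> r) V = 1"
    and h: "\<And>i x. 0 \<le> h i x \<and> h i x \<le> 1" "\<And>i. i \<in> I \<Longrightarrow> depends_on {s\<in>S. \<phi> s = i} (h i)"
    and cut: "\<And>s t X Y. s \<in> S \<Longrightarrow> t \<in> S \<Longrightarrow> \<phi> s < \<phi> t \<Longrightarrow> X \<subseteq> V \<Longrightarrow> Y \<subseteq> V \<Longrightarrow>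
        \<bar>\<Sum>u\<in>X. \<Sum>v\<in>Y. \<nu> s u * \<nu> t v * (of_bool (a u v = A s t) - d s t)\<bar> \<le> \<eta>"
    and d: "\<And>s t. 0 \<le> d s t \<and> d s t \<le> 1"
  shows "\<bar>expect V S \<nu> (\<lambda>x. (\<Prod>i\<in>I. h i x) * (\<Prod>(s, t)\<in>E. of_bool (a (x s) (x t) = A s t)))
     - (\<Prod>(s, t)\<in>E. d s t) * expect V S \<nu> (\<lambda>x. \<Prod>i\<in>I. h i x)\<bar> \<le> real (card E) * \<eta>"
  using finE
proof (induction E rule: finite_induct)
  case empty
  then show ?case by simp
next
  case (insert e E)
  obtain s t where e: "e = (s, t)" by (cases e)
  have st: "s \<in> S" "t \<in> S" "\<phi> s < \<phi> t" and Esub: "E \<subseteq> {(s, t) \<in> S \<times> S. \<phi> s < \<phi> t}"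
    using insert.prems e by auto
  define H where "H x = (\<Prod>i\<in>I. h i x)" for x
  define W where "W x = (\<Prod>(s, t)\<in>E. of_bool (a (x s) (x t) = A s t) :: real)" for x
  have "splits s t (\<lambda>x. H x * W x)"
  proof (rule splits_mult)
    show "splits s t H"
      unfolding H_def
    proof (rule splits_prod, rule splits_basic)
      fix i assume i: "i \<in> I"
      show "0 \<le> h i x \<and> h i x \<le> 1" for x by (rule h(1))
      show "ignores s (h i) \<or> ignores t (h i)"
      proof -
        have "s \<notin> {s\<in>S. \<phi> s = i} \<or> t \<notin> {s\<in>S. \<phi> s = i}" using st by auto
        then show ?thesis using depends_on_ignores[OF h(2)[OF i]] by blast
      qed
    qed
    show "splits s t W"
      unfolding W_def case_prod_unfold
    proof (rule splits_prod, rule splits_basic)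
      fix p assume p: "p \<in> E"
      \<comment> \<open>The only other pair with both ends among \<open>s\<close> and
        \<open>t\<close> would be \<open>(t, s)\<close>, which the orientation by
        \<open>\<phi>\<close> excludes.\<close>
      then have "p \<noteq> (s, t)" "\<phi> (fst p) < \<phi> (snd p)" using insert.hyps e Esub by auto
      then have "s \<notin> {fst p, snd p} \<or> t \<notin> {fst p, snd p}"
        using st by (cases p) auto
      moreover have dep: "depends_on {fst p, snd p} (\<lambda>x. of_bool (a (x (fst p)) (x (snd p)) = A (fst p) (snd p)) :: real)"
        by (simp add: depends_on_def)
      ultimately consider "s \<notin> {fst p, snd p}" | "t \<notin> {fst p, snd p}" by blast
      then show "ignores s (\<lambda>x. of_bool (a (x (fst p)) (x (snd p)) = A (fst p) (snd p))) \<or>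
          ignores t (\<lambda>x. of_bool (a (x (fst p)) (x (snd p)) = A (fst p) (snd p)))"
        by cases (simp_all only: depends_on_ignores[OF dep] simp_thms)
    qed simp
  qed
  then have 1: "\<bar>expect V S \<nu> (\<lambda>x. H x * W x * (of_bool (a (x s) (x t) = A s t) - d s t))\<bar> \<le> \<eta>"
    using st by (intro expect_cut[where m = "\<lambda>u v. of_bool (a u v = A s t) - d s t"] fin nn tot cut) auto
  have 2: "\<bar>expect V S \<nu> (\<lambda>x. H x * W x) - (\<Prod>(s, t)\<in>E. d s t) * expect V S \<nu> H\<bar> \<le> real (card E) * \<eta>"
    using insert.IH[OF Esub] unfolding H_def W_def .
  have "expect V S \<nu> (\<lambda>x. H x * (\<Prod>(s, t)\<in>insert e E. of_bool (a (x s) (x t) = A s t))) =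
     expect V S \<nu> (\<lambda>x. H x * W x * (of_bool (a (x s) (x t) = A s t) - d s t) + d s t * (H x * W x))"
    using insert.hyps e by (intro expect_cong) (simp add: W_def algebra_simps)
  also have "\<dots> = expect V S \<nu> (\<lambda>x. H x * W x * (of_bool (a (x s) (x t) = A s t) - d s t)) + d s t * expect V S \<nu> (\<lambda>x. H x * W x)"
    by (simp only: expect_add expect_cmult)
  finally have "expect V S \<nu> (\<lambda>x. H x * (\<Prod>(s, t)\<in>insert e E. of_bool (a (x s) (x t) = A s t)))
     - (\<Prod>(s, t)\<in>insert e E. d s t) * expect V S \<nu> H =
     expect V S \<nu> (\<lambda>x. H x * W x * (of_bool (a (x s) (x t) = A s t) - d s t)) +
     d s t * (expect V S \<nu> (\<lambda>x. H x * W x) - (\<Prod>(s, t)\<in>E. d s t) * expect V S \<nu> H)"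
    using insert.hyps e by (simp add: algebra_simps)
  also have "\<bar>\<dots>\<bar> \<le> \<eta> + real (card E) * \<eta>"
  proof -
    have "\<bar>d s t * (expect V S \<nu> (\<lambda>x. H x * W x) - (\<Prod>(s, t)\<in>E. d s t) * expect V S \<nu> H)\<bar> \<le>
       \<bar>expect V S \<nu> (\<lambda>x. H x * W x) - (\<Prod>(s, t)\<in>E. d s t) * expect V S \<nu> H\<bar>"
      using d[of s t] by (simp add: abs_mult mult_left_le_one_le)
    then show ?thesis using 1 2 by linarith
  qed
  finally show ?case unfolding H_def[symmetric] using insert.hyps by (simp add: algebra_simps)
qed

text \<open>In the application \<open>T i\<close> is the set of vertices of a forbidden graph placed in the
  \<open>i\<close>-th part, and \<open>h i\<close> asks them to be homogeneous.\<close>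

lemma counting:
  fixes S :: "'s set" and V :: "'v set" and \<phi> :: "'s \<Rightarrow> nat" and a :: "'v \<Rightarrow> 'v \<Rightarrow> bool"
  defines "T \<equiv> \<lambda>i. {s\<in>S. \<phi> s = i}"
  assumes fin: "finite S" "finite V"
    and nn: "\<And>i v. i \<in> \<phi> ` S \<Longrightarrow> 0 \<le> \<nu> i v" and tot: "\<And>i. i \<in> \<phi> ` S \<Longrightarrow> sum (\<nu> i) V = 1"
    and h: "\<And>i x. 0 \<le> h i x \<and> h i x \<le> 1" "\<And>i. i \<in> \<phi> ` S \<Longrightarrow> depends_on (T i) (h i)"
    and hc: "\<And>i. i \<in> \<phi> ` S \<Longrightarrow> c0 \<le> expect V (T i) (\<lambda>_. \<nu> i) (h i)" "0 < c0" "c0 \<le> 1"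
    and cut: "\<And>i j X Y. i \<in> \<phi> ` S \<Longrightarrow> j \<in> \<phi> ` S \<Longrightarrow> i \<noteq> j \<Longrightarrow> X \<subseteq> V \<Longrightarrow> Y \<subseteq> V \<Longrightarrow>
        \<bar>\<Sum>u\<in>X. \<Sum>v\<in>Y. \<nu> i u * \<nu> j v * (of_bool (a u v) - d i j)\<bar> \<le> \<eta>"
    and d: "\<And>i j. 0 \<le> d i j \<and> d i j \<le> 1"
    and dA: "\<And>s t. s \<in> S \<Longrightarrow> t \<in> S \<Longrightarrow> \<phi> s \<noteq> \<phi> t \<Longrightarrow> (if A s t then \<beta> \<le> d (\<phi> s) (\<phi> t) else d (\<phi> s) (\<phi> t) \<le> 1 - \<beta>)"
    and \<beta>: "0 < \<beta>" "\<beta> \<le> 1" and m: "card S \<le> m" and \<eta>: "0 \<le> \<eta>"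
  shows "\<beta> ^ (m * m) * c0 ^ m - real (m * m) * \<eta> \<le>
    expect V S (\<lambda>s. \<nu> (\<phi> s)) (\<lambda>x. (\<Prod>i\<in>\<phi> ` S. h i x) *
      (\<Prod>(s, t)\<in>{(s, t) \<in> S \<times> S. \<phi> s < \<phi> t}. of_bool (a (x s) (x t) = A s t)))"
proof -
  define E where "E = {(s, t) \<in> S \<times> S. \<phi> s < \<phi> t}"
  define D where "D s t = (if A s t then d (\<phi> s) (\<phi> t) else 1 - d (\<phi> s) (\<phi> t))" for s t
  have finE: "finite E" unfolding E_def by (rule finite_subset[of _ "S \<times> S"]) (use fin in auto)
  have "card E \<le> card (S \<times> S)" unfolding E_def using fin by (intro card_mono) auto
  also have "\<dots> \<le> m * m" using m by (simp add: card_cartesian_product mult_le_mono)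
  finally have cardE: "card E \<le> m * m" .
  have tele: "\<bar>expect V S (\<lambda>s. \<nu> (\<phi> s)) (\<lambda>x. (\<Prod>i\<in>\<phi> ` S. h i x) * (\<Prod>(s, t)\<in>E. of_bool (a (x s) (x t) = A s t)))
     - (\<Prod>(s, t)\<in>E. D s t) * expect V S (\<lambda>s. \<nu> (\<phi> s)) (\<lambda>x. \<Prod>i\<in>\<phi> ` S. h i x)\<bar> \<le> real (card E) * \<eta>"
  proof (rule telescoping[OF fin finE, where \<phi> = \<phi>])
    show "E \<subseteq> {(s, t). (s, t) \<in> S \<times> S \<and> \<phi> s < \<phi> t}" by (auto simp: E_def)
    show "0 \<le> D s t \<and> D s t \<le> 1" for s t using d[of "\<phi> s" "\<phi> t"] by (simp add: D_def)
    show "depends_on {s \<in> S. \<phi> s = i} (h i)" if "i \<in> \<phi> ` S" for i using h(2)[OF that] by (simp add: T_def)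
    fix s t X Y assume st: "s \<in> S" "t \<in> S" "\<phi> s < \<phi> t" "X \<subseteq> V" "Y \<subseteq> V"
    let ?c = "\<lambda>u v. \<nu> (\<phi> s) u * \<nu> (\<phi> t) v"
    \<comment> \<open>For a prescribed non-edge the discrepancy merely changes its sign, so the
      bound for \<open>a\<close> covers both cases.\<close>
    have "(\<Sum>u\<in>X. \<Sum>v\<in>Y. ?c u v * (of_bool (a u v = A s t) - D s t)) =
       (if A s t then 1 else - 1) * (\<Sum>u\<in>X. \<Sum>v\<in>Y. ?c u v * (of_bool (a u v) - d (\<phi> s) (\<phi> t)))"
      unfolding sum_distrib_left by (intro sum.cong refl) (auto simp: D_def algebra_simps)
    then show "\<bar>\<Sum>u\<in>X. \<Sum>v\<in>Y. ?c u v * (of_bool (a u v = A s t) - D s t)\<bar> \<le> \<eta>"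
      using cut[of "\<phi> s" "\<phi> t" X Y] st by (simp add: abs_mult)
  qed (use nn tot h in auto)
  have "c0 ^ m \<le> c0 ^ card (\<phi> ` S)"
    using hc m card_image_le[OF fin(1), of \<phi>] by (intro power_decreasing) auto
  also have "\<dots> \<le> (\<Prod>i\<in>\<phi> ` S. expect V (T i) (\<lambda>s. \<nu> (\<phi> s)) (h i))"
  proof -
    have "expect V (T i) (\<lambda>s. \<nu> (\<phi> s)) (h i) = expect V (T i) (\<lambda>_. \<nu> i) (h i)" for i
      unfolding expect_def T_def by (intro sum.cong refl arg_cong2[where f = "(*)"] prod.cong) auto
    then have "(\<Prod>i\<in>\<phi> ` S. c0) \<le> (\<Prod>i\<in>\<phi> ` S. expect V (T i) (\<lambda>s. \<nu> (\<phi> s)) (h i))"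
      using hc by (intro prod_mono) auto
    then show ?thesis by simp
  qed
  also have "\<dots> = expect V S (\<lambda>s. \<nu> (\<phi> s)) (\<lambda>x. \<Prod>i\<in>\<phi> ` S. h i x)"
    using h tot fin by (intro expect_prod_depends[symmetric]) (auto simp: T_def)
  finally have 1: "c0 ^ m \<le> expect V S (\<lambda>s. \<nu> (\<phi> s)) (\<lambda>x. \<Prod>i\<in>\<phi> ` S. h i x)" .
  have "\<beta> ^ (m * m) \<le> \<beta> ^ card E" using \<beta> cardE by (intro power_decreasing) auto
  also have "\<dots> = (\<Prod>(s, t)\<in>E. \<beta>)" by simp
  also have "\<dots> \<le> (\<Prod>(s, t)\<in>E. D s t)"
  proof (rule prod_mono, clarify)
    fix s t assume "(s, t) \<in> E"
    then show "0 \<le> \<beta> \<and> \<beta> \<le> D s t"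
      using dA[of s t] \<beta> by (auto simp: E_def D_def split: if_splits)
  qed
  finally have 2: "\<beta> ^ (m * m) \<le> (\<Prod>(s, t)\<in>E. D s t)" .
  have "\<beta> ^ (m * m) * c0 ^ m \<le> (\<Prod>(s, t)\<in>E. D s t) * expect V S (\<lambda>s. \<nu> (\<phi> s)) (\<lambda>x. \<Prod>i\<in>\<phi> ` S. h i x)"
    using 1 2 \<beta> hc by (intro mult_mono) (auto intro: order_trans[OF _ 2])
  moreover have "real (card E) * \<eta> \<le> real (m * m) * \<eta>"
    using cardE \<eta> by (intro mult_right_mono) (simp_all only: of_nat_le_iff)
  ultimately show ?thesis using tele unfolding E_def by linarith
qed

section \<open>Choosing representatives\<close>

context wgraph
begin

lemma mass_cells:
  assumes "X \<subseteq> V" "r ` V \<subseteq> {..<K}"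
  shows "mass X = (\<Sum>l<K. mass (cell r l \<inter> X))"
proof -
  have fin: "finite X" using assms(1) finite_subset by blast
  have rX: "r ` X \<subseteq> {..<K}" using assms by blast
  have "{x\<in>X. r x = l} = cell r l \<inter> X" for l
    using assms(1) by (auto simp: cell_def)
  then show ?thesis
    using sum.group[OF fin finite_lessThan rX, of \<mu>] by simp
qed

lemma cell_refines:
  assumes "refines r q" "x \<in> V"
  shows "cell r (r x) \<subseteq> cell q (q x)"
  using assms unfolding refines_def cell_def by blast

text \<open>The vertices whose fine class may represent coarse class \<open>i\<close>: at most half
  of the fine class lies in \<open>N\<close>, and it is not too light.\<close>

definition good :: "('a \<Rightarrow> nat) \<Rightarrow> ('a \<Rightarrow> nat) \<Rightarrow> 'a set \<Rightarrow> nat \<Rightarrow> nat \<Rightarrow> 'a set" where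
  "good q r N K i = {x \<in> cell q i. mass (cell r (r x) \<inter> N) \<le> mass (cell r (r x)) / 2 \<and>
     mass (cell q i) / (4 * real K) \<le> mass (cell r (r x))}"

text \<open>Two exclusions cost a quarter of the class each. Fine classes with more than half of
  their weight in \<open>N\<close> weigh at most twice what \<open>N\<close> has in the class, that
  is 2/8. There are at most \<open>K\<close> fine classes, so the light ones weigh at most
  \<open>K\<close> times the threshold.\<close>

lemma good_mass:
  assumes ref: "refines r q" and r: "r ` V \<subseteq> {..<K}" and K: "0 < K"
    and N: "mass (cell q i \<inter> N) \<le> mass (cell q i) / 8"
  shows "mass (cell q i) / 2 \<le> mass (good q r N K i)"
proof -
  let ?M = "mass (cell q i)"
  define B1 where "B1 = {x \<in> cell q i. mass (cell r (r x)) / 2 < mass (cell r (r x) \<inter> N)}"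
  define B2 where "B2 = {x \<in> cell q i. mass (cell r (r x)) < ?M / (4 * real K)}"
  have sub: "B1 \<subseteq> V" "B2 \<subseteq> V" "cell q i \<inter> N \<subseteq> V" by (auto simp: B1_def B2_def cell_def)
  have "mass B1 = (\<Sum>l<K. mass (cell r l \<inter> B1))" by (rule mass_cells[OF sub(1) r])
  also have "\<dots> \<le> (\<Sum>l<K. 2 * mass (cell r l \<inter> (cell q i \<inter> N)))"
  proof (rule sum_mono)
    fix l
    show "mass (cell r l \<inter> B1) \<le> 2 * mass (cell r l \<inter> (cell q i \<inter> N))"
    proof (cases "cell r l \<inter> B1 = {}")
      case False
      then obtain x where x: "x \<in> B1" "x \<in> V" "r x = l" by (auto simp: cell_def)
      then have "cell r l \<subseteq> cell q i"
        using cell_refines[OF ref, of x] by (auto simp: B1_def cell_def)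
      then have "cell r l \<inter> (cell q i \<inter> N) = cell r l \<inter> N" by auto
      moreover have "mass (cell r l) / 2 < mass (cell r l \<inter> N)" using x by (auto simp: B1_def)
      moreover have "mass (cell r l \<inter> B1) \<le> mass (cell r l)" by (intro mass_mono cell_subset) auto
      ultimately show ?thesis by simp
    qed simp
  qed
  also have "\<dots> = 2 * mass (cell q i \<inter> N)"
    using mass_cells[OF sub(3) r] by (simp only: sum_distrib_left)
  finally have 1: "mass B1 \<le> ?M / 4" using N by simp
  have "mass B2 = (\<Sum>l<K. mass (cell r l \<inter> B2))" by (rule mass_cells[OF sub(2) r])
  also have "\<dots> \<le> (\<Sum>l<K. ?M / (4 * real K))"
  proof (rule sum_mono)
    fix l
    show "mass (cell r l \<inter> B2) \<le> ?M / (4 * real K)"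
    proof (cases "cell r l \<inter> B2 = {}")
      case False
      then obtain x where x: "x \<in> B2" "r x = l" by (auto simp: cell_def)
      then have "mass (cell r l) \<le> ?M / (4 * real K)" by (auto simp: B2_def)
      moreover have "mass (cell r l \<inter> B2) \<le> mass (cell r l)" by (intro mass_mono cell_subset) auto
      ultimately show ?thesis by simp
    qed simp
  qed
  also have "\<dots> = ?M / 4" using K by simp
  finally have 2: "mass B2 \<le> ?M / 4" .
  have "cell q i \<subseteq> good q r N K i \<union> (B1 \<union> B2)"
    by (auto simp: good_def B1_def B2_def)
  then have "?M \<le> mass (good q r N K i \<union> (B1 \<union> B2))"
    using sub by (intro mass_mono) (auto simp: good_def cell_def)
  also have "\<dots> \<le> mass (good q r N K i) + mass (B1 \<union> B2)"
    using sub(1,2) finite_subset[OF _ finite_V] by (subst sum_Un) (auto simp: good_def intro!: sum_nonneg)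
  also have "mass (B1 \<union> B2) \<le> mass B1 + mass B2"
    using sub(1,2) finite_subset[OF _ finite_V] by (subst sum_Un) (auto intro!: sum_nonneg)
  finally show ?thesis using 1 2 by simp
qed

definition major :: "('a \<Rightarrow> nat) \<Rightarrow> 'a set \<Rightarrow> real \<Rightarrow> nat \<Rightarrow> nat set" where
  "major q N \<zeta> k = {i. i < k \<and> \<zeta> / real k \<le> mass (cell q i) \<and> mass (cell q i \<inter> N) \<le> mass (cell q i) / 8}"

text \<open>The light classes weigh at most \<open>k\<close> times \<zeta>/k together, and those
  with more than an eighth of their weight in \<open>N\<close> at most eight times the weight of
  \<open>N\<close>.\<close>

lemma mass_minor:
  assumes q: "q ` V \<subseteq> {..<k}" and N: "N \<subseteq> V" and \<zeta>: "0 < \<zeta>"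
  shows "mass {x\<in>V. q x \<notin> major q N \<zeta> k} \<le> \<zeta> + 8 * mass N"
proof -
  let ?Y = "{x\<in>V. q x \<notin> major q N \<zeta> k}"
  have k: "0 < k"
    using q weight_total by (cases "V = {}") auto
  have "mass ?Y = (\<Sum>i<k. mass (cell q i \<inter> ?Y))"
    by (rule mass_cells[OF _ q]) auto
  also have "\<dots> \<le> (\<Sum>i<k. \<zeta> / real k + 8 * mass (cell q i \<inter> N))"
  proof (rule sum_mono)
    fix i assume i: "i \<in> {..<k}"
    have nn: "0 \<le> \<zeta> / real k" using \<zeta> by simp
    show "mass (cell q i \<inter> ?Y) \<le> \<zeta> / real k + 8 * mass (cell q i \<inter> N)"
    proof (cases "i \<in> major q N \<zeta> k")
      case True
      then have "cell q i \<inter> ?Y = {}" by (auto simp: cell_def)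
      then show ?thesis using nn by (metis add_nonneg_nonneg mass_nonneg mult_nonneg_nonneg sum.empty zero_le_numeral)
    next
      case False
      have "mass (cell q i \<inter> ?Y) \<le> mass (cell q i)" by (intro mass_mono cell_subset) auto
      moreover have "mass (cell q i) < \<zeta> / real k \<or> mass (cell q i) / 8 < mass (cell q i \<inter> N)"
        using False i by (auto simp: major_def)
      ultimately show ?thesis using nn mass_nonneg[of "cell q i \<inter> N"] by linarith
    qed
  qed
  also have "\<dots> = \<zeta> + 8 * mass N"
    using k mass_cells[OF N q] by (simp add: sum.distrib sum_distrib_left[symmetric])
  finally show ?thesis .
qed

text \<open>Draw \<open>y i\<close> from the good part of class \<open>i\<close>, proportionally to
  weight and independently. The good part has at least half of the weight, whence the factor 4 for
  pairs. Kept classes weigh at least \<zeta>/k, so the expected number of irregular pairs is at most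
  4k^2/\<zeta>^2 times the irregular weight. The expected weight of the pairs with deviating density
  is bounded by the energy difference through Chebyshev's inequality.\<close>

lemma choose_representatives:
  fixes N :: "'a set"
  assumes ref: "refines r q" and q: "q ` V \<subseteq> {..<k}" and r: "r ` V \<subseteq> {..<K}" and K: "0 < K"
    and irr: "irr_mass r \<eta> \<le> \<eta>" and en: "energy r - energy q \<le> \<delta>"
    and \<zeta>: "0 < \<zeta>" and \<gamma>: "0 < \<gamma>"
    and \<rho>: "4 * (real k)\<^sup>2 / \<zeta>\<^sup>2 * \<eta> + 4 / \<gamma>\<^sup>2 * \<delta> \<le> \<rho>" "\<rho> < 1"
  defines "J \<equiv> major q N \<zeta> k"
  obtains y where "\<And>i. i \<in> J \<Longrightarrow> y i \<in> good q r N K i"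
    "\<And>i j. i \<in> J \<Longrightarrow> j \<in> J \<Longrightarrow> i \<noteq> j \<Longrightarrow> \<not> irregular r \<eta> (r (y i)) (r (y j))"
    "(\<Sum>i\<in>J. \<Sum>j\<in>J - {i}. mass (cell q i) * mass (cell q j) *
        of_bool (\<gamma> < \<bar>dens r (r (y i)) (r (y j)) - dens q i j\<bar>)) \<le> \<rho>"
proof -
  let ?M = "\<lambda>i. mass (cell q i)"
  let ?G = "good q r N K"
  have k: "0 < k"
    using q weight_total by (cases "V = {}") auto
  have finJ: "finite J" and Jk: "J \<subseteq> {..<k}" by (auto simp: J_def major_def)
  have Mpos: "\<zeta> / real k \<le> ?M i" "0 < ?M i" if "i \<in> J" for i
  proof -
    show "\<zeta> / real k \<le> ?M i" using that by (simp add: J_def major_def)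
    moreover have "0 < \<zeta> / real k" using \<zeta> k by simp
    ultimately show "0 < ?M i" by linarith
  qed
  have Ghalf: "?M i / 2 \<le> mass (?G i)" if "i \<in> J" for i
    using that by (intro good_mass[OF ref r K]) (simp add: J_def major_def)
  have Gpos: "0 < mass (?G i)" if "i \<in> J" for i
    using Ghalf[OF that] Mpos(2)[OF that] by linarith
  have Gsub: "?G i \<subseteq> cell q i" for i by (auto simp: good_def)
  have GV: "?G i \<subseteq> V" for i using Gsub cell_subset by blast
  define p where "p i u = \<mu> u * of_bool (u \<in> ?G i) / mass (?G i)" for i u
  define bad where "bad i j u v \<longleftrightarrow> \<gamma> < \<bar>dens r (r u) (r v) - dens q i j\<bar>" for i j u v
  \<comment> \<open>An irregular pair costs 1, so a total below 1 rules out irregular pairs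
    altogether. A deviating density is charged the weight of the pair of classes, the price of
    changing all of it.\<close>
  define c where "c i j u v = of_bool (irregular r \<eta> (r u) (r v)) + ?M i * ?M j * of_bool (bad i j u v)" for i j u v
  have ptot: "sum (p i) V = 1" if "i \<in> J" for i
  proof -
    have "(\<Sum>u\<in>V. \<mu> u * of_bool (u \<in> ?G i)) = mass (?G i)"
      using GV[of i] by (simp add: sum.inter_restrict[symmetric] of_bool_def if_distrib Int_absorb1 cong: if_cong)
    then show ?thesis using Gpos[OF that] by (simp add: p_def sum_divide_distrib[symmetric])
  qed
  define g where "g x y = 4 * (real k)\<^sup>2 / \<zeta>\<^sup>2 * of_bool (irregular r \<eta> (r x) (r y)) +
     4 / \<gamma>\<^sup>2 * (dens r (r x) (r y) - dens q (q x) (q y))\<^sup>2" for x y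
  have g_nonneg: "0 \<le> g x y" for x y unfolding g_def by simp
  have pair_cost: "(\<Sum>u\<in>V. \<Sum>v\<in>V. p i u * (p j v * c i j u v)) \<le> (\<Sum>u\<in>cell q i. \<Sum>v\<in>cell q j. \<mu> u * \<mu> v * g u v)"
    if ij: "i \<in> J" "j \<in> J" for i j
  proof -
    have pz: "p i u = 0" if "u \<notin> cell q i" for u i
      using that Gsub by (auto simp: p_def)
    have "(\<Sum>u\<in>V. \<Sum>v\<in>V. p i u * (p j v * c i j u v)) = (\<Sum>u\<in>cell q i. \<Sum>v\<in>V. p i u * (p j v * c i j u v))"
      using pz cell_subset by (intro sum.mono_neutral_right) auto
    also have "\<dots> = (\<Sum>u\<in>cell q i. \<Sum>v\<in>cell q j. p i u * (p j v * c i j u v))"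
      using pz cell_subset by (intro sum.cong[OF refl] sum.mono_neutral_right) auto
    also have "\<dots> \<le> (\<Sum>u\<in>cell q i. \<Sum>v\<in>cell q j. \<mu> u * \<mu> v * g u v)"
    proof (intro sum_mono)
      fix u v assume u: "u \<in> cell q i" and v: "v \<in> cell q j"
      have ple: "p i u \<le> \<mu> u * (2 / ?M i)" if "i \<in> J" for i u
      proof -
        have "p i u \<le> \<mu> u / mass (?G i)"
          unfolding p_def using Gpos[OF that] by (intro divide_right_mono) auto
        also have "\<dots> \<le> \<mu> u / (?M i / 2)"
          using Ghalf[OF that] Mpos(2)[OF that] by (intro divide_left_mono) (auto intro: mult_pos_pos Gpos[OF that])
        finally show ?thesis by simp
      qed
      have pnn: "0 \<le> p i u" for i u unfolding p_def by simp
      have cnn: "0 \<le> c i j u v" unfolding c_def by simp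
      have "p i u * (p j v * c i j u v) \<le> (\<mu> u * (2 / ?M i)) * ((\<mu> v * (2 / ?M j)) * c i j u v)"
        using ple ij pnn cnn Mpos(2) by (intro mult_mono mult_nonneg_nonneg) (auto intro: less_imp_le)
      also have "\<dots> = \<mu> u * \<mu> v * (4 / (?M i * ?M j) * c i j u v)" by simp
      also have "\<dots> \<le> \<mu> u * \<mu> v * g u v"
      proof (intro mult_left_mono)
        have qi: "q u = i" "q v = j" using u v by (auto simp: cell_def)
        have "4 / (?M i * ?M j) \<le> 4 / ((\<zeta> / real k) * (\<zeta> / real k))"
          using Mpos[OF ij(1)] Mpos[OF ij(2)] \<zeta> k
          by (intro divide_left_mono mult_mono mult_pos_pos) auto
        also have "\<dots> = 4 * (real k)\<^sup>2 / \<zeta>\<^sup>2" by (simp add: power2_eq_square)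
        finally have 1: "4 / (?M i * ?M j) * of_bool (irregular r \<eta> (r u) (r v)) \<le>
           4 * (real k)\<^sup>2 / \<zeta>\<^sup>2 * of_bool (irregular r \<eta> (r u) (r v))"
          by (intro mult_right_mono) auto
        have 2: "4 / (?M i * ?M j) * (?M i * ?M j * of_bool (bad i j u v)) \<le>
            4 / \<gamma>\<^sup>2 * (dens r (r u) (r v) - dens q (q u) (q v))\<^sup>2"
        proof (cases "bad i j u v")
          case True
          then have "\<gamma>\<^sup>2 \<le> (dens r (r u) (r v) - dens q i j)\<^sup>2"
            using \<gamma> unfolding bad_def by (metis abs_le_square_iff abs_of_pos less_imp_le)
          then have "1 \<le> (dens r (r u) (r v) - dens q i j)\<^sup>2 / \<gamma>\<^sup>2"
            using \<gamma> by simp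
          then show ?thesis using True Mpos(2)[OF ij(1)] Mpos(2)[OF ij(2)] qi by simp
        qed simp
        show "4 / (?M i * ?M j) * c i j u v \<le> g u v"
          using add_mono[OF 1 2] unfolding c_def g_def by (simp only: distrib_left)
      qed simp
      finally show "p i u * (p j v * c i j u v) \<le> \<mu> u * \<mu> v * g u v" .
    qed
    finally show ?thesis .
  qed
  have total: "(\<Sum>i\<in>J. \<Sum>j\<in>J - {i}. \<Sum>u\<in>V. \<Sum>v\<in>V. p i u * (p j v * c i j u v)) \<le> \<rho>"
  proof -
    let ?C = "\<lambda>i j. \<Sum>u\<in>cell q i. \<Sum>v\<in>cell q j. \<mu> u * \<mu> v * g u v"
    have Cnn: "0 \<le> ?C i j" for i j using g_nonneg by (intro sum_nonneg) auto
    have "(\<Sum>i\<in>J. \<Sum>j\<in>J - {i}. \<Sum>u\<in>V. \<Sum>v\<in>V. p i u * (p j v * c i j u v)) \<le> (\<Sum>i\<in>J. \<Sum>j\<in>J - {i}. ?C i j)"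
      using pair_cost by (intro sum_mono) auto
    also have "\<dots> \<le> (\<Sum>i\<in>J. \<Sum>j<k. ?C i j)"
      using Jk Cnn by (intro sum_mono sum_mono2) auto
    also have "\<dots> \<le> (\<Sum>i<k. \<Sum>j<k. ?C i j)"
      using Jk Cnn by (intro sum_mono2) (auto intro: sum_nonneg)
    also have "\<dots> = avg g" by (rule avg_cells[OF q finite_lessThan, symmetric])
    also have "\<dots> = 4 * (real k)\<^sup>2 / \<zeta>\<^sup>2 * irr_mass r \<eta> + 4 / \<gamma>\<^sup>2 * (energy r - energy q)"
      unfolding g_def avg_add avg_cmult energy_diff[OF ref] irr_mass_def ..
    also have "\<dots> \<le> 4 * (real k)\<^sup>2 / \<zeta>\<^sup>2 * \<eta> + 4 / \<gamma>\<^sup>2 * \<delta>"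
      using irr en by (intro add_mono mult_left_mono) auto
    finally show ?thesis using \<rho> by linarith
  qed
  obtain y where y: "\<And>i. i \<in> J \<Longrightarrow> y i \<in> V \<and> 0 < p i (y i)"
    and le: "(\<Sum>i\<in>J. \<Sum>j\<in>J - {i}. c i j (y i) (y j)) \<le> \<rho>"
  proof -
    have "\<exists>y. (\<forall>i\<in>J. y i \<in> V \<and> 0 < p i (y i)) \<and>
      (\<Sum>i\<in>J. 0) + (\<Sum>i\<in>J. \<Sum>j\<in>J - {i}. c i j (y i) (y j)) \<le> (\<Sum>i\<in>J. \<Sum>u\<in>V. p i u * 0) +
      (\<Sum>i\<in>J. \<Sum>j\<in>J - {i}. \<Sum>u\<in>V. \<Sum>v\<in>V. p i u * (p j v * c i j u v))"
      using ptot by (intro choose_pairwise[OF finJ finite_V]) (simp_all add: p_def)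
    then show thesis using that total by force
  qed
  have cnn: "0 \<le> c i j u v" for i j u v unfolding c_def by simp
  show thesis
  proof (rule that)
    show "y i \<in> ?G i" if "i \<in> J" for i
      using y[OF that] by (auto simp: p_def zero_less_divide_iff zero_less_mult_iff of_bool_def split: if_splits)
    show "\<not> irregular r \<eta> (r (y i)) (r (y j))" if "i \<in> J" "j \<in> J" "i \<noteq> j" for i j
    proof
      assume "irregular r \<eta> (r (y i)) (r (y j))"
      then have "1 \<le> c i j (y i) (y j)" by (simp add: c_def)
      also have "\<dots> \<le> (\<Sum>j\<in>J - {i}. c i j (y i) (y j))"
        using that finJ cnn by (intro member_le_sum) auto
      also have "\<dots> \<le> (\<Sum>i\<in>J. \<Sum>j\<in>J - {i}. c i j (y i) (y j))"
        using that finJ cnn by (intro member_le_sum[of i J "\<lambda>i. \<Sum>j\<in>J - {i}. c i j (y i) (y j)"] sum_nonneg) auto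
      finally show False using le \<rho> by linarith
    qed
    have "(\<Sum>i\<in>J. \<Sum>j\<in>J - {i}. ?M i * ?M j * of_bool (\<gamma> < \<bar>dens r (r (y i)) (r (y j)) - dens q i j\<bar>))
       \<le> (\<Sum>i\<in>J. \<Sum>j\<in>J - {i}. c i j (y i) (y j))"
      unfolding c_def bad_def by (intro sum_mono) auto
    then show "(\<Sum>i\<in>J. \<Sum>j\<in>J - {i}. ?M i * ?M j * of_bool (\<gamma> < \<bar>dens r (r (y i)) (r (y j)) - dens q i j\<bar>)) \<le> \<rho>"
      using le by linarith
  qed
qed

end

section \<open>Forbidden graphs\<close>

text \<open>\<open>C\<close> collects the vertices seen so far, and \<open>n\<close> more are drawn
  with replacement.\<close>

primrec sample_prob :: "'v set \<Rightarrow> ('v \<Rightarrow> real) \<Rightarrow> ('v set \<Rightarrow> bool) \<Rightarrow> nat \<Rightarrow> 'v set \<Rightarrow> real" where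
  "sample_prob V \<nu> B 0 C = of_bool (B C)"
| "sample_prob V \<nu> B (Suc n) C = (\<Sum>v\<in>V. \<nu> v * sample_prob V \<nu> B n (insert v C))"

lemma expect_image:
  fixes S :: "'s set" and V :: "'v set"
  assumes "finite S"
  shows "expect V S (\<lambda>_. \<nu>) (\<lambda>x. of_bool (B (x ` S \<union> C))) = sample_prob V \<nu> B (card S) C"
  using assms
proof (induction S arbitrary: C rule: finite_induct)
  case empty
  then show ?case by simp
next
  case (insert s S)
  have "expect V (insert s S) (\<lambda>_. \<nu>) (\<lambda>x. of_bool (B (x ` insert s S \<union> C)))
    = (\<Sum>v\<in>V. \<nu> v * expect V S (\<lambda>_. \<nu>) (\<lambda>x. of_bool (B (x ` S \<union> insert v C))))"
    unfolding expect_insert[OF insert.hyps]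
  proof (intro sum.cong refl arg_cong2[where f = "(*)"] expect_cong)
    fix v and x :: "'s \<Rightarrow> 'v"
    have "(x(s := v)) ` insert s S \<union> C = x ` S \<union> insert v C"
      using insert.hyps(2) by auto
    then show "of_bool (B ((x(s := v)) ` insert s S \<union> C)) = (of_bool (B (x ` S \<union> insert v C)) :: real)"
      by simp
  qed
  also have "\<dots> = sample_prob V \<nu> B (card (insert s S)) C"
    unfolding insert.IH using insert.hyps by simp
  finally show ?case .
qed

lemma sample_prob_mono_set:
  assumes "\<And>v. 0 \<le> \<nu> v" "\<And>X Y. B X \<Longrightarrow> X \<subseteq> Y \<Longrightarrow> B Y" "C \<subseteq> D"
  shows "sample_prob V \<nu> B n C \<le> sample_prob V \<nu> B n D"
  using assms(3)
proof (induction n arbitrary: C D)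
  case 0
  then show ?case using assms(2)[of C D] by simp
next
  case (Suc n)
  have "sample_prob V \<nu> B n (insert v C) \<le> sample_prob V \<nu> B n (insert v D)" for v
    using Suc.prems by (intro Suc.IH) auto
  then show ?case using assms(1) by (simp add: sum_mono mult_left_mono)
qed

lemma sample_prob_mono:
  assumes "\<And>v. 0 \<le> \<nu> v" "\<And>X Y. B X \<Longrightarrow> X \<subseteq> Y \<Longrightarrow> B Y" "sum \<nu> V = 1" "m \<le> n"
  shows "sample_prob V \<nu> B m C \<le> sample_prob V \<nu> B n C"
  using assms(4)
proof (induction n rule: dec_induct)
  case (step n)
  have "sample_prob V \<nu> B n C = (\<Sum>v\<in>V. \<nu> v * sample_prob V \<nu> B n C)"
    using assms(3) by (simp add: sum_distrib_right[symmetric])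
  also have "\<dots> \<le> (\<Sum>v\<in>V. \<nu> v * sample_prob V \<nu> B n (insert v C))"
  proof (intro sum_mono mult_left_mono)
    show "sample_prob V \<nu> B n C \<le> sample_prob V \<nu> B n (insert v C)" for v
      by (rule sample_prob_mono_set[OF assms(1)], erule (1) assms(2)) auto
  qed (rule assms(1))
  finally show ?case using step by simp
qed simp

text \<open>Closure under isomorphism and under induced subgraphs in one condition: the property
  passes to pullbacks along injections. Adjacency is compared off the diagonal only.\<close>

definition induced_closed :: "('a set \<Rightarrow> ('a \<Rightarrow> 'a \<Rightarrow> bool) \<Rightarrow> bool) \<Rightarrow> bool" where
  "induced_closed Q \<longleftrightarrow> (\<forall>X a Y b g. Q X a \<longrightarrow> inj_on g Y \<longrightarrow> g ` Y \<subseteq> X \<longrightarrow>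
     (\<forall>y\<in>Y. \<forall>z\<in>Y. y \<noteq> z \<longrightarrow> b y z = a (g y) (g z)) \<longrightarrow> Q Y b)"

lemma induced_closedD:
  assumes "induced_closed Q" "Q X a" "inj_on g Y" "g ` Y \<subseteq> X"
    "\<And>y z. y \<in> Y \<Longrightarrow> z \<in> Y \<Longrightarrow> y \<noteq> z \<Longrightarrow> b y z = a (g y) (g z)"
  shows "Q Y b"
  by (rule assms(1)[unfolded induced_closed_def, rule_format, OF assms(2-4)]) (rule assms(5))

lemma induced_closed_subset:
  assumes "induced_closed Q" "Q Y a" "X \<subseteq> Y"
  shows "Q X a"
  using assms(3) by (intro induced_closedD[OF assms(1,2), of id]) simp_all

text \<open>\<open>(J, Sg, Tt, C0, C1)\<close> is the reduced graph of the modified graph: its vertices are \<open>J\<close>,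
  those in \<open>Sg\<close> stand for one vertex only, the others for a clique or an independent set
  according to \<open>Tt\<close>; \<open>C0\<close> and \<open>C1\<close> are the non-edges and the edges, and other pairs are unrestricted.\<close>

definition conforms :: "nat set \<Rightarrow> nat set \<Rightarrow> nat set \<Rightarrow> (nat \<times> nat) set \<Rightarrow> (nat \<times> nat) set \<Rightarrow>
    ('s \<Rightarrow> nat) \<Rightarrow> 's set \<Rightarrow> ('s \<Rightarrow> 's \<Rightarrow> bool) \<Rightarrow> bool" where
  "conforms J Sg Tt C0 C1 \<phi> S A \<longleftrightarrow> finite S \<and> \<phi> ` S \<subseteq> J \<and>
     (\<forall>s\<in>S. \<forall>t\<in>S. s \<noteq> t \<longrightarrow> A s t = A t s \<and>
        (\<phi> s = \<phi> t \<longrightarrow> \<phi> s \<notin> Sg \<and> A s t = (\<phi> s \<in> Tt)) \<and>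
        (\<phi> s \<noteq> \<phi> t \<longrightarrow> ((\<phi> s, \<phi> t) \<in> C0 \<longrightarrow> \<not> A s t) \<and> ((\<phi> s, \<phi> t) \<in> C1 \<longrightarrow> A s t)))"

text \<open>A maximum over finitely many cases, without control of its size. Both the size of
  forbidden graphs and the threshold on the number of vertices originate here.\<close>

lemma finite_uniform_bound:
  assumes "finite R"
  shows "\<exists>m :: nat. \<forall>r\<in>R. (\<exists>n. P r n) \<longrightarrow> (\<exists>n\<le>m. P r n)"
  using assms
proof (induction R rule: finite_induct)
  case (insert r R)
  then obtain m where m: "\<forall>r\<in>R. (\<exists>n. P r n) \<longrightarrow> (\<exists>n\<le>m. P r n)" by blast
  obtain m' where m': "(\<exists>n. P r n) \<longrightarrow> (\<exists>n\<le>m'. P r n)" by blast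
  show ?case
  proof (rule exI[of _ "max m m'"], intro ballI impI)
    fix r' assume r': "r' \<in> insert r R" "\<exists>n. P r' n"
    then obtain n where "n \<le> m \<or> n \<le> m'" "P r' n" using m m' by blast
    then show "\<exists>n\<le>max m m'. P r' n" by (intro exI[of _ n]) auto
  qed
qed simp

text \<open>Only finitely many tuples describe reduced graphs with labels below \<open>k\<close>.
  For each that admits a conforming graph outside \<open>Q\<close>, one such graph is kept, and
  \<open>m\<close> bounds their sizes. Thus \<open>m\<close> depends on \<open>k\<close> and
  \<open>Q\<close>, but not on the input.\<close>

lemma bounded_witness:
  fixes Q :: "'a set \<Rightarrow> ('a \<Rightarrow> 'a \<Rightarrow> bool) \<Rightarrow> bool"
  obtains m :: nat where "\<And>J Sg Tt C0 C1 (S :: 'a set) A \<phi>. J \<subseteq> {..<k} \<Longrightarrow> Sg \<subseteq> {..<k} \<Longrightarrow> Tt \<subseteq> {..<k} \<Longrightarrow>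
     C0 \<subseteq> {..<k} \<times> {..<k} \<Longrightarrow> C1 \<subseteq> {..<k} \<times> {..<k} \<Longrightarrow> conforms J Sg Tt C0 C1 \<phi> S A \<Longrightarrow> \<not> Q S A \<Longrightarrow>
     \<exists>S A \<phi>. card S \<le> m \<and> conforms J Sg Tt C0 C1 \<phi> S A \<and> \<not> Q S A"
proof -
  let ?R = "Pow {..<k} \<times> Pow {..<k} \<times> Pow {..<k} \<times> Pow ({..<k} \<times> {..<k}) \<times> Pow ({..<k} \<times> {..<k})"
  define P where "P = (\<lambda>(J, Sg, Tt, C0, C1) n. \<exists>(S :: 'a set) A \<phi>. card S = n \<and> conforms J Sg Tt C0 C1 \<phi> S A \<and> \<not> Q S A)"
  have "finite ?R" by simp
  from finite_uniform_bound[OF this, of P]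
  obtain m where m: "\<forall>r\<in>?R. (\<exists>n. P r n) \<longrightarrow> (\<exists>n\<le>m. P r n)"
    by (rule exE)
  show thesis
  proof (rule that[of m])
    fix J Sg Tt C0 C1 and S :: "'a set" and A \<phi>
    assume R: "J \<subseteq> {..<k}" "Sg \<subseteq> {..<k}" "Tt \<subseteq> {..<k}" "C0 \<subseteq> {..<k} \<times> {..<k}" "C1 \<subseteq> {..<k} \<times> {..<k}"
      and c: "conforms J Sg Tt C0 C1 \<phi> S A" "\<not> Q S A"
    have "(J, Sg, Tt, C0, C1) \<in> ?R" using R by simp
    moreover have "P (J, Sg, Tt, C0, C1) (card S)"
      unfolding P_def prod.case using c by (intro exI conjI) (rule refl)
    ultimately have "\<exists>n\<le>m. P (J, Sg, Tt, C0, C1) n" using m[rule_format, OF _ exI] by simp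
    then show "\<exists>S A \<phi>. card S \<le> m \<and> conforms J Sg Tt C0 C1 \<phi> S A \<and> \<not> Q S A"
      unfolding P_def by auto
  qed
qed

context wgraph
begin

definition rel_weight :: "'a set \<Rightarrow> 'a \<Rightarrow> real" where
  "rel_weight U v = of_bool (v \<in> U) * \<mu> v / mass U"

lemma rel_weight_nonneg: "0 \<le> rel_weight U v"
  by (simp add: rel_weight_def)

lemma rel_weight_total:
  assumes "U \<subseteq> V" "0 < mass U"
  shows "sum (rel_weight U) V = 1"
proof -
  have "(\<Sum>v\<in>V. of_bool (v \<in> U) * \<mu> v) = mass U"
    using assms(1) by (simp add: sum.inter_restrict[symmetric] of_bool_def if_distrib[of "\<lambda>z. z * _"] Int_absorb1 cong: if_cong)
  then show ?thesis using assms(2) by (simp add: rel_weight_def sum_divide_distrib[symmetric])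
qed

lemma rel_weight_cut:
  assumes "X \<subseteq> V" "Y \<subseteq> V"
  shows "(\<Sum>u\<in>X. \<Sum>v\<in>Y. rel_weight U u * rel_weight W v * (of_bool (a u v) - d)) = cut d (X \<inter> U) (Y \<inter> W) / (mass U * mass W)"
proof -
  have fin: "finite X" "finite Y" using assms finite_subset by blast+
  have "(\<Sum>u\<in>X. \<Sum>v\<in>Y. rel_weight U u * rel_weight W v * (of_bool (a u v) - d)) =
     (\<Sum>u\<in>X. \<Sum>v\<in>Y. \<mu> u * \<mu> v * ((of_bool (a u v) - d) * of_bool (u \<in> X \<inter> U \<and> v \<in> Y \<inter> W))) / (mass U * mass W)"
    unfolding sum_divide_distrib by (intro sum.cong refl) (simp add: rel_weight_def)
  then show ?thesis using cut_restrict[of "X \<inter> U" X "Y \<inter> W" Y d] fin by simp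
qed

text \<open>Vertex \<open>s\<close> of the forbidden graph is sought in \<open>U (\<phi> s)\<close>.
  Each prescribed adjacency between parts has density at least \<open>\<beta>\<close>, and the
  vertices within a part are homogeneous with chance at least \<open>c0\<close>, so
  \<open>counting\<close> applies. Drawing from \<open>\<mu>\<close> instead of the conditional
  distributions costs a factor \<open>\<omega>\<close> per vertex. A tuple with all adjacencies
  right induces a graph outside \<open>Q\<close>.\<close>

lemma forbidden_density:
  fixes Q :: "'a set \<Rightarrow> ('a \<Rightarrow> 'a \<Rightarrow> bool) \<Rightarrow> bool" and S :: "'a set"
  assumes Q: "induced_closed Q"
    and U: "\<And>i. i \<in> J \<Longrightarrow> U i \<subseteq> cell q i" "\<And>i. i \<in> J \<Longrightarrow> \<omega> \<le> mass (U i)" and \<omega>: "0 < \<omega>" "\<omega> \<le> 1"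
    and cut: "\<And>i j X Y. i \<in> J \<Longrightarrow> j \<in> J \<Longrightarrow> i \<noteq> j \<Longrightarrow> X \<subseteq> U i \<Longrightarrow> Y \<subseteq> U j \<Longrightarrow>
        \<bar>cut (d i j) X Y\<bar> \<le> \<eta> * (mass (U i) * mass (U j))"
    and d: "\<And>i j. 0 \<le> d i j \<and> d i j \<le> 1"
    and hom: "\<And>i T. i \<in> J \<Longrightarrow> finite T \<Longrightarrow> card T \<le> m \<Longrightarrow> (i \<in> Sg \<Longrightarrow> card T \<le> 1) \<Longrightarrow>
        c0 \<le> expect V (T :: 'a set) (\<lambda>_. rel_weight (U i)) (\<lambda>x. of_bool (homog a (i \<in> Tt) T x))"
    and c0: "0 < c0" "c0 \<le> 1" and \<beta>: "0 < \<beta>" "\<beta> \<le> 1" and \<eta>: "0 \<le> \<eta>"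
    and conf: "conforms J Sg Tt {(i, j) \<in> J \<times> J. d i j < \<beta>} {(i, j) \<in> J \<times> J. 1 - \<beta> < d i j} \<phi> S A"
    and S: "card S \<le> m" "\<not> Q S A"
  shows "\<omega> ^ m * (\<beta> ^ (m * m) * c0 ^ m - real (m * m) * \<eta>) \<le> sample_prob V \<mu> (\<lambda>X. \<not> Q X a) m {}"
proof -
  define T where "T i = {s\<in>S. \<phi> s = i}" for i
  define h where "h i x = (of_bool (homog a (i \<in> Tt) (T i) x) :: real)" for i x
  define F where "F x = (\<Prod>i\<in>\<phi> ` S. h i x) *
      (\<Prod>(s, t)\<in>{(s, t) \<in> S \<times> S. \<phi> s < \<phi> t}. of_bool (a (x s) (x t) = A s t))" for x
  have finS: "finite S" and \<phi>J: "\<phi> ` S \<subseteq> J" using conf by (auto simp: conforms_def)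
  have confD: "A s t = A t s" "\<phi> s = \<phi> t \<Longrightarrow> \<phi> s \<notin> Sg \<and> A s t = (\<phi> s \<in> Tt)"
    "\<phi> s \<noteq> \<phi> t \<Longrightarrow> (d (\<phi> s) (\<phi> t) < \<beta> \<longrightarrow> \<not> A s t) \<and> (1 - \<beta> < d (\<phi> s) (\<phi> t) \<longrightarrow> A s t)"
    if "s \<in> S" "t \<in> S" "s \<noteq> t" for s t
  proof -
    have J: "\<phi> s \<in> J" "\<phi> t \<in> J" using \<phi>J that by auto
    note c = conf[unfolded conforms_def, THEN conjunct2, THEN conjunct2, rule_format, OF that]
    show "A s t = A t s" using c by blast
    show "\<phi> s \<notin> Sg \<and> A s t = (\<phi> s \<in> Tt)" if "\<phi> s = \<phi> t" using c that by blast
    show "(d (\<phi> s) (\<phi> t) < \<beta> \<longrightarrow> \<not> A s t) \<and> (1 - \<beta> < d (\<phi> s) (\<phi> t) \<longrightarrow> A s t)" if "\<phi> s \<noteq> \<phi> t"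
      using c that J by auto
  qed
  have UV: "U i \<subseteq> V" if "i \<in> J" for i using U(1)[OF that] cell_subset by blast
  have Upos: "0 < mass (U i)" if "i \<in> J" for i using U(2)[OF that] \<omega> by linarith
  have "\<beta> ^ (m * m) * c0 ^ m - real (m * m) * \<eta> \<le> expect V S (\<lambda>s. rel_weight (U (\<phi> s))) F"
    unfolding F_def
  proof (rule counting[where d = d])
    show "finite S" "finite V" by (auto simp: finS)
    show "0 \<le> rel_weight (U i) v" for i v by (rule rel_weight_nonneg)
    show "sum (rel_weight (U i)) V = 1" if "i \<in> \<phi> ` S" for i
      using that \<phi>J UV Upos by (intro rel_weight_total) auto
    show "0 \<le> h i x \<and> h i x \<le> 1" for i x by (simp add: h_def)
    show "depends_on {s \<in> S. \<phi> s = i} (h i)" for i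
      unfolding h_def T_def by (rule homog_depends)
    show "c0 \<le> expect V {s \<in> S. \<phi> s = i} (\<lambda>_. rel_weight (U i)) (h i)" if "i \<in> \<phi> ` S" for i
      unfolding h_def T_def[symmetric]
    proof (rule hom)
      show "i \<in> J" using that \<phi>J by blast
      show "finite (T i)" using finS by (simp add: T_def)
      have "card (T i) \<le> card S" using finS by (intro card_mono) (auto simp: T_def)
      then show "card (T i) \<le> m" using S by simp
      \<comment> \<open>\<open>conforms\<close> does not allow two vertices in a part from
        \<open>Sg\<close>.\<close>
      show "card (T i) \<le> 1" if "i \<in> Sg"
        using confD(2) that finS unfolding T_def One_nat_def by (subst card_le_Suc0_iff_eq) auto
    qed
    show "\<bar>\<Sum>u\<in>X. \<Sum>v\<in>Y. rel_weight (U i) u * rel_weight (U j) v * (of_bool (a u v) - d i j)\<bar> \<le> \<eta>"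
      if "i \<in> \<phi> ` S" "j \<in> \<phi> ` S" "i \<noteq> j" "X \<subseteq> V" "Y \<subseteq> V" for i j X Y
    proof -
      have ij: "i \<in> J" "j \<in> J" using that \<phi>J by auto
      have "\<bar>cut (d i j) (X \<inter> U i) (Y \<inter> U j)\<bar> \<le> \<eta> * (mass (U i) * mass (U j))"
        using that(3) ij by (intro cut) auto
      then show ?thesis
        unfolding rel_weight_cut[OF that(4,5)] using Upos[OF ij(1)] Upos[OF ij(2)]
        by (simp add: abs_mult pos_divide_le_eq)
    qed
    show "if A s t then \<beta> \<le> d (\<phi> s) (\<phi> t) else d (\<phi> s) (\<phi> t) \<le> 1 - \<beta>"
      if "s \<in> S" "t \<in> S" "\<phi> s \<noteq> \<phi> t" for s t
      using confD(3)[of s t] that by (auto simp: not_less[symmetric])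
  qed (use d c0 \<beta> \<eta> S in auto)
  then have "\<omega> ^ m * (\<beta> ^ (m * m) * c0 ^ m - real (m * m) * \<eta>) \<le> \<omega> ^ m * expect V S (\<lambda>s. rel_weight (U (\<phi> s))) F"
    using \<omega> by (intro mult_left_mono) auto
  also have "\<dots> \<le> expect V S (\<lambda>_. \<mu>) (\<lambda>x. of_bool (\<not> Q (x ` S) a))"
    unfolding expect_def sum_distrib_left
  proof (rule sum_mono)
    fix x assume x: "x \<in> S \<rightarrow>\<^sub>E V"
    show "\<omega> ^ m * ((\<Prod>s\<in>S. rel_weight (U (\<phi> s)) (x s)) * F x) \<le> (\<Prod>s\<in>S. \<mu> (x s)) * of_bool (\<not> Q (x ` S) a)"
    proof (cases "(\<forall>s\<in>S. x s \<in> U (\<phi> s)) \<and> F x \<noteq> 0")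
      case False
      have "(\<Prod>s\<in>S. rel_weight (U (\<phi> s)) (x s)) * F x = 0"
      proof (cases "F x = 0")
        case nz: False
        then obtain s where "s \<in> S" "x s \<notin> U (\<phi> s)" using False by blast
        then have "rel_weight (U (\<phi> s)) (x s) = 0" by (simp add: rel_weight_def)
        then show ?thesis using \<open>s \<in> S\<close> finS prod_zero by fastforce
      qed simp
      then show ?thesis by (simp only: mult_zero_right) (simp add: prod_nonneg)
    next
      case True
      then have xU: "\<And>s. s \<in> S \<Longrightarrow> x s \<in> U (\<phi> s)" by blast
      have Fnz: "F x \<noteq> 0" using True by blast
      have fin2: "finite {(s, t) \<in> S \<times> S. \<phi> s < \<phi> t}"
        by (rule finite_subset[of _ "S \<times> S"]) (use finS in auto)
      have hx: "homog a (i \<in> Tt) (T i) x" if "i \<in> \<phi> ` S" for i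
        using Fnz that finS by (auto simp: F_def h_def split: if_splits)
      have lt: "a (x s) (x t) = A s t" if "s \<in> S" "t \<in> S" "\<phi> s < \<phi> t" for s t
      proof -
        have "(\<Prod>(s, t)\<in>{(s, t) \<in> S \<times> S. \<phi> s < \<phi> t}. of_bool (a (x s) (x t) = A s t) :: real) \<noteq> 0"
          using Fnz by (auto simp: F_def)
        then have "(case (s, t) of (s, t) \<Rightarrow> (of_bool (a (x s) (x t) = A s t) :: real)) \<noteq> 0"
          using that fin2 prod_zero_iff[OF fin2] by blast
        then show ?thesis by simp
      qed
      \<comment> \<open>Inside a part both claims come from homogeneity. Across parts, distinctness
        holds because cells are disjoint, and adjacency is one of the oriented conditions, up to
        symmetry.\<close>
      have ne: "x s \<noteq> x t \<and> a (x s) (x t) = A s t" if st: "s \<in> S" "t \<in> S" "s \<noteq> t" for s t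
      proof (cases "\<phi> s = \<phi> t")
        case True
        have "homog a (\<phi> s \<in> Tt) (T (\<phi> s)) x" using hx st by blast
        moreover have "s \<in> T (\<phi> s)" "t \<in> T (\<phi> s)" using st True by (auto simp: T_def)
        ultimately have "x s \<noteq> x t" "a (x s) (x t) = (\<phi> s \<in> Tt)"
          using st(3) unfolding homog_def inj_on_def by blast+
        then show ?thesis using confD(2)[OF st True] by simp
      next
        case False
        have "q (x s) = \<phi> s" "q (x t) = \<phi> t"
          using xU[OF st(1)] xU[OF st(2)] U(1) \<phi>J st unfolding cell_def by blast+
        then have "x s \<noteq> x t" using False by auto
        moreover have "a (x s) (x t) = A s t"
        proof (cases "\<phi> s < \<phi> t")
          case True then show ?thesis using lt st by blast
        next
          case nlt: False
          then have "a (x t) (x s) = A t s" using False st by (intro lt) auto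
          then show ?thesis using confD(1)[OF st] adj_sym by blast
        qed
        ultimately show ?thesis by blast
      qed
      have nQ: "\<not> Q (x ` S) a"
      proof
        assume "Q (x ` S) a"
        then have "Q S A"
          by (rule induced_closedD[OF Q, where g = x]) (use ne in \<open>auto simp: inj_on_def\<close>)
        then show False using S by blast
      qed
      have "F x \<le> 1"
        unfolding F_def h_def case_prod_unfold by (intro mult_le_one prod_le_1 prod_nonneg) auto
      have "\<omega> ^ m \<le> \<omega> ^ card S" using \<omega> S by (intro power_decreasing) auto
      also have "\<dots> = (\<Prod>s\<in>S. \<omega>)" by simp
      finally have 1: "\<omega> ^ m \<le> (\<Prod>s\<in>S. \<omega>)" .
      have nnp: "0 \<le> (\<Prod>s\<in>S. rel_weight (U (\<phi> s)) (x s))" by (intro prod_nonneg) (simp add: rel_weight_nonneg)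
      have "(\<Prod>s\<in>S. rel_weight (U (\<phi> s)) (x s)) * F x \<le> (\<Prod>s\<in>S. rel_weight (U (\<phi> s)) (x s))"
        using \<open>F x \<le> 1\<close> nnp by (simp add: mult_left_le)
      then have "\<omega> ^ m * ((\<Prod>s\<in>S. rel_weight (U (\<phi> s)) (x s)) * F x) \<le> (\<Prod>s\<in>S. \<omega>) * (\<Prod>s\<in>S. rel_weight (U (\<phi> s)) (x s))"
        using 1 nnp \<omega> by (meson mult_mono mult_left_mono order_trans mult_right_mono zero_le_power less_imp_le)
      also have "\<dots> = (\<Prod>s\<in>S. \<omega> * rel_weight (U (\<phi> s)) (x s))" by (simp add: prod.distrib)
      also have "\<dots> \<le> (\<Prod>s\<in>S. \<mu> (x s))"
      proof (rule prod_mono)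
        fix s assume s: "s \<in> S"
        then have i: "\<phi> s \<in> J" using \<phi>J by blast
        have "\<omega> * rel_weight (U (\<phi> s)) (x s) \<le> mass (U (\<phi> s)) * rel_weight (U (\<phi> s)) (x s)"
          using U(2)[OF i] by (intro mult_right_mono rel_weight_nonneg)
        also have "\<dots> = \<mu> (x s)" using xU[OF s] Upos[OF i] by (simp add: rel_weight_def)
        finally show "0 \<le> \<omega> * rel_weight (U (\<phi> s)) (x s) \<and> \<omega> * rel_weight (U (\<phi> s)) (x s) \<le> \<mu> (x s)"
          using \<omega> rel_weight_nonneg by simp
      qed
      finally show ?thesis using nQ by simp
    qed
  qed
  also have "\<dots> = sample_prob V \<mu> (\<lambda>X. \<not> Q X a) (card S) {}"
    using expect_image[OF finS, of V \<mu> "\<lambda>X. \<not> Q X a" "{}"] by simp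
  also have "\<dots> \<le> sample_prob V \<mu> (\<lambda>X. \<not> Q X a) m {}"
    using S weight_total induced_closed_subset[OF Q] by (intro sample_prob_mono) auto
  finally show ?thesis .
qed

end

section \<open>Refining or modifying\<close>

context wgraph
begin

text \<open>\<open>d\<close> will be the density between the representatives, not between the
  classes. Pairs with intermediate density keep their adjacency; they are the unrestricted pairs of
  the reduced graph.\<close>

definition modified :: "('a \<Rightarrow> nat) \<Rightarrow> nat set \<Rightarrow> (nat \<Rightarrow> nat \<Rightarrow> real) \<Rightarrow> real \<Rightarrow> 'a \<Rightarrow> 'a \<Rightarrow> bool" where
  "modified q Tt d \<beta> x y = (if q x = q y then q x \<in> Tt
     else if d (q x) (q y) < \<beta> then False
     else if 1 - \<beta> < d (q x) (q y) then True else a x y)"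

text \<open>Ordered pairs are summed, so the pairs meeting \<open>V - X\<close> weigh at most twice
  \<open>mass (V - X)\<close>. Only the graph on \<open>X\<close> is required to have
  \<open>Q\<close>; completing it to \<open>V\<close> is left for later.\<close>

definition close_to :: "real \<Rightarrow> ('a set \<Rightarrow> ('a \<Rightarrow> 'a \<Rightarrow> bool) \<Rightarrow> bool) \<Rightarrow> bool" where
  "close_to \<epsilon> Q \<longleftrightarrow> (\<exists>X\<subseteq>V. \<exists>b. Q X b \<and>
     (\<Sum>x\<in>X. \<Sum>y\<in>X. \<mu> x * \<mu> y * of_bool (x \<noteq> y \<and> b x y \<noteq> a x y)) + 2 * mass (V - X) \<le> \<epsilon>)"

lemma sum_over_cells:
  fixes f :: "'a \<Rightarrow> real"
  assumes "finite J"
  shows "(\<Sum>x\<in>{x\<in>V. q x \<in> J}. f x) = (\<Sum>i\<in>J. \<Sum>x\<in>cell q i. f x)"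
proof -
  have "{x \<in> {x\<in>V. q x \<in> J}. q x = i} = cell q i" if "i \<in> J" for i
    using that by (auto simp: cell_def)
  then have "(\<Sum>i\<in>J. \<Sum>x\<in>cell q i. f x) = (\<Sum>i\<in>J. \<Sum>x\<in>{x \<in> {x\<in>V. q x \<in> J}. q x = i}. f x)"
    by simp
  also have "\<dots> = (\<Sum>x\<in>{x\<in>V. q x \<in> J}. f x)"
    using assms by (intro sum.group) auto
  finally show ?thesis ..
qed

lemma sum_mass_cells:
  assumes "finite J"
  shows "(\<Sum>i\<in>J. mass (cell q i)) \<le> 1"
proof -
  have "(\<Sum>i\<in>J. mass (cell q i)) = mass {x\<in>V. q x \<in> J}"
    using sum_over_cells[OF assms, of \<mu> q] by simp
  then show ?thesis using mass_le_1[of "{x\<in>V. q x \<in> J}"] by auto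
qed

lemma mass_mult: "(\<Sum>x\<in>A. \<Sum>y\<in>B. \<mu> x * \<mu> y * c) = mass A * mass B * c"
  unfolding sum_product by (simp only: sum_distrib_right)

lemma cut0_cells: "cut 0 (cell q i) (cell q j) = dens q i j * (mass (cell q i) * mass (cell q j))"
  using cut_dens[of q i j] unfolding cut_shift[of "dens q i j"] by simp

text \<open>Changes inside classes cost at most \<open>\<epsilon>'\<close>, where singleton classes
  contribute nothing. Pairs of classes with a misleading representative density cost
  \<open>\<rho>\<close>. In the remaining pairs something changes only if the density is within
  \<open>\<beta> + \<gamma>\<close> of 0 or 1, and the weight changed is that distance.\<close>

lemma modified_close:
  assumes J: "finite J" and \<beta>: "0 \<le> \<beta>" and \<gamma>: "0 \<le> \<gamma>" and \<epsilon>': "0 \<le> \<epsilon>'"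
    and part: "\<And>i. mass (cell q i) \<le> \<epsilon>' \<or> card (cell q i) \<le> 1"
    and bad: "(\<Sum>i\<in>J. \<Sum>j\<in>J - {i}. mass (cell q i) * mass (cell q j) * of_bool (\<gamma> < \<bar>d i j - dens q i j\<bar>)) \<le> \<rho>"
  defines "X \<equiv> {x\<in>V. q x \<in> J}"
  shows "(\<Sum>x\<in>X. \<Sum>y\<in>X. \<mu> x * \<mu> y * of_bool (x \<noteq> y \<and> modified q Tt d \<beta> x y \<noteq> a x y)) \<le> \<epsilon>' + \<rho> + (\<beta> + \<gamma>)"
proof -
  let ?M = "\<lambda>i. mass (cell q i)"
  let ?f = "\<lambda>x y. of_bool (x \<noteq> y \<and> modified q Tt d \<beta> x y \<noteq> a x y) :: real"
  let ?S = "\<lambda>i j. \<Sum>x\<in>cell q i. \<Sum>y\<in>cell q j. \<mu> x * \<mu> y * ?f x y"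
  let ?B = "\<lambda>i j. of_bool (\<gamma> < \<bar>d i j - dens q i j\<bar>) :: real"
  have triv: "?S i j \<le> ?M i * ?M j" for i j
  proof -
    have "?S i j \<le> (\<Sum>x\<in>cell q i. \<Sum>y\<in>cell q j. \<mu> x * \<mu> y * 1)"
      by (intro sum_mono mult_left_mono) auto
    then show ?thesis unfolding mass_mult by simp
  qed
  have diag: "?S i i \<le> \<epsilon>' * ?M i" for i
  proof (cases "card (cell q i) \<le> 1")
    case True
    then have "x = y" if "x \<in> cell q i" "y \<in> cell q i" for x y
      using that card_le_Suc0_iff_eq[OF finite_cell] by simp
    then have "?S i i = (\<Sum>x\<in>cell q i. \<Sum>y\<in>cell q i. 0)"
      by (intro sum.cong refl) auto
    then show ?thesis using \<epsilon>' by simp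
  next
    case False
    then have "?M i \<le> \<epsilon>'" using part by blast
    then have "?M i * ?M i \<le> \<epsilon>' * ?M i" by (intro mult_right_mono) auto
    then show ?thesis using triv[of i i] by linarith
  qed
  have off: "?S i j \<le> ?M i * ?M j * ?B i j + (\<beta> + \<gamma>) * (?M i * ?M j)" if ij: "i \<noteq> j" for i j
  proof (cases "\<gamma> < \<bar>d i j - dens q i j\<bar>")
    case True
    moreover have "0 \<le> (\<beta> + \<gamma>) * (?M i * ?M j)" using \<beta> \<gamma> by (intro mult_nonneg_nonneg) auto
    moreover have "?S i j \<le> ?M i * ?M j" by (rule triv)
    ultimately show ?thesis by simp
  next
    case near: False
    let ?MM = "?M i * ?M j"
    have MM: "0 \<le> ?MM" by simp
    have qq: "q x = i" "q y = j" if "x \<in> cell q i" "y \<in> cell q j" for x y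
      using that by (auto simp: cell_def)
    consider "d i j < \<beta>" | "\<not> d i j < \<beta>" "1 - \<beta> < d i j" | "\<not> d i j < \<beta>" "\<not> 1 - \<beta> < d i j" by blast
    then have "?S i j \<le> (\<beta> + \<gamma>) * ?MM"
    proof cases
      case 1
      have "?S i j \<le> cut 0 (cell q i) (cell q j)"
        unfolding cut_def using 1 ij qq by (intro sum_mono mult_left_mono) (auto simp: modified_def)
      also have "\<dots> = dens q i j * ?MM" by (rule cut0_cells)
      also have "\<dots> \<le> (\<beta> + \<gamma>) * ?MM" using 1 near by (intro mult_right_mono MM) linarith
      finally show ?thesis .
    next
      case 2
      have "?S i j \<le> (\<Sum>x\<in>cell q i. \<Sum>y\<in>cell q j. \<mu> x * \<mu> y * 1 - \<mu> x * \<mu> y * (of_bool (a x y) - 0))"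
        using 2 ij qq by (intro sum_mono) (auto simp: modified_def)
      also have "\<dots> = ?MM - cut 0 (cell q i) (cell q j)"
        unfolding cut_def sum_subtractf mass_mult by simp
      also have "\<dots> = (1 - dens q i j) * ?MM" by (simp add: cut0_cells algebra_simps)
      also have "\<dots> \<le> (\<beta> + \<gamma>) * ?MM" using 2 near by (intro mult_right_mono MM) linarith
      finally show ?thesis .
    next
      case 3
      have "?S i j = (\<Sum>x\<in>cell q i. \<Sum>y\<in>cell q j. 0)"
        using 3 ij qq by (intro sum.cong refl) (auto simp: modified_def)
      then show ?thesis using \<beta> \<gamma> MM by simp
    qed
    moreover have "0 \<le> ?MM * ?B i j" by simp
    ultimately show ?thesis by linarith
  qed
  have "(\<Sum>x\<in>X. \<Sum>y\<in>X. \<mu> x * \<mu> y * ?f x y) = (\<Sum>i\<in>J. \<Sum>x\<in>cell q i. \<Sum>j\<in>J. \<Sum>y\<in>cell q j. \<mu> x * \<mu> y * ?f x y)"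
    unfolding X_def sum_over_cells[OF J] ..
  also have "\<dots> = (\<Sum>i\<in>J. \<Sum>j\<in>J. ?S i j)"
    by (intro sum.cong refl sum.swap)
  also have "\<dots> = (\<Sum>i\<in>J. ?S i i + (\<Sum>j\<in>J - {i}. ?S i j))"
    using J by (intro sum.cong refl sum.remove) auto
  also have "\<dots> \<le> (\<Sum>i\<in>J. \<epsilon>' * ?M i + (\<Sum>j\<in>J - {i}. ?M i * ?M j * ?B i j + (\<beta> + \<gamma>) * (?M i * ?M j)))"
    using diag off by (intro sum_mono add_mono) auto
  also have "\<dots> = \<epsilon>' * (\<Sum>i\<in>J. ?M i) + (\<Sum>i\<in>J. \<Sum>j\<in>J - {i}. ?M i * ?M j * ?B i j)
     + (\<beta> + \<gamma>) * (\<Sum>i\<in>J. \<Sum>j\<in>J - {i}. ?M i * ?M j)"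
    by (simp only: sum.distrib sum_distrib_left add.assoc)
  also have "\<dots> \<le> \<epsilon>' * 1 + \<rho> + (\<beta> + \<gamma>) * 1"
  proof (intro add_mono mult_left_mono)
    show "(\<Sum>i\<in>J. ?M i) \<le> 1" by (rule sum_mass_cells[OF J])
    have "(\<Sum>i\<in>J. \<Sum>j\<in>J - {i}. ?M i * ?M j) \<le> (\<Sum>i\<in>J. \<Sum>j\<in>J. ?M i * ?M j)"
      using J by (intro sum_mono sum_mono2) auto
    also have "\<dots> = (\<Sum>i\<in>J. ?M i) * (\<Sum>i\<in>J. ?M i)" by (simp add: sum_product)
    also have "\<dots> \<le> 1" using sum_mass_cells[OF J] by (intro mult_le_one) (auto intro: sum_nonneg)
    finally show "(\<Sum>i\<in>J. \<Sum>j\<in>J - {i}. ?M i * ?M j) \<le> 1" .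
  qed (use bad \<beta> \<gamma> \<epsilon>' in auto)
  finally show ?thesis by simp
qed

section \<open>The potential and its growth\<close>

definition singles :: "('a \<Rightarrow> nat) \<Rightarrow> real" where
  "singles q = mass {x\<in>V. cell q (q x) = {x}}"

definition potential :: "('a \<Rightarrow> nat) \<Rightarrow> real" where
  "potential q = energy q + singles q"

lemma potential_bounds: "0 \<le> potential q" "potential q \<le> 2"
  using energy_nonneg[of q] energy_le_1[of q] mass_le_1[of "{x\<in>V. cell q (q x) = {x}}"]
  by (auto simp: potential_def singles_def)

text \<open>At most 1/\<theta> vertices have weight at least \<theta>, so giving each its own class
  adds boundedly many classes.\<close>

lemma separate_atoms:
  assumes r: "r ` V \<subseteq> {..<K}" and \<theta>: "0 < \<theta>"
  obtains r' where "refines r' r" "r' ` V \<subseteq> {..<K + nat \<lceil>1 / \<theta>\<rceil>}"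
    "\<And>x. x \<in> V \<Longrightarrow> \<theta> \<le> \<mu> x \<Longrightarrow> cell r' (r' x) = {x}"
proof -
  define H where "H = {x\<in>V. \<theta> \<le> \<mu> x}"
  define f where "f x = (if \<theta> \<le> \<mu> x then Inr x else Inl (r x))" for x
  have finH: "finite H" by (simp add: H_def)
  have "real (card H) * \<theta> = (\<Sum>x\<in>H. \<theta>)" by simp
  also have "\<dots> \<le> mass H" unfolding H_def by (intro sum_mono) auto
  also have "\<dots> \<le> 1" by (rule mass_le_1) (auto simp: H_def)
  finally have "real (card H) \<le> 1 / \<theta>" using \<theta> by (simp add: field_simps)
  then have cH: "card H \<le> nat \<lceil>1 / \<theta>\<rceil>" by linarith
  have "f ` V \<subseteq> {..<K} <+> H" "finite ({..<K} <+> H)" "card ({..<K} <+> H) \<le> K + nat \<lceil>1 / \<theta>\<rceil>"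
    using r cH finH by (auto simp: f_def H_def card_Plus)
  then obtain r' where r': "r' ` V \<subseteq> {..<K + nat \<lceil>1 / \<theta>\<rceil>}"
    "\<And>x y. x \<in> V \<Longrightarrow> y \<in> V \<Longrightarrow> r' x = r' y \<longleftrightarrow> f x = f y"
    by (rule encode_partition[where 'a = 'a]) blast
  show thesis
  proof (rule that[OF _ r'(1)])
    have "r x = r y" if "f x = f y" for x y
      using that by (auto simp: f_def split: if_splits)
    then show "refines r' r" using r'(2) unfolding refines_def by blast
    fix x assume x: "x \<in> V" "\<theta> \<le> \<mu> x"
    have "y = x" if "f y = f x" for y using that x(2) by (auto simp: f_def split: if_splits)
    then have "y = x" if "y \<in> V" "r' y = r' x" for y using r'(2)[OF that(1) x(1)] that(2) by blast
    then show "cell r' (r' x) = {x}" using x(1) unfolding cell_def by blast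
  qed
qed

text \<open>Singleton classes survive refinement, and the heavy vertices that were not singletons in
  \<open>q\<close> become so in \<open>r'\<close>; both sets are disjoint.\<close>

lemma potential_separate:
  assumes "refines r q" "refines r' r"
    and "\<And>x. x \<in> V \<Longrightarrow> \<theta> \<le> \<mu> x \<Longrightarrow> cell r' (r' x) = {x}"
  shows "energy r + singles q + mass {x\<in>V. \<theta> \<le> \<mu> x \<and> cell q (q x) \<noteq> {x}} \<le> potential r'"
proof -
  let ?A = "{x\<in>V. cell q (q x) = {x}}" and ?N = "{x\<in>V. \<theta> \<le> \<mu> x \<and> cell q (q x) \<noteq> {x}}"
  have sub: "?A \<subseteq> {x\<in>V. cell r' (r' x) = {x}}"
  proof clarify
    fix x assume x: "x \<in> V" "cell q (q x) = {x}"
    then have "cell r' (r' x) \<subseteq> {x}"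
      using cell_refines[OF refines_trans[OF assms(2,1)] x(1)] by simp
    moreover have "x \<in> cell r' (r' x)" using x by (simp add: cell_def)
    ultimately show "cell r' (r' x) = {x}" by blast
  qed
  have "singles q + mass ?N = mass (?A \<union> ?N)"
    unfolding singles_def by (intro sum.union_disjoint[symmetric]) auto
  also have "\<dots> \<le> singles r'"
    unfolding singles_def using sub assms(3) by (intro mass_mono) auto
  finally show ?thesis
    using energy_mono[OF assms(2)] by (simp add: potential_def)
qed

text \<open>One round for a coarse partition \<open>q\<close> whose refinement \<open>r\<close>
  gains little. If the modified graph on the kept classes has \<open>Q\<close>, it witnesses
  closeness; otherwise a forbidden graph of bounded size conforms to its reduced graph and is
  sampled often. The constants \<open>m\<close>, \<open>c0\<close> and \<open>\<tau>\<close> are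
  given from outside because they must be uniform in the graph.\<close>

lemma level_step:
  fixes Q :: "'a set \<Rightarrow> ('a \<Rightarrow> 'a \<Rightarrow> bool) \<Rightarrow> bool"
  assumes Q: "induced_closed Q" and \<epsilon>: "0 < \<epsilon>" "\<epsilon> \<le> 1" and k: "0 < k" and K: "0 < K"
    and wit: "\<And>J Sg Tt C0 C1 (S :: 'a set) A \<phi>. J \<subseteq> {..<k} \<Longrightarrow> Sg \<subseteq> {..<k} \<Longrightarrow> Tt \<subseteq> {..<k} \<Longrightarrow>
     C0 \<subseteq> {..<k} \<times> {..<k} \<Longrightarrow> C1 \<subseteq> {..<k} \<times> {..<k} \<Longrightarrow> conforms J Sg Tt C0 C1 \<phi> S A \<Longrightarrow> \<not> Q S A \<Longrightarrow>
     \<exists>S A \<phi>. card S \<le> m \<and> conforms J Sg Tt C0 C1 \<phi> S A \<and> \<not> Q S A"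
    and c0: "0 < c0" "c0 \<le> 1" and \<tau>: "0 < \<tau>"
    and hom: "\<And>\<nu>. (\<And>v. 0 \<le> \<nu> v) \<Longrightarrow> sum \<nu> V = 1 \<Longrightarrow> (\<And>v. v \<in> V \<Longrightarrow> \<nu> v \<le> \<tau>) \<Longrightarrow>
       \<exists>t. \<forall>S :: 'a set. finite S \<longrightarrow> card S \<le> m \<longrightarrow> c0 \<le> expect V S (\<lambda>_. \<nu>) (\<lambda>x. of_bool (homog a t S x))"
    and q: "q ` V \<subseteq> {..<k}" and r: "r ` V \<subseteq> {..<K}" and ref: "refines r q"
    and irr: "irr_mass r \<eta> \<le> \<eta>" and \<eta>: "0 < \<eta>" "\<eta> \<le> \<epsilon> ^ 3 / 8000 / (real k)\<^sup>2"
    and en: "energy r - energy q \<le> \<epsilon> ^ 3 / 8000"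
    and \<omega>: "\<omega> = \<epsilon> / 10 / (8 * real K * real k)"
    and atoms: "mass {x\<in>V. \<tau> * \<omega> \<le> \<mu> x \<and> cell q (q x) \<noteq> {x}} \<le> \<epsilon> ^ 3 / 8000"
    and part: "\<And>i. mass (cell q i) \<le> \<epsilon> / 10 \<or> card (cell q i) \<le> 1"
  shows "\<omega> ^ m * ((\<epsilon> / 10) ^ (m * m) * c0 ^ m - real (m * m) * (4 * \<eta>)) \<le> sample_prob V \<mu> (\<lambda>X. \<not> Q X a) m {}
    \<or> close_to \<epsilon> Q"
proof -
  \<comment> \<open>The budget: changes on the kept vertices cost 4\<zeta>, and the discarded weight
    is at most \<zeta> + 8\<delta> and counts twice. The sum stays below \<epsilon>.\<close>
  define \<zeta> where "\<zeta> = \<epsilon> / 10"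
  \<comment> \<open>This is \<zeta>^3/8, so that the two terms of the representative cost, each at
    most 4\<delta>/\<zeta>^2, add up to at most \<zeta>.\<close>
  define \<delta> where "\<delta> = \<epsilon> ^ 3 / 8000"
  define N where "N = {x\<in>V. \<tau> * \<omega> \<le> \<mu> x \<and> cell q (q x) \<noteq> {x}}"
  define J where "J = major q N \<zeta> k"
  have \<zeta>: "0 < \<zeta>" "\<zeta> < 1" using \<epsilon> by (auto simp: \<zeta>_def)
  have \<delta>\<epsilon>: "\<delta> \<le> \<epsilon> / 8000" unfolding \<delta>_def using \<epsilon> power_decreasing[of 1 3 \<epsilon>] by simp
  have \<rho>: "4 * (real k)\<^sup>2 / \<zeta>\<^sup>2 * \<eta> + 4 / \<zeta>\<^sup>2 * \<delta> \<le> \<zeta>"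
  proof -
    have "4 * (real k)\<^sup>2 / \<zeta>\<^sup>2 * \<eta> \<le> 4 * (real k)\<^sup>2 / \<zeta>\<^sup>2 * (\<delta> / (real k)\<^sup>2)"
      using \<eta> by (intro mult_left_mono) (auto simp: \<delta>_def)
    also have "\<dots> = 4 / \<zeta>\<^sup>2 * \<delta>" using k by simp
    finally have "4 * (real k)\<^sup>2 / \<zeta>\<^sup>2 * \<eta> + 4 / \<zeta>\<^sup>2 * \<delta> \<le> 8 * (\<delta> / \<zeta>\<^sup>2)" by simp
    also have "\<dots> = \<zeta>" using \<epsilon> by (simp add: \<zeta>_def \<delta>_def power2_eq_square power3_eq_cube)
    finally show ?thesis .
  qed
  obtain y where y: "\<And>i. i \<in> J \<Longrightarrow> y i \<in> good q r N K i"
    and reg: "\<And>i j. i \<in> J \<Longrightarrow> j \<in> J \<Longrightarrow> i \<noteq> j \<Longrightarrow> \<not> irregular r \<eta> (r (y i)) (r (y j))"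
    and bad: "(\<Sum>i\<in>J. \<Sum>j\<in>J - {i}. mass (cell q i) * mass (cell q j) *
        of_bool (\<zeta> < \<bar>dens r (r (y i)) (r (y j)) - dens q i j\<bar>)) \<le> \<zeta>"
    by (rule choose_representatives[OF ref q r K irr en[folded \<delta>_def] \<zeta>(1) \<zeta>(1) \<rho> \<zeta>(2), where N = N, folded J_def]) blast
  define W where "W i = cell r (r (y i))" for i
  \<comment> \<open>Copies are sought outside \<open>N\<close>, since heavy vertices sharing a class
    with others would cause collisions.\<close>
  define U where "U i = W i - N" for i
  define d where "d i j = dens r (r (y i)) (r (y j))" for i j
  have finJ: "finite J" and Jk: "J \<subseteq> {..<k}" by (auto simp: J_def major_def)
  have \<omega>pos: "0 < \<omega>" using \<epsilon> k K by (simp add: \<omega>)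
  have \<omega>1: "\<omega> \<le> 1"
  proof -
    have "1 * 1 \<le> real K * real k" using k K by (intro mult_mono) auto
    then have "1 \<le> 8 * real K * real k" by linarith
    then show ?thesis unfolding \<omega> using \<epsilon> by (simp add: divide_le_eq_1)
  qed
  have yV: "y i \<in> V" "q (y i) = i" if "i \<in> J" for i
    using y[OF that] by (auto simp: good_def cell_def)
  have Wq: "W i \<subseteq> cell q i" if "i \<in> J" for i
    using cell_refines[OF ref yV(1)[OF that]] yV(2)[OF that] by (simp add: W_def)
  have UW: "mass (W i) \<le> 2 * mass (U i)" if "i \<in> J" for i
  proof -
    have "mass (W i) = mass (W i \<inter> N) + mass (U i)"
      unfolding U_def by (rule sum.Int_Diff) (simp add: W_def)
    moreover have "mass (W i \<inter> N) \<le> mass (W i) / 2" using y[OF that] by (simp add: good_def W_def)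
    ultimately show ?thesis by linarith
  qed
  \<comment> \<open>A kept class weighs at least \<zeta>/k, a good fine class in it at least 1/(4K)
    of that, and at least half of the fine class remains outside \<open>N\<close>; hence the 8 in
    \<open>\<omega>\<close>.\<close>
  have U\<omega>: "\<omega> \<le> mass (U i)" if "i \<in> J" for i
  proof -
    have "\<omega> = \<zeta> / real k / (8 * real K)" by (simp add: \<omega> \<zeta>_def mult_ac)
    also have "\<dots> \<le> mass (cell q i) / (8 * real K)"
      using that K by (intro divide_right_mono) (auto simp: J_def major_def)
    also have "\<dots> = mass (cell q i) / (4 * real K) / 2" by simp
    also have "\<dots> \<le> mass (W i) / 2" using y[OF that] by (simp add: good_def W_def)
    finally show ?thesis using UW[OF that] by linarith
  qed
  define Sg where "Sg = {i\<in>J. card (cell q i) \<le> 1}"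
  have "\<exists>t. \<forall>T :: 'a set. finite T \<longrightarrow> card T \<le> m \<longrightarrow> (i \<in> Sg \<longrightarrow> card T \<le> 1) \<longrightarrow>
     c0 \<le> expect V T (\<lambda>_. rel_weight (U i)) (\<lambda>x. of_bool (homog a t T x))" if i: "i \<in> J" for i
  proof -
    have UV: "U i \<subseteq> V" using Wq[OF i] cell_subset U_def by blast
    have Upos: "0 < mass (U i)" using U\<omega>[OF i] \<omega>pos by linarith
    have tot: "sum (rel_weight (U i)) V = 1" by (rule rel_weight_total[OF UV Upos])
    show ?thesis
    proof (cases "i \<in> Sg")
      \<comment> \<open>A one-vertex class takes at most one vertex of a forbidden graph, and tuples
        of length at most 1 are homogeneous of either kind.\<close>
      case True
      have "c0 \<le> expect V T (\<lambda>_. rel_weight (U i)) (\<lambda>x. of_bool (homog a True T x))"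
        if T: "finite T" "card T \<le> 1" for T :: "'a set"
      proof -
        have "s = t" if "s \<in> T" "t \<in> T" for s t
          using that T card_le_Suc0_iff_eq[OF T(1)] by simp
        then have "homog a True T x" for x unfolding homog_def inj_on_def by blast
        then have "expect V T (\<lambda>_. rel_weight (U i)) (\<lambda>x. of_bool (homog a True T x)) = expect V T (\<lambda>_. rel_weight (U i)) (\<lambda>x. 1)"
          by simp
        also have "\<dots> = 1" using tot by (intro expect_one T) auto
        finally show ?thesis using c0 by simp
      qed
      then show ?thesis using True by blast
    next
      case False
      have "rel_weight (U i) v \<le> \<tau>" for v
      proof (cases "v \<in> U i")
        case True
        then have v: "v \<in> V" "q v = i" "v \<notin> N" using Wq[OF i] by (auto simp: U_def cell_def)
        \<comment> \<open>Outside \<open>N\<close> and not alone in its class, \<open>v\<close>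
          weighs less than \<open>\<tau> * \<omega>\<close>. Relative to \<open>U i\<close>, whose
          weight is at least \<open>\<omega>\<close>, this is below the Ramsey threshold
          \<open>\<tau>\<close>.\<close>
        have "cell q i \<noteq> {v}" using False i by (auto simp: Sg_def)
        then have "\<mu> v < \<tau> * \<omega>" using v by (auto simp: N_def)
        also have "\<dots> \<le> \<tau> * mass (U i)" using \<tau> U\<omega>[OF i] by (intro mult_left_mono) auto
        finally show ?thesis using True Upos by (simp add: rel_weight_def pos_divide_le_eq)
      next
        case nU: False
        then show ?thesis using \<tau> by (simp add: rel_weight_def)
      qed
      then obtain t where "\<forall>S :: 'a set. finite S \<longrightarrow> card S \<le> m \<longrightarrow>
          c0 \<le> expect V S (\<lambda>_. rel_weight (U i)) (\<lambda>x. of_bool (homog a t S x))"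
        using hom[OF rel_weight_nonneg tot] by blast
      then show ?thesis by blast
    qed
  qed
  then obtain t where t: "\<And>i (T :: 'a set). i \<in> J \<Longrightarrow> finite T \<Longrightarrow> card T \<le> m \<Longrightarrow> (i \<in> Sg \<Longrightarrow> card T \<le> 1) \<Longrightarrow>
     c0 \<le> expect V T (\<lambda>_. rel_weight (U i)) (\<lambda>x. of_bool (homog a (t i) T x))"
    by metis
  define Tt where "Tt = {i\<in>J. t i}"
  define X where "X = {x\<in>V. q x \<in> J}"
  define b where "b = modified q Tt d \<zeta>"
  show ?thesis
  proof (cases "Q X b")
    case True
    have "(\<Sum>x\<in>X. \<Sum>y\<in>X. \<mu> x * \<mu> y * of_bool (x \<noteq> y \<and> b x y \<noteq> a x y)) \<le> \<zeta> + \<zeta> + (\<zeta> + \<zeta>)"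
      unfolding X_def b_def
      using \<zeta> part bad by (intro modified_close finJ) (auto simp: d_def \<zeta>_def)
    moreover have "mass (V - X) \<le> \<zeta> + 8 * \<delta>"
    proof -
      have "V - X = {x\<in>V. q x \<notin> J}" by (auto simp: X_def)
      moreover have "mass {x\<in>V. q x \<notin> J} \<le> \<zeta> + 8 * mass N"
        unfolding J_def by (rule mass_minor[OF q _ \<zeta>(1)]) (auto simp: N_def)
      ultimately show ?thesis using atoms by (simp add: N_def \<delta>_def)
    qed
    ultimately have "(\<Sum>x\<in>X. \<Sum>y\<in>X. \<mu> x * \<mu> y * of_bool (x \<noteq> y \<and> b x y \<noteq> a x y)) + 2 * mass (V - X) \<le> \<epsilon>"
      using \<delta>\<epsilon> \<epsilon> by (simp add: \<zeta>_def)
    then show ?thesis unfolding close_to_def using True by (intro disjI2 exI[of _ X] exI[of _ b]) (auto simp: X_def)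
  next
    case False
    let ?C0 = "{(i, j) \<in> J \<times> J. d i j < \<zeta>}" and ?C1 = "{(i, j) \<in> J \<times> J. 1 - \<zeta> < d i j}"
    have dsym: "d i j = d j i" for i j unfolding d_def by (rule dens_sym)
    have bsym: "b x y = b y x" for x y
      unfolding b_def modified_def using dsym adj_sym by simp
    have "conforms J Sg Tt ?C0 ?C1 q X b"
      unfolding conforms_def
    proof (intro conjI ballI impI)
      show "finite X" "q ` X \<subseteq> J" by (auto simp: X_def)
      fix x y assume xy: "x \<in> X" "y \<in> X" "x \<noteq> y"
      show "b x y = b y x" by (rule bsym)
      {
        assume e: "q x = q y"
        have "{x, y} \<subseteq> cell q (q x)" using xy e by (auto simp: X_def cell_def)
        then have "card {x, y} \<le> card (cell q (q x))" by (intro card_mono) auto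
        then show "q x \<notin> Sg" using xy(3) by (auto simp: Sg_def)
        show "b x y = (q x \<in> Tt)" using e by (simp add: b_def modified_def)
      next
        assume ne: "q x \<noteq> q y"
        show "\<not> b x y" if "(q x, q y) \<in> ?C0" using ne that by (simp add: b_def modified_def)
        \<comment> \<open>The test for density near 0 comes before the one for density near 1 in
          \<open>modified\<close>; they exclude each other because \<zeta> is at most 1/10.\<close>
        show "b x y" if "(q x, q y) \<in> ?C1"
          using ne that \<epsilon> by (auto simp: b_def modified_def \<zeta>_def)
      }
    qed
    \<comment> \<open>The modified graph is itself a conforming graph outside \<open>Q\<close>, of
      unbounded size; \<open>wit\<close> replaces it by a bounded one.\<close>
    then have "\<exists>S A \<phi>. card S \<le> m \<and> conforms J Sg Tt ?C0 ?C1 \<phi> (S :: 'a set) A \<and> \<not> Q S A"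
      using Jk False by (intro wit[where \<phi> = q and S = X and A = b]) (auto simp: Sg_def Tt_def)
    then obtain S :: "'a set" and A \<phi> where S: "card S \<le> m" "conforms J Sg Tt ?C0 ?C1 \<phi> S A" "\<not> Q S A"
      by blast
    have "\<omega> ^ m * (\<zeta> ^ (m * m) * c0 ^ m - real (m * m) * (4 * \<eta>)) \<le> sample_prob V \<mu> (\<lambda>X. \<not> Q X a) m {}"
    proof (rule forbidden_density[OF Q _ _ \<omega>pos \<omega>1 _ _ _ c0 _ _ _ S(2,1,3)])
      show "U i \<subseteq> cell q i" if "i \<in> J" for i using Wq[OF that] by (auto simp: U_def)
      show "\<omega> \<le> mass (U i)" if "i \<in> J" for i by (rule U\<omega>[OF that])
      show "\<bar>cut (d i j) X' Y'\<bar> \<le> 4 * \<eta> * (mass (U i) * mass (U j))"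
        if "i \<in> J" "j \<in> J" "i \<noteq> j" "X' \<subseteq> U i" "Y' \<subseteq> U j" for i j X' Y'
      proof -
        \<comment> \<open>Regularity is relative to the full fine classes \<open>W\<close>, which
          weigh at most twice as much as \<open>U\<close>; hence the factor 4.\<close>
        have "\<bar>cut (d i j) X' Y'\<bar> \<le> \<eta> * (mass (W i) * mass (W j))"
          using reg[OF that(1-3)] that(4,5) unfolding irregular_def d_def W_def U_def
          by (meson Diff_subset not_le order_trans)
        also have "\<dots> \<le> \<eta> * ((2 * mass (U i)) * (2 * mass (U j)))"
          using \<eta> UW[OF that(1)] UW[OF that(2)] by (intro mult_left_mono mult_mono) auto
        finally show ?thesis by (simp add: mult_ac)
      qed
      show "0 \<le> d i j \<and> d i j \<le> 1" for i j by (simp add: d_def dens_nonneg dens_le_1)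
      show "c0 \<le> expect V T (\<lambda>_. rel_weight (U i)) (\<lambda>x. of_bool (homog a (i \<in> Tt) T x))"
        if "i \<in> J" "finite T" "card T \<le> m" "i \<in> Sg \<Longrightarrow> card T \<le> 1" for i and T :: "'a set"
      proof -
        have "(i \<in> Tt) = t i" using that(1) by (simp add: Tt_def)
        then show ?thesis using t[OF that] by simp
      qed
    qed (use \<zeta> \<eta> in auto)
    then show ?thesis by (simp add: \<zeta>_def)
  qed
qed

end

section \<open>Iterated refinement\<close>

context wgraph
begin

text \<open>A heavy vertex cannot be divided, so singletons may exceed the bound; no pair inside
  them has to be changed.\<close>

definition fine_cells :: "real \<Rightarrow> ('a \<Rightarrow> nat) \<Rightarrow> bool" where
  "fine_cells \<epsilon> q \<longleftrightarrow> (\<forall>i. mass (cell q i) \<le> \<epsilon> \<or> card (cell q i) \<le> 1)"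

lemma fine_cells_refines:
  assumes "refines r q" "fine_cells \<epsilon> q" "0 \<le> \<epsilon>"
  shows "fine_cells \<epsilon> r"
  unfolding fine_cells_def
proof
  fix i
  show "mass (cell r i) \<le> \<epsilon> \<or> card (cell r i) \<le> 1"
  proof (cases "cell r i = {}")
    case False
    then obtain x where x: "x \<in> V" "r x = i" by (auto simp: cell_def)
    have sub: "cell r i \<subseteq> cell q (q x)" using cell_refines[OF assms(1) x(1)] x(2) by simp
    have "mass (cell r i) \<le> mass (cell q (q x))" by (intro mass_mono sub cell_subset)
    moreover have "card (cell r i) \<le> card (cell q (q x))" by (intro card_mono sub) simp
    ultimately show ?thesis using assms(2) unfolding fine_cells_def by (meson order_trans)
  qed (use assms(3) in auto)
qed

text \<open>In a partition with the least number of classes no two classes can be merged.\<close>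

lemma initial_partition:
  assumes \<epsilon>: "0 < \<epsilon>"
  obtains q where "fine_cells \<epsilon> q" "q ` V \<subseteq> {..<nat \<lceil>2 / \<epsilon>\<rceil> + 1}"
proof -
  obtain f :: "'a \<Rightarrow> nat" where "f ` V \<subseteq> {..<card V}"
    and f: "\<And>x y. x \<in> V \<Longrightarrow> y \<in> V \<Longrightarrow> f x = f y \<longleftrightarrow> id x = id y"
    by (rule encode_partition[of id V V "card V"]) auto
  have "card (cell f i) \<le> 1" for i
    unfolding One_nat_def using f by (subst card_le_Suc0_iff_eq) (auto simp: cell_def)
  \<comment> \<open>The discrete partition shows that a partition of this kind exists at
    all.\<close>
  then have "fine_cells \<epsilon> f" by (simp add: fine_cells_def)
  then obtain p where p: "fine_cells \<epsilon> p" and least: "\<And>p'. fine_cells \<epsilon> p' \<Longrightarrow> card (p ` V) \<le> card (p' ` V)"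
    using ex_has_least_nat[of "fine_cells \<epsilon>" f "\<lambda>p. card (p ` V)"] by blast
  define L where "L = {i \<in> p ` V. mass (cell p i) \<le> \<epsilon> / 2}"
  have finL: "finite L" by (simp add: L_def)
  have "i = j" if ij: "i \<in> L" "j \<in> L" for i j
  proof (rule ccontr)
    assume ne: "i \<noteq> j"
    define p' where "p' x = (if p x = j then i else p x)" for x
    have cells: "cell p' i = cell p i \<union> cell p j" "cell p' j = {}"
      "\<And>l. l \<noteq> i \<Longrightarrow> l \<noteq> j \<Longrightarrow> cell p' l = cell p l"
      using ne by (auto simp: cell_def p'_def)
    have "cell p i \<inter> cell p j = {}" using ne by (auto simp: cell_def)
    then have "mass (cell p' i) = mass (cell p i) + mass (cell p j)"
      unfolding cells by (intro sum.union_disjoint) auto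
    also have "\<dots> \<le> \<epsilon>" using ij by (simp add: L_def)
    finally have "mass (cell p' i) \<le> \<epsilon>" .
    then have "fine_cells \<epsilon> p'"
      using p cells(2,3) unfolding fine_cells_def by (metis card.empty zero_le_one)
    then have "card (p ` V) \<le> card (p' ` V)" by (rule least)
    also have "p' ` V \<subseteq> p ` V - {j}"
      using ij ne by (auto simp: p'_def L_def)
    then have "card (p' ` V) \<le> card (p ` V - {j})" by (intro card_mono) auto
    also have "\<dots> < card (p ` V)" using ij by (intro card_Diff1_less) (auto simp: L_def)
    finally show False by simp
  qed
  \<comment> \<open>Besides this one light class, every class weighs more than \<epsilon>/2, so
    there are at most 2/\<epsilon> others.\<close>
  then have L1: "card L \<le> 1"
    unfolding One_nat_def using finL by (subst card_le_Suc0_iff_eq) auto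
  have "real (card (p ` V - L)) * (\<epsilon> / 2) = (\<Sum>i\<in>p ` V - L. \<epsilon> / 2)" by simp
  also have "\<dots> \<le> (\<Sum>i\<in>p ` V - L. mass (cell p i))"
    by (intro sum_mono) (auto simp: L_def)
  also have "\<dots> \<le> 1" by (rule sum_mass_cells) simp
  finally have "real (card (p ` V - L)) \<le> 2 / \<epsilon>" using \<epsilon> by (simp add: field_simps)
  then have "card (p ` V - L) \<le> nat \<lceil>2 / \<epsilon>\<rceil>" by linarith
  moreover have "card (p ` V) = card (p ` V - L) + card L"
    using finL by (subst card_Diff_subset) (auto simp: L_def intro!: le_add_diff_inverse2[symmetric] card_mono)
  ultimately have c: "card (p ` V) \<le> nat \<lceil>2 / \<epsilon>\<rceil> + 1" using L1 by linarith
  obtain q :: "'a \<Rightarrow> nat" where q: "q ` V \<subseteq> {..<nat \<lceil>2 / \<epsilon>\<rceil> + 1}"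
    "\<And>x y. x \<in> V \<Longrightarrow> y \<in> V \<Longrightarrow> q x = q y \<longleftrightarrow> p x = p y"
    using encode_partition[OF order_refl _ c] by blast
  have "refines q p" using q(2) by (auto simp: refines_def)
  then have "fine_cells \<epsilon> q" using fine_cells_refines p \<epsilon> by auto
  then show thesis using that q(1) by blast
qed

end

text \<open>All constants of a round are fixed here, from \<open>k\<close>,
  \<open>\<epsilon>\<close> and \<open>Q\<close> alone: \<open>m\<close> from the reduced graphs on
  \<open>k\<close> labels, \<open>c0\<close> and \<open>\<tau>\<close> from \<open>m\<close>, after
  that \<open>\<eta>\<close>, \<open>K\<close>, \<open>\<omega>\<close> and \<open>\<theta>\<close>.
  The graph enters only afterwards.\<close>

lemma level:
  fixes Q :: "'a set \<Rightarrow> ('a \<Rightarrow> 'a \<Rightarrow> bool) \<Rightarrow> bool"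
  assumes Q: "induced_closed Q" and \<epsilon>: "0 < \<epsilon>" "\<epsilon> \<le> 1" and k: "0 < k"
  obtains c m K' where "0 < c" "0 < K'"
    "\<And>V \<mu> a q. wgraph V \<mu> a \<Longrightarrow> q ` V \<subseteq> {..<k} \<Longrightarrow> wgraph.fine_cells V \<mu> (\<epsilon> / 10) q \<Longrightarrow>
      c \<le> sample_prob V \<mu> (\<lambda>X. \<not> Q X a) m {} \<or> wgraph.close_to V \<mu> a \<epsilon> Q \<or>
      (\<exists>r. wgraph.refines V r q \<and> r ` V \<subseteq> {..<K'} \<and>
         wgraph.potential V \<mu> a q + \<epsilon> ^ 3 / 8000 < wgraph.potential V \<mu> a r)"
proof -
  obtain m where wit: "\<And>J Sg Tt C0 C1 (S :: 'a set) A \<phi>. J \<subseteq> {..<k} \<Longrightarrow> Sg \<subseteq> {..<k} \<Longrightarrow> Tt \<subseteq> {..<k} \<Longrightarrow>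
     C0 \<subseteq> {..<k} \<times> {..<k} \<Longrightarrow> C1 \<subseteq> {..<k} \<times> {..<k} \<Longrightarrow> conforms J Sg Tt C0 C1 \<phi> S A \<Longrightarrow> \<not> Q S A \<Longrightarrow>
     \<exists>S A \<phi>. card S \<le> m \<and> conforms J Sg Tt C0 C1 \<phi> S A \<and> \<not> Q S A"
    by (rule bounded_witness[of k Q]) (rule that; blast)
  obtain c0 \<tau> :: real where c0: "0 < c0" "c0 \<le> 1" and \<tau>: "0 < \<tau>" and
    hom: "\<And>(V :: 'a set) a \<nu>. finite V \<Longrightarrow> (\<And>u v. a u v \<longleftrightarrow> a v u) \<Longrightarrow> (\<And>v. 0 \<le> \<nu> v) \<Longrightarrow> sum \<nu> V = 1 \<Longrightarrow>
       (\<And>v. v \<in> V \<Longrightarrow> \<nu> v \<le> \<tau>) \<Longrightarrow>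
       \<exists>t. \<forall>S :: 'a set. finite S \<longrightarrow> card S \<le> m \<longrightarrow> c0 \<le> expect V S (\<lambda>_. \<nu>) (\<lambda>x. of_bool (homog a t S x))"
    using homogeneous_density[where m = m and 'v = 'a and 's = 'a] by metis
  define B where "B = (\<epsilon> / 10) ^ (m * m) * c0 ^ m"
  \<comment> \<open>The first bound makes irregular pairs cheap relative to the \<open>k\<close>
    coarse classes. The second keeps the counting error, including the factor 4, at half of the main
    term \<open>B\<close>.\<close>
  define \<eta> where "\<eta> = min (\<epsilon> ^ 3 / 8000 / (real k)\<^sup>2) (B / (8 * (real (m * m) + 1)))"
  have B: "0 < B" using \<epsilon> c0 by (simp add: B_def)
  have mm: "0 < 8 * (real (m * m) + 1)" by (intro mult_pos_pos add_nonneg_pos) auto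
  have \<eta>: "0 < \<eta>" "\<eta> \<le> \<epsilon> ^ 3 / 8000 / (real k)\<^sup>2"
    using \<epsilon> k B mm by (auto simp: \<eta>_def)
  have \<eta>2: "real (m * m) * (4 * \<eta>) \<le> B / 2"
  proof -
    have "8 * (real (m * m) + 1) * \<eta> \<le> B"
      using mm unfolding \<eta>_def by (simp add: min_def pos_le_divide_eq mult.commute)
    then show ?thesis using \<eta> by (simp add: algebra_simps)
  qed
  obtain K0 where K0: "\<And>(V :: 'a set) \<mu> a q. wgraph V \<mu> a \<Longrightarrow> q ` V \<subseteq> {..<k} \<Longrightarrow>
    \<exists>r. wgraph.refines V r q \<and> r ` V \<subseteq> {..<K0} \<and> wgraph.irr_mass V \<mu> a r \<eta> \<le> \<eta>"
    using regularity[OF \<eta>(1), of k] by metis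
  define K where "K = Suc K0"
  define \<omega> where "\<omega> = \<epsilon> / 10 / (8 * real K * real k)"
  have \<omega>: "0 < \<omega>" using \<epsilon> k by (simp add: \<omega>_def K_def)
  define \<theta> where "\<theta> = \<tau> * \<omega>"
  have \<theta>: "0 < \<theta>" using \<tau> \<omega> by (simp add: \<theta>_def)
  show thesis
  proof (rule that)
    show "0 < \<omega> ^ m * (B / 2)" using \<omega> B by simp
    show "0 < K + nat \<lceil>1 / \<theta>\<rceil>" by (simp add: K_def)
    fix V :: "'a set" and \<mu> a and q :: "'a \<Rightarrow> nat"
    assume w: "wgraph V \<mu> a" and q: "q ` V \<subseteq> {..<k}" and fine_cells: "wgraph.fine_cells V \<mu> (\<epsilon> / 10) q"
    interpret wgraph V \<mu> a by (rule w)
    obtain r where r0: "refines r q" "r ` V \<subseteq> {..<K0}" "irr_mass r \<eta> \<le> \<eta>"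
      using K0[OF w q] by blast
    have r: "r ` V \<subseteq> {..<K}" using r0(2) by (force simp: K_def)
    obtain r' where r': "refines r' r" "r' ` V \<subseteq> {..<K + nat \<lceil>1 / \<theta>\<rceil>}"
      "\<And>x. x \<in> V \<Longrightarrow> \<theta> \<le> \<mu> x \<Longrightarrow> cell r' (r' x) = {x}"
      by (rule separate_atoms[OF r \<theta>]) blast
    let ?N = "{x\<in>V. \<theta> \<le> \<mu> x \<and> cell q (q x) \<noteq> {x}}"
    have pot: "energy r + singles q + mass ?N \<le> potential r'"
      by (rule potential_separate[OF r0(1) r'(1,3)])
    show "\<omega> ^ m * (B / 2) \<le> sample_prob V \<mu> (\<lambda>X. \<not> Q X a) m {} \<or> close_to \<epsilon> Q \<or>
      (\<exists>r. refines r q \<and> r ` V \<subseteq> {..<K + nat \<lceil>1 / \<theta>\<rceil>} \<and> potential q + \<epsilon> ^ 3 / 8000 < potential r)"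
    proof (cases "potential q + \<epsilon> ^ 3 / 8000 < potential r'")
      case True
      then show ?thesis using refines_trans[OF r'(1) r0(1)] r'(2) by blast
    next
      case False
      \<comment> \<open>Without a rise of the potential, both the energy gained by \<open>r\<close>
        and the weight of newly separated vertices are small. The round is completed with
        \<open>r\<close>, whose regularity is known; \<open>r'\<close> only served to measure the
        gain.\<close>
      then have le: "energy r + mass ?N \<le> energy q + \<epsilon> ^ 3 / 8000"
        using pot by (simp add: potential_def)
      have en: "energy r - energy q \<le> \<epsilon> ^ 3 / 8000" using le mass_nonneg[of ?N] by linarith
      have at: "mass {x\<in>V. \<tau> * \<omega> \<le> \<mu> x \<and> cell q (q x) \<noteq> {x}} \<le> \<epsilon> ^ 3 / 8000"
        using le energy_mono[OF r0(1)] unfolding \<theta>_def by linarith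
      have "\<omega> ^ m * (B - real (m * m) * (4 * \<eta>)) \<le> sample_prob V \<mu> (\<lambda>X. \<not> Q X a) m {} \<or> close_to \<epsilon> Q"
        unfolding B_def
      proof (rule level_step[OF Q \<epsilon> k _ wit c0 \<tau> hom q r r0(1,3) \<eta> en \<omega>_def at])
        show "0 < K" by (simp add: K_def)
        show "mass (cell q i) \<le> \<epsilon> / 10 \<or> card (cell q i) \<le> 1" for i
          using fine_cells by (simp add: fine_cells_def)
      qed (simp_all, use adj_sym in blast)
      moreover have "\<omega> ^ m * (B / 2) \<le> \<omega> ^ m * (B - real (m * m) * (4 * \<eta>))"
        using \<eta>2 \<omega> by (intro mult_left_mono) auto
      ultimately show ?thesis by linarith
    qed
  qed
qed

text \<open>\<open>t\<close> bounds the rises of the potential still possible, as it never exceeds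
  2. Each round has its own \<open>c\<close> and \<open>m\<close>; the smaller chance and the larger
  sample serve both, since a sample outside \<open>Q\<close> stays outside when it grows.\<close>

lemma level_induct:
  fixes Q :: "'a set \<Rightarrow> ('a \<Rightarrow> 'a \<Rightarrow> bool) \<Rightarrow> bool"
  assumes Q: "induced_closed Q" and \<epsilon>: "0 < \<epsilon>" "\<epsilon> \<le> 1" and "0 < k"
  shows "\<exists>c m. 0 < c \<and> (\<forall>V \<mu> a q. wgraph V \<mu> a \<longrightarrow> q ` V \<subseteq> {..<k} \<longrightarrow> wgraph.fine_cells V \<mu> (\<epsilon> / 10) q \<longrightarrow>
      2 - real t * (\<epsilon> ^ 3 / 8000) \<le> wgraph.potential V \<mu> a q \<longrightarrow>
      c \<le> sample_prob V \<mu> (\<lambda>X. \<not> Q X a) m {} \<or> wgraph.close_to V \<mu> a \<epsilon> Q)"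
  using assms(4)
proof (induction t arbitrary: k)
  case 0
  obtain c m K' where c: "0 < c" and "0 < K'" and lev: "\<And>V \<mu> a q. wgraph V \<mu> a \<Longrightarrow> q ` V \<subseteq> {..<k} \<Longrightarrow> wgraph.fine_cells V \<mu> (\<epsilon> / 10) q \<Longrightarrow>
      c \<le> sample_prob V \<mu> (\<lambda>X. \<not> Q X a) m {} \<or> wgraph.close_to V \<mu> a \<epsilon> Q \<or>
      (\<exists>r. wgraph.refines V r q \<and> r ` V \<subseteq> {..<K'} \<and>
         wgraph.potential V \<mu> a q + \<epsilon> ^ 3 / 8000 < wgraph.potential V \<mu> a r)"
    by (rule level[OF Q \<epsilon> 0]) (rule that; blast)
  show ?case
  proof (rule exI[of _ c], rule exI[of _ m], intro conjI c allI impI)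
    fix V \<mu> a and q :: "'a \<Rightarrow> nat"
    assume w: "wgraph V \<mu> a" and q: "q ` V \<subseteq> {..<k}" "wgraph.fine_cells V \<mu> (\<epsilon> / 10) q"
      and pot: "2 - real 0 * (\<epsilon> ^ 3 / 8000) \<le> wgraph.potential V \<mu> a q"
    have "0 < \<epsilon> ^ 3 / 8000" using \<epsilon> by simp
    then have "\<not> wgraph.potential V \<mu> a q + \<epsilon> ^ 3 / 8000 < wgraph.potential V \<mu> a r" for r
      using wgraph.potential_bounds(2)[OF w, of r] pot by linarith
    then show "c \<le> sample_prob V \<mu> (\<lambda>X. \<not> Q X a) m {} \<or> wgraph.close_to V \<mu> a \<epsilon> Q"
      using lev[OF w q] by blast
  qed
next
  case (Suc t)
  obtain c m K' where c: "0 < c" and K': "0 < K'" and lev: "\<And>V \<mu> a q. wgraph V \<mu> a \<Longrightarrow> q ` V \<subseteq> {..<k} \<Longrightarrow> wgraph.fine_cells V \<mu> (\<epsilon> / 10) q \<Longrightarrow>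
      c \<le> sample_prob V \<mu> (\<lambda>X. \<not> Q X a) m {} \<or> wgraph.close_to V \<mu> a \<epsilon> Q \<or>
      (\<exists>r. wgraph.refines V r q \<and> r ` V \<subseteq> {..<K'} \<and>
         wgraph.potential V \<mu> a q + \<epsilon> ^ 3 / 8000 < wgraph.potential V \<mu> a r)"
    by (rule level[OF Q \<epsilon> Suc.prems]) (rule that; blast)
  obtain c' m' where c': "0 < c'" and IH: "\<And>V \<mu> a q. wgraph V \<mu> a \<Longrightarrow> q ` V \<subseteq> {..<K'} \<Longrightarrow> wgraph.fine_cells V \<mu> (\<epsilon> / 10) q \<Longrightarrow>
      2 - real t * (\<epsilon> ^ 3 / 8000) \<le> wgraph.potential V \<mu> a q \<Longrightarrow>
      c' \<le> sample_prob V \<mu> (\<lambda>X. \<not> Q X a) m' {} \<or> wgraph.close_to V \<mu> a \<epsilon> Q"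
    using Suc.IH[OF K'] by blast
  show ?case
  proof (rule exI[of _ "min c c'"], rule exI[of _ "max m m'"], intro conjI allI impI)
    show "0 < min c c'" using c c' by simp
    fix V \<mu> a and q :: "'a \<Rightarrow> nat"
    assume w: "wgraph V \<mu> a" and q: "q ` V \<subseteq> {..<k}" "wgraph.fine_cells V \<mu> (\<epsilon> / 10) q"
      and pot: "2 - real (Suc t) * (\<epsilon> ^ 3 / 8000) \<le> wgraph.potential V \<mu> a q"
    interpret wgraph V \<mu> a by (rule w)
    have mono: "sample_prob V \<mu> (\<lambda>X. \<not> Q X a) n {} \<le> sample_prob V \<mu> (\<lambda>X. \<not> Q X a) (max m m') {}" if "n \<le> max m m'" for n
      using weight_total induced_closed_subset[OF Q] that by (intro sample_prob_mono) auto
    consider "c \<le> sample_prob V \<mu> (\<lambda>X. \<not> Q X a) m {}" | "close_to \<epsilon> Q"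
      | r where "refines r q" "r ` V \<subseteq> {..<K'}" "potential q + \<epsilon> ^ 3 / 8000 < potential r"
      using lev[OF w q] by blast
    then show "min c c' \<le> sample_prob V \<mu> (\<lambda>X. \<not> Q X a) (max m m') {} \<or> close_to \<epsilon> Q"
    proof cases
      case 1
      have "min c c' \<le> c" by (rule min.cobounded1)
      also note 1
      also have "sample_prob V \<mu> (\<lambda>X. \<not> Q X a) m {} \<le> sample_prob V \<mu> (\<lambda>X. \<not> Q X a) (max m m') {}"
        by (rule mono) simp
      finally show ?thesis by (rule disjI1)
    next
      case 3
      have f: "fine_cells (\<epsilon> / 10) r" using fine_cells_refines[OF 3(1) q(2)] \<epsilon> by simp
      have "2 - real t * (\<epsilon> ^ 3 / 8000) \<le> potential r"
        using 3(3) pot unfolding of_nat_Suc distrib_right mult_1 by linarith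
      then have "c' \<le> sample_prob V \<mu> (\<lambda>X. \<not> Q X a) m' {} \<or> close_to \<epsilon> Q" by (rule IH[OF w 3(2) f])
      moreover have "sample_prob V \<mu> (\<lambda>X. \<not> Q X a) m' {} \<le> sample_prob V \<mu> (\<lambda>X. \<not> Q X a) (max m m') {}"
        by (rule mono) simp
      ultimately show ?thesis using min.cobounded2[of c c'] by (meson order_trans)
    qed blast
  qed
qed

theorem sample_or_close:
  fixes Q :: "'a set \<Rightarrow> ('a \<Rightarrow> 'a \<Rightarrow> bool) \<Rightarrow> bool"
  assumes Q: "induced_closed Q" and \<epsilon>: "0 < \<epsilon>" "\<epsilon> \<le> 1"
  obtains c m where "0 < c"
    "\<And>V \<mu> a. wgraph V \<mu> a \<Longrightarrow> c \<le> sample_prob V \<mu> (\<lambda>X. \<not> Q X a) m {} \<or> wgraph.close_to V \<mu> a \<epsilon> Q"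
proof -
  obtain t :: nat where "2 / (\<epsilon> ^ 3 / 8000) \<le> real t" using real_arch_simple by blast
  moreover have d: "0 < \<epsilon> ^ 3 / 8000" using \<epsilon> by simp
  ultimately have "2 \<le> real t * (\<epsilon> ^ 3 / 8000)" by (simp only: pos_divide_le_eq[OF d])
  then have t: "2 - real t * (\<epsilon> ^ 3 / 8000) \<le> 0" by linarith
  define k where "k = nat \<lceil>2 / (\<epsilon> / 10)\<rceil> + 1"
  have k: "0 < k" by (simp add: k_def)
  obtain c m where c: "0 < c" and H: "\<And>V \<mu> a q. wgraph V \<mu> a \<Longrightarrow> q ` V \<subseteq> {..<k} \<Longrightarrow> wgraph.fine_cells V \<mu> (\<epsilon> / 10) q \<Longrightarrow>
      2 - real t * (\<epsilon> ^ 3 / 8000) \<le> wgraph.potential V \<mu> a q \<Longrightarrow>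
      c \<le> sample_prob V \<mu> (\<lambda>X. \<not> Q X a) m {} \<or> wgraph.close_to V \<mu> a \<epsilon> Q"
    using level_induct[OF Q \<epsilon> k, of t] by blast
  show thesis
  proof (rule that[OF c])
    fix V :: "'a set" and \<mu> a assume w: "wgraph V \<mu> a"
    interpret wgraph V \<mu> a by (rule w)
    have "0 < \<epsilon> / 10" using \<epsilon> by simp
    then obtain q where q: "fine_cells (\<epsilon> / 10) q" "q ` V \<subseteq> {..<k}"
      unfolding k_def by (rule initial_partition)
    show "c \<le> sample_prob V \<mu> (\<lambda>X. \<not> Q X a) m {} \<or> close_to \<epsilon> Q"
      using t potential_bounds(1)[of q] by (intro H[OF w q(2,1)]) linarith
  qed
qed

section \<open>Extendable graphs and the tester\<close>

text \<open>If all draws together miss \<open>B\<close>, so do the initial ones and, by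
  monotonicity, the last \<open>m\<close> on their own; the two blocks are independent.\<close>

lemma sample_prob_amplify:
  assumes nn: "\<And>v. 0 \<le> \<nu> v" and B: "\<And>X Y. B X \<Longrightarrow> X \<subseteq> Y \<Longrightarrow> B Y" and tot: "sum \<nu> V = 1"
  shows "1 - sample_prob V \<nu> B (n + m) C \<le> (1 - sample_prob V \<nu> B m {}) * (1 - sample_prob V \<nu> B n C)"
proof (induction n arbitrary: C)
  case 0
  show ?case
  proof (cases "B C")
    case True
    have "sample_prob V \<nu> B 0 C \<le> sample_prob V \<nu> B m C"
      by (rule sample_prob_mono[OF nn _ tot], erule (1) B) simp
    then have "1 \<le> sample_prob V \<nu> B m C" using True by simp
    then show ?thesis using True by simp
  next
    case False
    have "sample_prob V \<nu> B m {} \<le> sample_prob V \<nu> B m C"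
      by (rule sample_prob_mono_set[OF nn], erule (1) B) simp
    then show ?thesis using False by simp
  qed
next
  case (Suc n)
  have 1: "1 - (\<Sum>v\<in>V. \<nu> v * f v) = (\<Sum>v\<in>V. \<nu> v * (1 - f v))" for f
    using tot by (simp add: right_diff_distrib sum_subtractf)
  have "(\<Sum>v\<in>V. \<nu> v * (1 - sample_prob V \<nu> B (n + m) (insert v C))) \<le>
     (\<Sum>v\<in>V. \<nu> v * ((1 - sample_prob V \<nu> B m {}) * (1 - sample_prob V \<nu> B n (insert v C))))"
    using nn Suc.IH by (intro sum_mono mult_left_mono)
  also have "\<dots> = (1 - sample_prob V \<nu> B m {}) * (\<Sum>v\<in>V. \<nu> v * (1 - sample_prob V \<nu> B n (insert v C)))"
    by (simp add: sum_distrib_left mult_ac)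
  finally show ?case by (simp add: 1)
qed

lemma sample_prob_le_1:
  assumes nn: "\<And>v. 0 \<le> \<nu> v" and tot: "sum \<nu> V = 1"
  shows "sample_prob V \<nu> B n C \<le> 1"
proof (induction n arbitrary: C)
  case (Suc n)
  have "(\<Sum>v\<in>V. \<nu> v * sample_prob V \<nu> B n (insert v C)) \<le> (\<Sum>v\<in>V. \<nu> v * 1)"
    using nn Suc.IH by (intro sum_mono mult_left_mono)
  then show ?case using tot by simp
qed simp

lemma sample_prob_power:
  assumes nn: "\<And>v. 0 \<le> \<nu> v" and B: "\<And>X Y. B X \<Longrightarrow> X \<subseteq> Y \<Longrightarrow> B Y" and tot: "sum \<nu> V = 1"
  shows "1 - sample_prob V \<nu> B (r * m) {} \<le> (1 - sample_prob V \<nu> B m {}) ^ r"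
proof (induction r)
  case 0
  then show ?case by simp
next
  case (Suc r)
  have "1 - sample_prob V \<nu> B (r * m + m) {} \<le> (1 - sample_prob V \<nu> B m {}) * (1 - sample_prob V \<nu> B (r * m) {})"
    by (rule sample_prob_amplify[OF nn _ tot], erule (1) B)
  also have "\<dots> \<le> (1 - sample_prob V \<nu> B m {}) * (1 - sample_prob V \<nu> B m {}) ^ r"
    using Suc.IH sample_prob_le_1[OF nn tot, of B m "{}"] by (intro mult_left_mono) auto
  finally show ?case by (simp add: add.commute)
qed

text \<open>This connects the list of samples drawn by a tester with the recursive
  \<open>sample_prob\<close>; \<open>C\<close> stands for the samples already drawn.\<close>

lemma pmf_sample:
  assumes "finite V" "set_pmf D \<subseteq> V"
  shows "pmf (map_pmf (\<lambda>ys. B (set ys \<union> C)) (replicate_pmf n D)) False = sample_prob V (pmf D) (\<lambda>X. \<not> B X) n C"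
proof (induction n arbitrary: C)
  case 0
  then show ?case by (simp add: pmf_return)
next
  case (Suc n)
  have eq: "map_pmf (\<lambda>ys. B (set ys \<union> C)) (replicate_pmf (Suc n) D) =
     bind_pmf D (\<lambda>v. map_pmf (\<lambda>ys. B (set ys \<union> insert v C)) (replicate_pmf n D))"
    by (simp add: map_bind_pmf map_pmf_def bind_assoc_pmf bind_return_pmf)
  have "pmf (map_pmf (\<lambda>ys. B (set ys \<union> C)) (replicate_pmf (Suc n) D)) False =
     (\<Sum>v\<in>V. pmf D v * pmf (map_pmf (\<lambda>ys. B (set ys \<union> insert v C)) (replicate_pmf n D)) False)"
    unfolding eq pmf_bind using assms by (subst integral_measure_pmf[of V]) auto
  then show ?case unfolding Suc.IH by simp
qed

section \<open>Extendability and completion to a member\<close>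

definition embeds :: "'b set \<Rightarrow> ('b \<Rightarrow> 'b \<Rightarrow> bool) \<Rightarrow> 'a ugraph \<Rightarrow> bool" where
  "embeds X a G \<longleftrightarrow> (\<exists>f. inj_on f X \<and> f ` X \<subseteq> verts G \<and>
     (\<forall>x\<in>X. \<forall>y\<in>X. x \<noteq> y \<longrightarrow> (a x y \<longleftrightarrow> {f x, f y} \<in> edges G)))"

text \<open>The graphs contained in arbitrarily large members of \<open>P\<close>. On inputs with many vertices the
  tester may replace \<open>P\<close> by this smaller property, all of whose members extend.\<close>

definition extendable_part :: "'a ugraph set \<Rightarrow> 'b set \<Rightarrow> ('b \<Rightarrow> 'b \<Rightarrow> bool) \<Rightarrow> bool" where
  "extendable_part P X a \<longleftrightarrow> (\<forall>N. \<exists>G\<in>P. N \<le> card (verts G) \<and> embeds X a G)"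

lemma embedsE:
  assumes "embeds X a G"
  obtains f where "inj_on f X" "f ` X \<subseteq> verts G"
    "\<And>x y. x \<in> X \<Longrightarrow> y \<in> X \<Longrightarrow> x \<noteq> y \<Longrightarrow> a x y \<longleftrightarrow> {f x, f y} \<in> edges G"
proof -
  from assms[unfolded embeds_def]
  obtain f where f: "inj_on f X \<and> f ` X \<subseteq> verts G \<and>
     (\<forall>x\<in>X. \<forall>y\<in>X. x \<noteq> y \<longrightarrow> (a x y \<longleftrightarrow> {f x, f y} \<in> edges G))" by (rule exE)
  show thesis
    by (rule that[OF f[THEN conjunct1] f[THEN conjunct2, THEN conjunct1]])
      (rule f[THEN conjunct2, THEN conjunct2, rule_format])
qed

lemma embeds_pullback:
  assumes "embeds X a G" "inj_on g Y" "g ` Y \<subseteq> X"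
    "\<And>y z. y \<in> Y \<Longrightarrow> z \<in> Y \<Longrightarrow> y \<noteq> z \<Longrightarrow> b y z = a (g y) (g z)"
  shows "embeds Y b G"
proof -
  obtain f where f: "inj_on f X" "f ` X \<subseteq> verts G"
    "\<And>x y. x \<in> X \<Longrightarrow> y \<in> X \<Longrightarrow> x \<noteq> y \<Longrightarrow> (a x y \<longleftrightarrow> {f x, f y} \<in> edges G)"
    by (rule embedsE[OF assms(1)]) (rule that; assumption)
  have inj: "inj_on (f \<circ> g) Y"
    by (rule comp_inj_on[OF assms(2) inj_on_subset[OF f(1) assms(3)]])
  have "b y z \<longleftrightarrow> {(f \<circ> g) y, (f \<circ> g) z} \<in> edges G" if "y \<in> Y" "z \<in> Y" "y \<noteq> z" for y z
  proof -
    have "g y \<noteq> g z" using that assms(2) by (auto simp: inj_on_def)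
    moreover have "g y \<in> X" "g z \<in> X" using that assms(3) by auto
    ultimately show ?thesis using f(3)[of "g y" "g z"] assms(4)[OF that] by simp
  qed
  moreover have "(f \<circ> g) ` Y \<subseteq> verts G" using f(2) assms(3) by fastforce
  ultimately show ?thesis unfolding embeds_def using inj by (intro exI[of _ "f \<circ> g"]) simp
qed

lemma extendable_part_pullback:
  assumes "extendable_part P X a" "inj_on g Y" "g ` Y \<subseteq> X"
    "\<And>y z. y \<in> Y \<Longrightarrow> z \<in> Y \<Longrightarrow> y \<noteq> z \<Longrightarrow> b y z = a (g y) (g z)"
  shows "extendable_part P Y b"
  unfolding extendable_part_def
proof
  fix N
  obtain G where G: "G \<in> P" "N \<le> card (verts G)" "embeds X a G"
    using assms(1) unfolding extendable_part_def by blast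
  have "embeds Y b G" by (rule embeds_pullback[OF G(3) assms(2,3)]) (rule assms(4))
  then show "\<exists>G\<in>P. N \<le> card (verts G) \<and> embeds Y b G" using G by blast
qed

lemma induced_closed_extendable_part: "induced_closed (extendable_part P)"
  unfolding induced_closed_def by (intro allI impI) (rule extendable_part_pullback, auto)

text \<open>There are finitely many isomorphism types of graphs with at most \<open>s\<close> vertices, so
  containment in one member of \<open>P\<close> that is large enough for \<open>s\<close> suffices.\<close>

lemma extendable_part_threshold:
  fixes P :: "'a ugraph set"
  obtains M where "\<And>G X. G \<in> P \<Longrightarrow> M \<le> card (verts G) \<Longrightarrow> finite X \<Longrightarrow> X \<subseteq> verts G \<Longrightarrow> card X \<le> s \<Longrightarrow>
    extendable_part P X (\<lambda>x y. {x, y} \<in> edges G)"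
proof -
  let ?C = "{..s} \<times> Pow ({..<s} \<times> {..<s})"
  \<comment> \<open>\<open>R\<close> states that \<open>N\<close> is a size from which on no member
    contains the given labelled graph.\<close>
  define R where "R = (\<lambda>(n :: nat, E) N. \<forall>G\<in>P. N \<le> card (verts G) \<longrightarrow> \<not> embeds {..<n} (\<lambda>i j. (i, j) \<in> E) G)"
  have "finite ?C" by simp
  from finite_uniform_bound[OF this, of R]
  obtain M where M: "\<forall>c\<in>?C. (\<exists>N. R c N) \<longrightarrow> (\<exists>N\<le>M. R c N)" by (rule exE)
  show thesis
  proof (rule that[of M])
    fix G and X :: "'a set"
    assume G: "G \<in> P" "M \<le> card (verts G)" and X: "finite X" "X \<subseteq> verts G" "card X \<le> s"
    define n where "n = card X"
    obtain g where g: "bij_betw g {..<n} X"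
      using ex_bij_betw_nat_finite[OF X(1)] by (auto simp: n_def atLeast0LessThan)
    define E where "E = {(i, j) \<in> {..<n} \<times> {..<n}. {g i, g j} \<in> edges G}"
    have c: "(n, E) \<in> ?C" using X(3) by (auto simp: E_def n_def)
    have emb: "embeds {..<n} (\<lambda>i j. (i, j) \<in> E) G"
      unfolding embeds_def using g X(2)
      by (intro exI[of _ g]) (auto simp: E_def bij_betw_def)
    \<comment> \<open>Such a size up to \<open>M\<close> is refuted by \<open>G\<close> itself. By
      the choice of \<open>M\<close>, a graph without such a size up to \<open>M\<close> has none at
      all, which is extendability.\<close>
    have "\<not> (\<exists>N\<le>M. R (n, E) N)"
    proof
      assume "\<exists>N\<le>M. R (n, E) N"
      then obtain N where "N \<le> M" "R (n, E) N" by blast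
      then show False using G emb order_trans[of N M "card (verts G)"] unfolding R_def by auto
    qed
    then have "\<not> R (n, E) N" for N using M c by blast
    then have ext: "extendable_part P {..<n} (\<lambda>i j. (i, j) \<in> E)"
      unfolding extendable_part_def R_def by auto
    show "extendable_part P X (\<lambda>x y. {x, y} \<in> edges G)"
    proof (rule extendable_part_pullback[OF ext])
      let ?h = "inv_into {..<n} g"
      have h: "bij_betw ?h X {..<n}" using g by (rule bij_betw_inv_into)
      then show "inj_on ?h X" "?h ` X \<subseteq> {..<n}" by (auto simp: bij_betw_def)
      fix x y assume xy: "x \<in> X" "y \<in> X" "x \<noteq> y"
      have "g (?h x) = x" "g (?h y) = y" using xy g by (simp_all add: bij_betw_inv_into_right)
      moreover have "?h x \<in> {..<n}" "?h y \<in> {..<n}" using h xy by (auto dest: bij_betwE)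
      ultimately show "({x, y} \<in> edges G) = ((?h x, ?h y) \<in> E)" by (simp add: E_def)
    qed
  qed
qed

text \<open>Delete the vertices outside \<open>W\<close> one at a time; as \<open>W\<close> is
  nonempty, the last vertex is never deleted.\<close>

lemma hereditary_induced:
  assumes P: "hereditary_property P" and "G \<in> P" "W \<subseteq> verts G" "W \<noteq> {}"
  shows "\<lparr>verts = W, edges = {e \<in> edges G. e \<subseteq> W}\<rparr> \<in> P"
  using assms(2,3)
proof (induction "card (verts G - W)" arbitrary: G)
  case 0
  have simple: "simple_graph G" using P 0(2) by (auto simp: hereditary_property_def graph_property_def)
  then have "verts G = W" using 0 by (auto simp: simple_graph_def)
  moreover from this have "{e \<in> edges G. e \<subseteq> W} = edges G" using simple by (auto simp: simple_graph_def)
  ultimately show ?case using 0(2) by (cases G) simp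
next
  case (Suc n)
  have simple: "simple_graph G" using P Suc.prems by (auto simp: hereditary_property_def graph_property_def)
  obtain v where v: "v \<in> verts G" "v \<notin> W" using Suc(2) by (metis card.empty Diff_eq_empty_iff nat.distinct(1) subsetI)
  have H: "remove_vertex G v \<in> P"
  proof -
    have "verts G \<noteq> {v}" using v Suc.prems(2) assms(4) by auto
    then show ?thesis
      by (rule P[unfolded hereditary_property_def, THEN conjunct2, rule_format, OF Suc.prems(1) v(1)])
  qed
  have "verts G - W = insert v (verts (remove_vertex G v) - W)"
    using v by (auto simp: remove_vertex_def)
  then have "card (verts (remove_vertex G v) - W) = n"
    using Suc(2) simple by (simp add: simple_graph_def remove_vertex_def)
  moreover have "W \<subseteq> verts (remove_vertex G v)" using v Suc.prems by (auto simp: remove_vertex_def)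
  ultimately have "\<lparr>verts = W, edges = {e \<in> edges (remove_vertex G v). e \<subseteq> W}\<rparr> \<in> P"
    using Suc.hyps(1) H by blast
  moreover have "{e \<in> edges (remove_vertex G v). e \<subseteq> W} = {e \<in> edges G. e \<subseteq> W}"
    using v by (auto simp: remove_vertex_def)
  ultimately show ?case by simp
qed

text \<open>A member with at least \<open>card V\<close> vertices has room for \<open>V - X\<close>
  beside the copy of \<open>X\<close>. The induced subgraph on the image of \<open>V\<close> is
  again a member and is carried back to \<open>V\<close>.\<close>

lemma extend_to_member:
  fixes P :: "'a ugraph set"
  assumes P: "hereditary_property P" and ext: "extendable_part P X b" and X: "X \<subseteq> V" and V: "finite V" "V \<noteq> {}"
  obtains H where "H \<in> P" "verts H = V" "\<And>x y. x \<in> X \<Longrightarrow> y \<in> X \<Longrightarrow> x \<noteq> y \<Longrightarrow> {x, y} \<in> edges H \<longleftrightarrow> b x y"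
proof -
  obtain G where G: "G \<in> P" "card V \<le> card (verts G)" "embeds X b G"
    using ext unfolding extendable_part_def by blast
  have finG: "finite (verts G)" using P G(1) by (auto simp: hereditary_property_def graph_property_def simple_graph_def)
  obtain f where f: "inj_on f X" "f ` X \<subseteq> verts G"
    "\<And>x y. x \<in> X \<Longrightarrow> y \<in> X \<Longrightarrow> x \<noteq> y \<Longrightarrow> (b x y \<longleftrightarrow> {f x, f y} \<in> edges G)"
    by (rule embedsE[OF G(3)]) (rule that; assumption)
  have finX: "finite X" using X V finite_subset by blast
  have "card (V - X) \<le> card (verts G - f ` X)"
    using G(2) card_image[OF f(1)] finX X f(2) by (simp add: card_Diff_subset)
  then obtain h where h: "h ` (V - X) \<subseteq> verts G - f ` X" "inj_on h (V - X)"
    using card_le_inj[of "V - X" "verts G - f ` X"] V finG by auto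
  define k where "k x = (if x \<in> X then f x else h x)" for x
  have kX: "k x = f x" if "x \<in> X" for x using that by (simp add: k_def)
  have kinj: "inj_on k V"
  proof (rule inj_onI)
    fix x y assume xy: "x \<in> V" "y \<in> V" "k x = k y"
    show "x = y"
      using xy f(1) h unfolding k_def inj_on_def by (auto split: if_splits)
  qed
  have kV: "k ` V \<subseteq> verts G" using f(2) h(1) by (auto simp: k_def)
  define W where "W = k ` V"
  define G' where "G' = \<lparr>verts = W, edges = {e \<in> edges G. e \<subseteq> W}\<rparr>"
  have G': "G' \<in> P" unfolding G'_def W_def by (rule hereditary_induced[OF P G(1) kV]) (use V in simp)
  define g where "g = inv_into V k"
  have bij: "bij_betw g W V" unfolding g_def W_def
    by (intro bij_betw_inv_into) (simp add: bij_betw_def kinj)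
  define H where "H = \<lparr>verts = V, edges = (\<lambda>e. g ` e) ` edges G'\<rparr>"
  have "isomorphic_graphs G' H"
    unfolding isomorphic_graphs_def using bij by (intro exI[of _ g]) (simp add: H_def G'_def)
  then have HP: "H \<in> P" using P G' unfolding hereditary_property_def graph_property_def by blast
  have gk: "g (k x) = x" if "x \<in> V" for x using that kinj by (simp add: g_def)
  have edge: "{x, y} \<in> edges H \<longleftrightarrow> b x y" if xy: "x \<in> X" "y \<in> X" "x \<noteq> y" for x y
  proof -
    have V: "x \<in> V" "y \<in> V" using xy X by auto
    have "{x, y} \<in> edges H \<longleftrightarrow> {k x, k y} \<in> edges G"
    proof
      assume "{k x, k y} \<in> edges G"
      then have "{k x, k y} \<in> edges G'" using V by (simp add: G'_def W_def)
      then have "g ` {k x, k y} \<in> edges H" unfolding H_def ugraph.simps by (rule imageI)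
      then show "{x, y} \<in> edges H" using V by (simp add: gk)
    next
      assume "{x, y} \<in> edges H"
      then obtain e where e: "e \<in> edges G" "e \<subseteq> W" "{x, y} = g ` e" by (auto simp: H_def G'_def)
      have "k ` (g ` e) = e"
      proof -
        have "k (g z) = z" if "z \<in> e" for z
          using that e(2) unfolding g_def W_def by (intro f_inv_into_f) auto
        then show ?thesis by (simp add: image_image)
      qed
      then have "{k x, k y} = e" using e(3) by (metis image_empty image_insert)
      then show "{k x, k y} \<in> edges G" using e(1) by simp
    qed
    then show ?thesis using f(3)[OF xy] kX xy by simp
  qed
  show thesis by (rule that[of H]) (use HP edge in \<open>auto simp: H_def\<close>)
qed

text \<open>Passing from edges to ordered pairs of ends only increases the sum. Pairs whose first
  end is outside \<open>X\<close> weigh the mass of \<open>V - X\<close> in total, and the same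
  holds for second ends, whatever \<open>H\<close> does there.\<close>

lemma graph_dist_le:
  assumes "simple_graph G" "simple_graph H" "verts G = V" "verts H = V" "X \<subseteq> V"
    and D: "set_pmf D \<subseteq> V"
  shows "graph_dist D G H \<le> (\<Sum>x\<in>X. \<Sum>y\<in>X. pmf D x * pmf D y * of_bool (x \<noteq> y \<and> ({x, y} \<in> edges H) \<noteq> ({x, y} \<in> edges G)))
     + 2 * sum (pmf D) (V - X)"
proof -
  let ?\<mu> = "pmf D"
  have fin: "finite V" using assms by (auto simp: simple_graph_def)
  have tot: "sum ?\<mu> V = 1" using fin D by (rule sum_pmf_eq_1)
  define F where "F x y = (of_bool (x \<noteq> y \<and> ({x, y} \<in> edges H) \<noteq> ({x, y} \<in> edges G)) :: real)" for x y
  define R where "R = {(x, y) \<in> V \<times> V. x \<noteq> y \<and> ({x, y} \<in> edges H) \<noteq> ({x, y} \<in> edges G)}"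
  let ?D = "(edges G - edges H) \<union> (edges H - edges G)"
  have finR: "finite R" unfolding R_def by (rule finite_subset[of _ "V \<times> V"]) (use fin in auto)
  have sub: "?D \<subseteq> (\<lambda>(x, y). {x, y}) ` R"
  proof
    fix e assume e: "e \<in> ?D"
    then have "e \<subseteq> V" "card e = 2" using assms unfolding simple_graph_def by auto
    then obtain x y where "e = {x, y}" "x \<noteq> y" "x \<in> V" "y \<in> V" by (auto simp: card_2_iff)
    then show "e \<in> (\<lambda>(x, y). {x, y}) ` R" using e by (auto simp: R_def)
  qed
  have "graph_dist D G H \<le> (\<Sum>e\<in>(\<lambda>(x, y). {x, y}) ` R. \<Prod>x\<in>e. ?\<mu> x)"
    unfolding graph_dist_def using finR sub by (intro sum_mono2) (auto intro: prod_nonneg)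
  also have "\<dots> \<le> (\<Sum>p\<in>R. \<Prod>x\<in>(\<lambda>(x, y). {x, y}) p. ?\<mu> x)"
    using sum_image_le[OF finR, of "\<lambda>e. \<Prod>x\<in>e. ?\<mu> x" "\<lambda>(x, y). {x, y}"]
    by (simp add: o_def prod_nonneg)
  also have "\<dots> = (\<Sum>(x, y)\<in>R. ?\<mu> x * ?\<mu> y * F x y)"
    by (intro sum.cong refl) (auto simp: R_def F_def)
  also have "\<dots> \<le> (\<Sum>(x, y)\<in>V \<times> V. ?\<mu> x * ?\<mu> y * F x y)"
    using fin by (intro sum_mono2) (auto simp: R_def F_def)
  also have "\<dots> = (\<Sum>x\<in>V. \<Sum>y\<in>V. ?\<mu> x * ?\<mu> y * F x y)"
    by (simp add: sum.cartesian_product)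
  also have "\<dots> \<le> (\<Sum>x\<in>V. \<Sum>y\<in>V. ?\<mu> x * ?\<mu> y * (of_bool (x \<in> X \<and> y \<in> X) * F x y))
      + (\<Sum>x\<in>V. \<Sum>y\<in>V. ?\<mu> x * ?\<mu> y * of_bool (x \<notin> X)) + (\<Sum>x\<in>V. \<Sum>y\<in>V. ?\<mu> x * ?\<mu> y * of_bool (y \<notin> X))"
    unfolding sum.distrib[symmetric] distrib_left[symmetric]
    by (intro sum_mono mult_left_mono) (auto simp: F_def)
  also have "(\<Sum>x\<in>V. \<Sum>y\<in>V. ?\<mu> x * ?\<mu> y * (of_bool (x \<in> X \<and> y \<in> X) * F x y)) = (\<Sum>x\<in>X. \<Sum>y\<in>X. ?\<mu> x * ?\<mu> y * F x y)"
  proof -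
    have "(\<Sum>x\<in>V. \<Sum>y\<in>V. ?\<mu> x * ?\<mu> y * (of_bool (x \<in> X \<and> y \<in> X) * F x y)) =
       (\<Sum>x\<in>X. \<Sum>y\<in>V. ?\<mu> x * ?\<mu> y * (of_bool (x \<in> X \<and> y \<in> X) * F x y))"
      using assms(5) fin by (intro sum.mono_neutral_right) auto
    also have "\<dots> = (\<Sum>x\<in>X. \<Sum>y\<in>X. ?\<mu> x * ?\<mu> y * (of_bool (x \<in> X \<and> y \<in> X) * F x y))"
      using assms(5) fin by (intro sum.cong[OF refl] sum.mono_neutral_right) auto
    finally show ?thesis by simp
  qed
  also have "(\<Sum>x\<in>V. \<Sum>y\<in>V. ?\<mu> x * ?\<mu> y * of_bool (x \<notin> X)) = sum ?\<mu> (V - X)"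
  proof -
    have "(\<Sum>x\<in>V. \<Sum>y\<in>V. ?\<mu> x * ?\<mu> y * of_bool (x \<notin> X)) = (\<Sum>x\<in>V. ?\<mu> x * of_bool (x \<notin> X)) * sum ?\<mu> V"
      unfolding sum_product by (simp only: mult_ac)
    also have "\<dots> = sum ?\<mu> (V - X)"
      using fin by (simp add: tot of_bool_def if_distrib sum.If_cases set_diff_eq Int_def cong: if_cong)
    finally show ?thesis .
  qed
  also have "(\<Sum>x\<in>V. \<Sum>y\<in>V. ?\<mu> x * ?\<mu> y * of_bool (y \<notin> X)) = sum ?\<mu> (V - X)"
  proof -
    have "(\<Sum>x\<in>V. \<Sum>y\<in>V. ?\<mu> x * ?\<mu> y * of_bool (y \<notin> X)) = sum ?\<mu> V * (\<Sum>y\<in>V. ?\<mu> y * of_bool (y \<notin> X))"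
      unfolding sum_product by (simp only: mult.assoc)
    also have "\<dots> = sum ?\<mu> (V - X)"
      using fin by (simp add: tot of_bool_def if_distrib sum.If_cases set_diff_eq Int_def cong: if_cong)
    finally show ?thesis .
  qed
  finally show ?thesis by (simp add: F_def)
qed

section \<open>The tester as a strategy tree\<close>

primrec draw_vertices :: "nat \<Rightarrow> vdf_tester \<Rightarrow> vdf_tester" where
  "draw_vertices 0 t = t"
| "draw_vertices (Suc n) t = Draw (draw_vertices n t)"

text \<open>The questions are not adaptive: the pairs answered positively are collected and handed
  to the continuation \<open>k\<close>.\<close>

primrec ask_same :: "(nat \<times> nat) list \<Rightarrow> ((nat \<times> nat) set \<Rightarrow> vdf_tester) \<Rightarrow> vdf_tester" where
  "ask_same [] k = k {}"
| "ask_same (p # ps) k = Same_Vertex (fst p) (snd p) (\<lambda>b. ask_same ps (\<lambda>R. k (if b then insert p R else R)))"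

primrec ask_edges :: "(nat \<times> nat) list \<Rightarrow> ((nat \<times> nat) set \<Rightarrow> vdf_tester) \<Rightarrow> vdf_tester" where
  "ask_edges [] k = k {}"
| "ask_edges (p # ps) k = Edge_Query (fst p) (snd p) (\<lambda>b. ask_edges ps (\<lambda>R. k (if b then insert p R else R)))"

lemma draws_draw_vertices: "draws_at_most 0 t \<Longrightarrow> draws_at_most n (draw_vertices n t)"
  by (induction n) (auto intro: draws_at_most.intros)

lemma draws_ask_same: "(\<And>R. draws_at_most 0 (k R)) \<Longrightarrow> draws_at_most 0 (ask_same ps k)"
  by (induction ps arbitrary: k) (auto intro: draws_at_most.intros)

lemma draws_ask_edges: "(\<And>R. draws_at_most 0 (k R)) \<Longrightarrow> draws_at_most 0 (ask_edges ps k)"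
  by (induction ps arbitrary: k) (auto intro: draws_at_most.intros)

lemma run_draw_vertices:
  "run_tester G D (draw_vertices n t) xs = bind_pmf (replicate_pmf n D) (\<lambda>ys. run_tester G D t (xs @ ys))"
proof (induction n arbitrary: xs)
  case (Suc n)
  then show ?case by (simp add: bind_assoc_pmf bind_return_pmf)
qed (simp add: bind_return_pmf)

lemma run_ask_same:
  "run_tester G D (ask_same ps k) xs =
   run_tester G D (k {(i, j) \<in> set ps. i < length xs \<and> j < length xs \<and> xs ! i = xs ! j}) xs"
proof (induction ps arbitrary: k)
  case (Cons p ps)
  have "{(i, j) \<in> set (p # ps). i < length xs \<and> j < length xs \<and> xs ! i = xs ! j} =
    (if fst p < length xs \<and> snd p < length xs \<and> xs ! fst p = xs ! snd p
     then insert p {(i, j) \<in> set ps. i < length xs \<and> j < length xs \<and> xs ! i = xs ! j}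
     else {(i, j) \<in> set ps. i < length xs \<and> j < length xs \<and> xs ! i = xs ! j})"
    by auto
  then show ?case by (simp add: Cons.IH)
qed simp

lemma run_ask_edges:
  "run_tester G D (ask_edges ps k) xs =
   run_tester G D (k {(i, j) \<in> set ps. i < length xs \<and> j < length xs \<and> {xs ! i, xs ! j} \<in> edges G}) xs"
proof (induction ps arbitrary: k)
  case (Cons p ps)
  have "{(i, j) \<in> set (p # ps). i < length xs \<and> j < length xs \<and> {xs ! i, xs ! j} \<in> edges G} =
    (if fst p < length xs \<and> snd p < length xs \<and> {xs ! fst p, xs ! snd p} \<in> edges G
     then insert p {(i, j) \<in> set ps. i < length xs \<and> j < length xs \<and> {xs ! i, xs ! j} \<in> edges G}
     else {(i, j) \<in> set ps. i < length xs \<and> j < length xs \<and> {xs ! i, xs ! j} \<in> edges G})"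
    by auto
  then show ?case by (simp add: Cons.IH)
qed simp

text \<open>Each sampled vertex is represented by its first position among the samples.\<close>

definition sample_tester :: "'a ugraph set \<Rightarrow> nat \<Rightarrow> vdf_tester" where
  "sample_tester P s = draw_vertices s
     (ask_same (List.product [0..<s] [0..<s]) (\<lambda>R. ask_edges (List.product [0..<s] [0..<s]) (\<lambda>E.
        Verdict (extendable_part P {i. i < s \<and> (\<forall>j<i. (j, i) \<notin> R)} (\<lambda>i j. (i, j) \<in> E)))))"

lemma draws_sample_tester: "draws_at_most s (sample_tester P s)"
  unfolding sample_tester_def
  by (intro draws_draw_vertices draws_ask_same draws_ask_edges draws_at_most.intros)

text \<open>First positions enumerate the sampled vertices without repetition. The graph on
  positions and the graph on \<open>set ys\<close> are therefore isomorphic, and extendability is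
  pulled back in both directions.\<close>

lemma sample_tester_decision:
  assumes "length ys = s"
    and R: "R = {(i, j). i < s \<and> j < s \<and> ys ! i = ys ! j}"
    and E: "E = {(i, j). i < s \<and> j < s \<and> {ys ! i, ys ! j} \<in> edges G}"
  shows "extendable_part P {i. i < s \<and> (\<forall>j<i. (j, i) \<notin> R)} (\<lambda>i j. (i, j) \<in> E) \<longleftrightarrow>
     extendable_part P (set ys) (\<lambda>x y. {x, y} \<in> edges G)" (is "extendable_part P ?I _ \<longleftrightarrow> _")
proof -
  have I: "i \<in> ?I \<longleftrightarrow> i < s \<and> (\<forall>j<i. ys ! j \<noteq> ys ! i)" for i by (auto simp: R)
  have inj: "inj_on ((!) ys) ?I"
  proof (rule inj_onI)
    fix i j assume "i \<in> ?I" "j \<in> ?I" "ys ! i = ys ! j"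
    then show "i = j" unfolding I by (metis nat_neq_iff)
  qed
  have img: "(!) ys ` ?I = set ys"
  proof (intro equalityI subsetI)
    fix x assume "x \<in> set ys"
    then obtain i where i: "i < s" "ys ! i = x" using assms(1) by (auto simp: in_set_conv_nth)
    define l where "l = (LEAST l. ys ! l = x)"
    have "ys ! l = x" unfolding l_def by (rule LeastI[of _ i]) (rule i(2))
    moreover have "l \<le> i" unfolding l_def by (rule Least_le) (rule i(2))
    moreover have "ys ! j \<noteq> x" if "j < l" for j using that not_less_Least unfolding l_def by blast
    ultimately have "l \<in> ?I" unfolding I using i(1) by auto
    then show "x \<in> (!) ys ` ?I" using \<open>ys ! l = x\<close> by blast
  qed (use assms(1) in auto)
  let ?h = "inv_into ?I ((!) ys)"
  have h: "bij_betw ?h (set ys) ?I"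
    using bij_betw_inv_into[of "(!) ys" ?I "set ys"] inj img by (simp add: bij_betw_def)
  show ?thesis
  proof
    assume "extendable_part P ?I (\<lambda>i j. (i, j) \<in> E)"
    then show "extendable_part P (set ys) (\<lambda>x y. {x, y} \<in> edges G)"
    proof (rule extendable_part_pullback[where g = ?h])
      show "inj_on ?h (set ys)" "?h ` set ys \<subseteq> ?I" using h by (auto simp: bij_betw_def)
      fix x y assume xy: "x \<in> set ys" "y \<in> set ys" "x \<noteq> y"
      have "ys ! ?h x = x" "ys ! ?h y = y" using xy img by (simp_all add: f_inv_into_f)
      moreover have "?h x \<in> ?I" "?h y \<in> ?I" using h xy by (auto dest: bij_betwE)
      ultimately show "({x, y} \<in> edges G) = ((?h x, ?h y) \<in> E)" by (simp add: E)
    qed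
  next
    assume "extendable_part P (set ys) (\<lambda>x y. {x, y} \<in> edges G)"
    then show "extendable_part P ?I (\<lambda>i j. (i, j) \<in> E)"
      by (rule extendable_part_pullback[where g = "(!) ys"]) (use inj img in \<open>auto simp: E\<close>)
  qed
qed

lemma run_sample_tester:
  "run_tester G D (sample_tester P s) [] =
   map_pmf (\<lambda>ys. extendable_part P (set ys) (\<lambda>x y. {x, y} \<in> edges G)) (replicate_pmf s D)"
  unfolding sample_tester_def run_draw_vertices run_ask_same run_ask_edges map_pmf_def
proof (rule bind_pmf_cong[OF refl])
  fix ys assume "ys \<in> set_pmf (replicate_pmf s D)"
  then have len: "length ys = s" by (simp add: set_replicate_pmf)
  show "run_tester G D (Verdict (extendable_part P
      {i. i < s \<and> (\<forall>j<i. (j, i) \<notin> {(i, j) \<in> set (List.product [0..<s] [0..<s]).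
         i < length ([] @ ys) \<and> j < length ([] @ ys) \<and> ([] @ ys) ! i = ([] @ ys) ! j})}
      (\<lambda>i j. (i, j) \<in> {(i, j) \<in> set (List.product [0..<s] [0..<s]).
         i < length ([] @ ys) \<and> j < length ([] @ ys) \<and> {([] @ ys) ! i, ([] @ ys) ! j} \<in> edges G}))) ([] @ ys) =
    return_pmf (extendable_part P (set ys) (\<lambda>x y. {x, y} \<in> edges G))"
    unfolding run_tester.simps
    by (rule arg_cong[where f = return_pmf], rule sample_tester_decision[OF len]) (auto simp: len)
qed

text \<open>Closeness is used with \<epsilon>/2, because a distance of at most \<epsilon> would not
  contradict being \<epsilon>-far. Repeating the \<open>m\<close> draws \<open>r\<close> times
  lowers the chance of acceptance below 1/3; \<open>min c 1\<close> keeps the base of the power in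
  [0,1).\<close>

lemma far_rejected:
  fixes P :: "'a ugraph set"
  assumes P: "hereditary_property P" and \<epsilon>: "0 < \<epsilon>" "\<epsilon> < 1"
  obtains s where "\<And>G D. weighted_graph G D \<Longrightarrow> far_from \<epsilon> G D P \<Longrightarrow>
     2 / 3 \<le> pmf (run_tester G D (sample_tester P s) []) False"
proof -
  let ?Q = "extendable_part P :: 'a set \<Rightarrow> ('a \<Rightarrow> 'a \<Rightarrow> bool) \<Rightarrow> bool"
  have \<epsilon>2: "0 < \<epsilon> / 2" "\<epsilon> / 2 \<le> 1" using \<epsilon> by auto
  obtain c m where c: "0 < c" and H: "\<And>V \<mu> a. wgraph V \<mu> a \<Longrightarrow>
      c \<le> sample_prob V \<mu> (\<lambda>X. \<not> ?Q X a) m {} \<or> wgraph.close_to V \<mu> a (\<epsilon> / 2) ?Q"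
    by (rule sample_or_close[OF induced_closed_extendable_part \<epsilon>2]) (rule that; blast)
  have "1 - min c 1 < 1" "0 \<le> 1 - min c 1" using c by auto
  then obtain r where r: "(1 - min c 1) ^ r < 1 / 3"
    using real_arch_pow_inv[of "1 / 3" "1 - min c 1"] by auto
  show thesis
  proof (rule that[of "r * m"])
    fix G :: "'a ugraph" and D
    assume G: "weighted_graph G D" and far: "far_from \<epsilon> G D P"
    define a where "a x y \<longleftrightarrow> {x, y} \<in> edges G" for x y
    let ?V = "verts G"
    have simple: "simple_graph G" and D: "set_pmf D \<subseteq> ?V" using G by (auto simp: weighted_graph_def)
    have fin: "finite ?V" "?V \<noteq> {}" using simple by (auto simp: simple_graph_def)
    have tot: "sum (pmf D) ?V = 1" using fin D by (intro sum_pmf_eq_1)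
    have w: "wgraph ?V (pmf D) a"
      by unfold_locales (use fin tot in \<open>auto simp: a_def insert_commute\<close>)
    have "\<not> wgraph.close_to ?V (pmf D) a (\<epsilon> / 2) ?Q"
    proof
      assume "wgraph.close_to ?V (pmf D) a (\<epsilon> / 2) ?Q"
      then obtain X b where X: "X \<subseteq> ?V" "?Q X b" and
        le: "(\<Sum>x\<in>X. \<Sum>y\<in>X. pmf D x * pmf D y * of_bool (x \<noteq> y \<and> b x y \<noteq> a x y)) + 2 * sum (pmf D) (?V - X) \<le> \<epsilon> / 2"
        unfolding wgraph.close_to_def[OF w] by blast
      obtain H where H: "H \<in> P" "verts H = ?V"
        and edge: "\<And>x y. x \<in> X \<Longrightarrow> y \<in> X \<Longrightarrow> x \<noteq> y \<Longrightarrow> {x, y} \<in> edges H \<longleftrightarrow> b x y"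
        by (rule extend_to_member[OF P X(2,1) fin]) (rule that; blast)
      have "simple_graph H" using P H(1) by (auto simp: hereditary_property_def graph_property_def)
      then have "graph_dist D G H \<le> (\<Sum>x\<in>X. \<Sum>y\<in>X. pmf D x * pmf D y * of_bool (x \<noteq> y \<and> ({x, y} \<in> edges H) \<noteq> ({x, y} \<in> edges G)))
          + 2 * sum (pmf D) (?V - X)"
        using simple H(2) X(1) D by (intro graph_dist_le) auto
      also have "(\<Sum>x\<in>X. \<Sum>y\<in>X. pmf D x * pmf D y * of_bool (x \<noteq> y \<and> ({x, y} \<in> edges H) \<noteq> ({x, y} \<in> edges G))) =
          (\<Sum>x\<in>X. \<Sum>y\<in>X. pmf D x * pmf D y * of_bool (x \<noteq> y \<and> b x y \<noteq> a x y))"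
        using edge by (intro sum.cong refl) (auto simp: a_def)
      finally have "graph_dist D G H \<le> \<epsilon> / 2" using le by linarith
      moreover have "\<epsilon> \<le> graph_dist D G H" using far H by (simp add: far_from_def)
      ultimately show False using \<epsilon> by linarith
    qed
    then have "c \<le> sample_prob ?V (pmf D) (\<lambda>X. \<not> ?Q X a) m {}" using H[OF w] by blast
    then have le: "1 - sample_prob ?V (pmf D) (\<lambda>X. \<not> ?Q X a) m {} \<le> 1 - min c 1" by linarith
    have nn: "0 \<le> pmf D v" for v by simp
    have up: "\<not> ?Q X a \<Longrightarrow> X \<subseteq> Y \<Longrightarrow> \<not> ?Q Y a" for X Y
      using induced_closed_subset[OF induced_closed_extendable_part] by blast
    have "1 - sample_prob ?V (pmf D) (\<lambda>X. \<not> ?Q X a) (r * m) {} \<le> (1 - sample_prob ?V (pmf D) (\<lambda>X. \<not> ?Q X a) m {}) ^ r"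
      by (rule sample_prob_power[OF nn up tot])
    also have "\<dots> \<le> (1 - min c 1) ^ r"
      using le sample_prob_le_1[OF nn tot, of "\<lambda>X. \<not> ?Q X a" m "{}"] by (intro power_mono) auto
    finally have "2 / 3 \<le> sample_prob ?V (pmf D) (\<lambda>X. \<not> ?Q X a) (r * m) {}" using r by linarith
    also have "\<dots> = pmf (run_tester G D (sample_tester P (r * m)) []) False"
      using pmf_sample[OF fin(1) D, of "\<lambda>X. ?Q X a" "{}" "r * m"]
      unfolding run_sample_tester a_def by simp
    finally show "2 / 3 \<le> pmf (run_tester G D (sample_tester P (r * m)) []) False" .
  qed
qed

theorem theorem6:
  fixes P :: "'a ugraph set"
  assumes "hereditary_property P"
  shows "\<exists>(M :: real \<Rightarrow> nat) (s :: real \<Rightarrow> nat).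
    \<forall>\<epsilon>. 0 < \<epsilon> \<and> \<epsilon> < 1 \<longrightarrow>
      vdf_testable_one_sided P \<epsilon> (s \<epsilon>) (\<lambda>G D. M \<epsilon> \<le> card (verts G))"
proof -
  have "\<exists>M s. 0 < \<epsilon> \<and> \<epsilon> < 1 \<longrightarrow> vdf_testable_one_sided P \<epsilon> s (\<lambda>G D. M \<le> card (verts G))" for \<epsilon>
  proof (cases "0 < \<epsilon> \<and> \<epsilon> < 1")
    case True
    then have \<epsilon>: "0 < \<epsilon>" "\<epsilon> < 1" by auto
    obtain s where rej: "\<And>G D. weighted_graph G D \<Longrightarrow> far_from \<epsilon> G D P \<Longrightarrow>
        2 / 3 \<le> pmf (run_tester G D (sample_tester P s) []) False"
      by (rule far_rejected[OF assms \<epsilon>]) (rule that; blast)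
    \<comment> \<open>The number \<open>s\<close> of samples is already fixed, so the threshold may
      depend on it. In a member of \<open>P\<close> of this size every possible sample is
      extendable, which gives acceptance with certainty.\<close>
    obtain M where M: "\<And>G X. G \<in> P \<Longrightarrow> M \<le> card (verts G) \<Longrightarrow> finite X \<Longrightarrow> X \<subseteq> verts G \<Longrightarrow> card X \<le> s \<Longrightarrow>
        extendable_part P X (\<lambda>x y. {x, y} \<in> edges G)"
      by (rule extendable_part_threshold[of P s]) (rule that; blast)
    have acc: "pmf (run_tester G D (sample_tester P s) []) True = 1"
      if G: "weighted_graph G D" "M \<le> card (verts G)" "G \<in> P" for G and D :: "'a pmf"
    proof -
      have "extendable_part P (set ys) (\<lambda>x y. {x, y} \<in> edges G)" if "ys \<in> set_pmf (replicate_pmf s D)" for ys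
      proof (rule M[OF G(3,2)])
        show "set ys \<subseteq> verts G" using that G(1) by (auto simp: set_replicate_pmf weighted_graph_def lists_eq_set)
        show "card (set ys) \<le> s" using that card_length[of ys] by (simp add: set_replicate_pmf)
      qed simp
      then have "run_tester G D (sample_tester P s) [] = map_pmf (\<lambda>_. True) (replicate_pmf s D)"
        unfolding run_sample_tester by (intro map_pmf_cong refl) simp
      then show ?thesis by (simp add: map_pmf_const)
    qed
    have "vdf_testable_one_sided P \<epsilon> s (\<lambda>G D. M \<le> card (verts G))"
      unfolding vdf_testable_one_sided_def
      by (rule exI[of _ "sample_tester P s"]) (use draws_sample_tester rej acc in blast)
    then show ?thesis by blast
  qed blast
  then show ?thesis by metis
qed

end
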